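(* Let $M\in\mathbb{C}^{n\times n}$ be a positive-definite matrix such that $\operatorname{Re}(\bm{x}^*M\bm{x})\ge\mu_1^2$ for every unit vector $\bm{x}\in\mathbb{C}^n$, for some $\mu_1>0$, and let $\bm{b}\in\mathbb{C}^n$ be a nonzero vector. Let $\widetilde M\in\mathbb{C}^{n\times n}$ satisfy $\operatorname{Re}(\bm{x}^*\widetilde M\bm{x})\ge\mu_2^2$ for every unit vector $\bm{x}\in\mathbb{C}^n$, for some $\mu_2>0$, and $\|M-\widetilde M\|\le\epsilon\|M\|$ for some $\epsilon>0$. Let $k\ge2$ be such that $Q_k$ and $H_k$ of the Arnoldi process for $\widetilde M$ and $\bm{b}$ are defined. Then $$\|M^{1/2}\bm{b}-\operatorname{Arn}_k(x^{1/2};\widetilde M,\bm{b})\|\le\frac{\epsilon\,\sigma_{\max}(M)}{\mu_1+\mu_2}\|\bm{b}\|+\frac{\Gamma(3/4)(1+\epsilon)^{3/2}}{2^{1/4}\pi}\,\frac{2k}{2k-3}\,(\sigma_{\max}(M))^{3/2}\,k^{-3/4}\,\|\bm{\xi}_0^k\|,$$ where $\Gamma(\cdot)$ is the Gamma function, $\sigma_{\max}(M)$ is the largest singular value of $M$, and $\bm{\xi}_0^k:=\widetilde M^{-1}\bm{b}-Q_kH_k^{-1}\|\bm{b}\|\bm{e}_1$.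
   Context: $\|\cdot\|$ is the Euclidean norm for vectors and the induced spectral norm for matrices. A matrix $A\in\mathbb{C}^{n\times n}$ is called positive-definite if $\operatorname{Re}(\bm{x}^*A\bm{x})>0$ for every unit vector $\bm{x}\in\mathbb{C}^n$ ($A$ need not be Hermitian). For such $A$, $A^{1/2}$ denotes its unique positive-definite square root, i.e. the principal square root (the matrix function of $x^{1/2}$ with the principal branch, branch cut along the negative real axis). $H_k$ below is then also positive-definite, and $H_k^{1/2}$ is defined in the same way. Arnoldi process for $\widetilde M$ and $\bm{b}\ne\bm 0$: set $\bm{q}_1=\bm{b}/\|\bm{b}\|$. For $j=1,2,\dots,k$: start with $\bm{w}=\widetilde M\bm{q}_j$; for $i=1,\dots,j$ successively put $h_{i,j}=\bm{q}_i^*\bm{w}$ and replace $\bm{w}$ by $\bm{w}-h_{i,j}\bm{q}_i$; then put $h_{j+1,j}=\|\bm{w}\|$, stop if $h_{j+1,j}=0$, and otherwise put $\bm{q}_{j+1}=\bm{w}/h_{j+1,j}$. It is understood that the process does not stop before step $k$ (i.e. $h_{j+1,j}\ne0$ for $1\le j<k$). Then $Q_k=[\bm{q}_1,\dots,\bm{q}_k]$ has orthonormal columns, $H_k=[h_{i,j}]_{i,j=1}^k$ is upper Hessenberg (with $h_{i,j}=0$ for $i>j+1$), and $H_k=Q_k^*\widetilde MQ_k$. $\operatorname{Arn}_k(x^{1/2};\widetilde M,\bm{b}):=Q_kH_k^{1/2}Q_k^*\bm{b}=\|\bm{b}\|Q_kH_k^{1/2}\bm{e}_1$, with $\bm{e}_1$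 the first canonical basis vector of $\mathbb{C}^k$. The vector $\bm{\xi}_0^k$ is the error of the $k$-th iterate of the Full Orthogonalization Method (zero initial guess) for $\widetilde M\bm{x}=\bm{b}$. *)

theory Defs
  imports
    "HOL-Analysis.Gamma_Function"
    "Jordan_Normal_Form.Gauss_Jordan_Elimination"
    "Jordan_Normal_Form.Schur_Decomposition"
begin

hide_const (open) Finite_Cartesian_Product.vec Finite_Cartesian_Product.mat
no_notation Finite_Cartesian_Product.vec_nth (infixl "$" 90)
no_notation Inner_Product.real_inner_class.inner (infix "\<bullet>" 70)

definition vnorm :: "complex vec \<Rightarrow> real" where
  "vnorm v = sqrt (\<Sum>i<dim_vec v. (cmod (v $ i))\<^sup>2)"

text \<open>The supremum is over the unit sphere, which is nonempty only if \<open>A\<close> has at least one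
  column.\<close>

definition spectral_norm :: "complex mat \<Rightarrow> real" where
  "spectral_norm A = (SUP x \<in> {x \<in> carrier_vec (dim_col A). vnorm x = 1}. vnorm (A *\<^sub>v x))"

definition singular_values :: "complex mat \<Rightarrow> real set" where
  "singular_values A =
     {s. 0 \<le> s \<and> eigenvalue (mat_adjoint A * A) (complex_of_real (s\<^sup>2))}"

definition sigma_max :: "complex mat \<Rightarrow> real" where
  "sigma_max A = Max (singular_values A)"

text \<open>Since \<open>u \<bullet>c v\<close> conjugates its second argument, \<open>v\<^sup>* u\<close> is written \<open>u \<bullet>c v\<close> throughout.\<close>

definition herm_form :: "complex mat \<Rightarrow> complex vec \<Rightarrow> complex" where
  "herm_form A x = (A *\<^sub>v x) \<bullet>c x"

definition positive_definite :: "complex mat \<Rightarrow> bool" where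
  "positive_definite A \<longleftrightarrow> square_mat A \<and>
     (\<forall>x \<in> carrier_vec (dim_row A). vnorm x = 1 \<longrightarrow> Re (herm_form A x) > 0)"

text \<open>The unique positive-definite square root of a (not necessarily Hermitian)
  positive-definite matrix, which is its principal square root.\<close>

definition mat_sqrt :: "complex mat \<Rightarrow> complex mat" where
  "mat_sqrt A =
     (THE X. X \<in> carrier_mat (dim_row A) (dim_row A) \<and> positive_definite X \<and> X * X = A)"

text \<open>Unspecified if \<open>A\<close> is not an invertible square matrix.\<close>

definition mat_inv :: "complex mat \<Rightarrow> complex mat" where
  "mat_inv A = the (mat_inverse A)"

text \<open>The Arnoldi process (modified Gram--Schmidt), with indices starting at \<open>0\<close>:
  \<open>arnoldi_q A b j\<close> is the basis vector usually written \<open>q\<^bsub>j+1\<^esub>\<close>, and \<open>arnoldi_w A b j i\<close> is the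
  content of the work vector, started as \<open>A q\<^bsub>j+1\<^esub>\<close>, after \<open>i\<close> of the \<open>j+1\<close> orthogonalisation
  steps against \<open>q\<^sub>1, \<dots>, q\<^bsub>j+1\<^esub>\<close>. Once the process has stopped, the values are meaningless.\<close>

function arnoldi_q :: "complex mat \<Rightarrow> complex vec \<Rightarrow> nat \<Rightarrow> complex vec"
  and arnoldi_w :: "complex mat \<Rightarrow> complex vec \<Rightarrow> nat \<Rightarrow> nat \<Rightarrow> complex vec" where
  "arnoldi_q A b 0 = complex_of_real (1 / vnorm b) \<cdot>\<^sub>v b"
| "arnoldi_q A b (Suc j) =
     complex_of_real (1 / vnorm (arnoldi_w A b j (Suc j))) \<cdot>\<^sub>v arnoldi_w A b j (Suc j)"
| "arnoldi_w A b j 0 = A *\<^sub>v arnoldi_q A b j"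
| "arnoldi_w A b j (Suc i) =
     arnoldi_w A b j i - (arnoldi_w A b j i \<bullet>c arnoldi_q A b i) \<cdot>\<^sub>v arnoldi_q A b i"
  by pat_completeness auto
termination
  by (relation "measures [case_sum (\<lambda>(A, b, j). j) (\<lambda>(A, b, j, i). max j (i - 1)),
                          case_sum (\<lambda>(A, b, j). 0) (\<lambda>(A, b, j, i). Suc i)]")
     (auto simp: max_def)

text \<open>\<open>arnoldi_h A b i j\<close> is the coefficient usually written \<open>h\<^bsub>i+1,j+1\<^esub>\<close>.\<close>

definition arnoldi_h :: "complex mat \<Rightarrow> complex vec \<Rightarrow> nat \<Rightarrow> nat \<Rightarrow> complex" where
  "arnoldi_h A b i j =
     (if i \<le> j then arnoldi_w A b j i \<bullet>c arnoldi_q A b i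
      else if i = Suc j then complex_of_real (vnorm (arnoldi_w A b j (Suc j)))
      else 0)"

text \<open>The process does not stop before step \<open>k\<close>; \<open>h\<^bsub>k+1,k\<^esub> = 0\<close> is allowed.\<close>

definition arnoldi_defined :: "complex mat \<Rightarrow> complex vec \<Rightarrow> nat \<Rightarrow> bool" where
  "arnoldi_defined A b k \<longleftrightarrow> (\<forall>j. Suc j < k \<longrightarrow> arnoldi_h A b (Suc j) j \<noteq> 0)"

definition arnoldi_Q :: "complex mat \<Rightarrow> complex vec \<Rightarrow> nat \<Rightarrow> complex mat" where
  "arnoldi_Q A b k = mat_of_cols (dim_vec b) (map (arnoldi_q A b) [0..<k])"

definition arnoldi_H :: "complex mat \<Rightarrow> complex vec \<Rightarrow> nat \<Rightarrow> complex mat" where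
  "arnoldi_H A b k = mat k k (\<lambda>(i, j). arnoldi_h A b i j)"

definition Arn_sqrt :: "complex mat \<Rightarrow> complex vec \<Rightarrow> nat \<Rightarrow> complex vec" where
  "Arn_sqrt A b k =
     arnoldi_Q A b k *\<^sub>v
       (mat_sqrt (arnoldi_H A b k) *\<^sub>v (mat_adjoint (arnoldi_Q A b k) *\<^sub>v b))"

text \<open>Error of the \<open>k\<close>-th iterate of the Full Orthogonalization Method for \<open>A x = b\<close>
  with zero initial guess.\<close>

definition fom_error :: "complex mat \<Rightarrow> complex vec \<Rightarrow> nat \<Rightarrow> complex vec" where
  "fom_error A b k =
     mat_inv A *\<^sub>v b -
     arnoldi_Q A b k *\<^sub>v
       (mat_inv (arnoldi_H A b k) *\<^sub>v (complex_of_real (vnorm b) \<cdot>\<^sub>v unit_vec k 0))"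

end

theory Submission
  imports Defs
begin

text \<open>Write \<open>A\<close> for the perturbed matrix, \<open>X\<close> and \<open>Y\<close> for the roots of \<open>M\<close> and \<open>A\<close>, and split the
  error at \<open>Y b\<close>. The first part is bounded through the Sylvester equation
  \<open>X (X - Y) + (X - Y) Y = M - A\<close>, tested on a singular vector of \<open>X - Y\<close> to its largest singular
  value, since the forms of \<open>X\<close> and \<open>Y\<close> are bounded below by \<open>\<mu>1\<close> and \<open>\<mu>2\<close>.

  For the second part, with \<open>p = cos\<^sup>2 \<theta>\<close> and \<open>q = sin\<^sup>2 \<theta>\<close>, the formula
  \<open>Y b = 2/\<pi> \<integral> A (p A + q)\<^sup>-\<^sup>1 b d\<theta>\<close> over \<open>[0, \<pi>/2]\<close> and its analogue for \<open>H\<^sub>k\<close> reduce the error to the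
  errors of the Full Orthogonalization Method for the shifted systems. Their residuals are collinear,
  so the integrand is \<open>- q p\<^bsup>k-1\<^esup> det H\<^sub>k / det (p H\<^sub>k + q)\<close> times \<open>A (p A + q)\<^sup>-\<^sup>1 \<xi>\<^sub>0\<close>. Positivity of
  the real parts bounds the determinant quotient by \<open>(p\<^sup>2 + (q/s)\<^sup>2)\<^bsup>-k/2\<^esup>\<close> whenever \<open>\<parallel>A\<parallel> \<le> s\<close>, and the
  resulting integral is a Beta function.\<close>

section \<open>Euclidean norm, adjoints and quadratic forms\<close>

text \<open>The matrices need not be normal, so the spectral theorem is not at hand: every estimate
  comes from the lower bound on the real part of the form and from an upper bound on the norm, and
  both pass from the matrix to its compression \<open>arnoldi_H\<close>. The integral formula is the
  classical one, 2/pi times the integral of A (A + t^2)^-1 over the half-line, with t = tan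
  \<theta>; the substitution makes the interval compact and p A + q uniformly coercive on it, as p +
  q = 1. Vector-valued integration is avoided by pairing with a fixed vector, in the end with the
  error itself. The constants arise as follows. The norm bound s = (1 + \<epsilon>)
  \<open>sigma_max M\<close> for the perturbed matrix leaves the Beta integral as s^(3/2). One of
  the k - 1 factors p is spent on bounding p A (p A + q)^-1 by 1 in norm; p^(k-2) stays under the
  integral, which is finite only for k \<ge> 2. Log-convexity of Gamma near k/2 yields k^(-3/4) with
  the factor 2k/(2k-3).\<close>

lemma vnorm_L2_set: "vnorm v = L2_set (\<lambda>i. cmod (v $ i)) {..<dim_vec v}"
  by (simp add: vnorm_def L2_set_def)

lemma vnorm_nonneg [simp]: "0 \<le> vnorm v"
  by (simp add: vnorm_L2_set L2_set_nonneg)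

lemma cscalar_self: "v \<bullet>c v = complex_of_real ((vnorm v)\<^sup>2)"
proof -
  have "v \<bullet>c v = (\<Sum>i<dim_vec v. complex_of_real ((cmod (v $ i))\<^sup>2))"
    unfolding scalar_prod_def
    by (simp add: atLeast0LessThan complex_norm_square[symmetric] conjugate_complex_def)
  then show ?thesis
    by (simp add: vnorm_def sum_nonneg)
qed

lemma vnorm_eq_0_iff: "v \<in> carrier_vec n \<Longrightarrow> vnorm v = 0 \<longleftrightarrow> v = 0\<^sub>v n"
  using conjugate_square_eq_0_vec[of v n] by (simp add: cscalar_self)

lemma vnorm_zero [simp]: "vnorm (0\<^sub>v n) = 0"
  by (simp add: vnorm_def)

lemma vnorm_pos: "v \<in> carrier_vec n \<Longrightarrow> v \<noteq> 0\<^sub>v n \<Longrightarrow> 0 < vnorm v"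
  using vnorm_eq_0_iff[of v n] vnorm_nonneg[of v] by linarith

lemma vnorm_ge_entry: "i < dim_vec v \<Longrightarrow> cmod (v $ i) \<le> vnorm v"
  unfolding vnorm_L2_set by (rule member_le_L2_set) auto

lemma vnorm_unit_vec: "j < n \<Longrightarrow> vnorm (unit_vec n j) = 1"
proof -
  assume j: "j < n"
  have "(\<Sum>i<n. (cmod (unit_vec n j $ i))\<^sup>2) = (\<Sum>i<n. if i = j then 1 else 0)"
    using j by (intro sum.cong) auto
  then show ?thesis using j by (simp add: vnorm_def)
qed

lemma vnorm_smult: "vnorm (a \<cdot>\<^sub>v v) = cmod a * vnorm v"
  by (auto simp: vnorm_L2_set norm_mult L2_set_right_distrib intro!: L2_set_cong)

lemma vnorm_triangle:
  assumes "x \<in> carrier_vec n" "y \<in> carrier_vec n"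
  shows "vnorm (x + y) \<le> vnorm x + vnorm y"
proof -
  have "vnorm (x + y) \<le> L2_set (\<lambda>i. cmod (x $ i) + cmod (y $ i)) {..<n}"
    using assms by (auto simp: vnorm_L2_set intro!: L2_set_mono norm_triangle_ineq)
  also have "\<dots> \<le> vnorm x + vnorm y"
    using assms L2_set_triangle_ineq by (auto simp: vnorm_L2_set)
  finally show ?thesis .
qed

lemma vnorm_uminus: "vnorm (- v) = vnorm v"
  by (simp add: vnorm_def)

lemma vnorm_triangle_minus:
  assumes "x \<in> carrier_vec n" "y \<in> carrier_vec n"
  shows "vnorm (x - y) \<le> vnorm x + vnorm y"
  using vnorm_triangle[of x n "- y"] assms
  by (simp add: vnorm_uminus minus_add_uminus_vec)

lemma cscalar_add_left:
  "\<lbrakk>x \<in> carrier_vec n; y \<in> carrier_vec n; z \<in> carrier_vec n\<rbrakk> \<Longrightarrow> (x + y) \<bullet>c z = x \<bullet>c z + y \<bullet>c z"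
  by (simp add: add_scalar_prod_distrib)

lemma cscalar_diff_left:
  "\<lbrakk>x \<in> carrier_vec n; y \<in> carrier_vec n; z \<in> carrier_vec n\<rbrakk> \<Longrightarrow> (x - y) \<bullet>c z = x \<bullet>c z - y \<bullet>c z"
  by (simp add: minus_scalar_prod_distrib)

lemma cscalar_add_right:
  "\<lbrakk>x \<in> carrier_vec n; y \<in> carrier_vec n; z \<in> carrier_vec n\<rbrakk> \<Longrightarrow> z \<bullet>c (x + y) = z \<bullet>c x + z \<bullet>c y"
  by (simp add: conjugate_add_vec scalar_prod_add_distrib)

lemma conjugate_minus_vec:
  fixes x y :: "complex vec"
  shows "\<lbrakk>x \<in> carrier_vec n; y \<in> carrier_vec n\<rbrakk> \<Longrightarrow> conjugate (x - y) = conjugate x - conjugate y"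
  by (intro eq_vecI) (auto simp: conjugate_complex_def)

lemma cscalar_diff_right:
  "\<lbrakk>x \<in> carrier_vec n; y \<in> carrier_vec n; (z :: complex vec) \<in> carrier_vec n\<rbrakk> \<Longrightarrow>
    z \<bullet>c (x - y) = z \<bullet>c x - z \<bullet>c y"
  by (simp add: conjugate_minus_vec scalar_prod_minus_distrib)

lemma cscalar_smult_left:
  "\<lbrakk>x \<in> carrier_vec n; z \<in> carrier_vec n\<rbrakk> \<Longrightarrow> (a \<cdot>\<^sub>v x) \<bullet>c z = a * (x \<bullet>c z)"
  by simp

lemma cscalar_smult_right:
  "\<lbrakk>x \<in> carrier_vec n; z \<in> carrier_vec n\<rbrakk> \<Longrightarrow> z \<bullet>c (a \<cdot>\<^sub>v x) = cnj a * (z \<bullet>c x)"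
  by (simp add: conjugate_smult_vec conjugate_complex_def)

lemmas cscalar_simps = cscalar_add_left cscalar_diff_left cscalar_add_right cscalar_diff_right
  cscalar_smult_left cscalar_smult_right

lemma cscalar_cnj:
  assumes "x \<in> carrier_vec n" "y \<in> carrier_vec n"
  shows "y \<bullet>c x = cnj (x \<bullet>c y)"
proof -
  have "y \<bullet>c x = conjugate (conjugate y \<bullet> x)"
    using conjugate_sprod_vec[of "conjugate y" n x] assms by simp
  also have "conjugate y \<bullet> x = x \<bullet>c y"
    using assms by (intro comm_scalar_prod[of _ n]) auto
  finally show ?thesis by (simp add: conjugate_complex_def)
qed

lemma Re_cscalar_sym:
  "x \<in> carrier_vec n \<Longrightarrow> y \<in> carrier_vec n \<Longrightarrow> Re (y \<bullet>c x) = Re (x \<bullet>c y)"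
  by (subst cscalar_cnj[of x n y]) auto

lemma cscalar_Cauchy_Schwarz:
  assumes "x \<in> carrier_vec n" "y \<in> carrier_vec n"
  shows "cmod (x \<bullet>c y) \<le> vnorm x * vnorm y"
proof -
  have "x \<bullet>c y = (\<Sum>i<n. x $ i * cnj (y $ i))"
    using assms by (simp add: scalar_prod_def atLeast0LessThan conjugate_complex_def)
  then have "cmod (x \<bullet>c y) \<le> (\<Sum>i<n. \<bar>cmod (x $ i)\<bar> * \<bar>cmod (y $ i)\<bar>)"
    by (auto simp: norm_mult intro!: sum_norm_le)
  also have "\<dots> \<le> vnorm x * vnorm y"
    using assms L2_set_mult_ineq[of "\<lambda>i. cmod (x $ i)" "\<lambda>i. cmod (y $ i)"]
    by (auto simp: vnorm_L2_set)
  finally show ?thesis .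
qed

lemma Re_cscalar_le:
  "x \<in> carrier_vec n \<Longrightarrow> y \<in> carrier_vec n \<Longrightarrow> Re (x \<bullet>c y) \<le> vnorm x * vnorm y"
  using cscalar_Cauchy_Schwarz[of x n y] complex_Re_le_cmod[of "x \<bullet>c y"] by linarith

section \<open>Adjoints, operator bounds and invertibility\<close>

lemma mat_adjoint_carrier: "A \<in> carrier_mat n m \<Longrightarrow> mat_adjoint A \<in> carrier_mat m n"
  by (auto simp: mat_adjoint_def)

lemma mat_adjoint_dim [simp]:
  "dim_row (mat_adjoint A) = dim_col A" "dim_col (mat_adjoint A) = dim_row A"
  by (simp_all add: mat_adjoint_def)

lemma mat_adjoint_index:
  assumes "(A :: complex mat) \<in> carrier_mat n m" "i < m" "j < n"
  shows "mat_adjoint A $$ (i, j) = cnj (A $$ (j, i))"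
  using assms by (auto simp: mat_adjoint_def mat_of_rows_def conjugate_complex_def)

lemma cscalar_adjoint:
  assumes A: "(A :: complex mat) \<in> carrier_mat n m" and x: "x \<in> carrier_vec m" and y: "y \<in> carrier_vec n"
  shows "(A *\<^sub>v x) \<bullet>c y = x \<bullet>c (mat_adjoint A *\<^sub>v y)"
proof -
  have "(A *\<^sub>v x) \<bullet>c y = (\<Sum>i<n. \<Sum>j<m. A $$ (i, j) * x $ j * cnj (y $ i))"
    using assms by (auto simp: scalar_prod_def atLeast0LessThan conjugate_complex_def
        sum_distrib_right intro!: sum.cong)
  also have "\<dots> = (\<Sum>j<m. \<Sum>i<n. A $$ (i, j) * x $ j * cnj (y $ i))"
    by (rule sum.swap)
  also have "\<dots> = x \<bullet>c (mat_adjoint A *\<^sub>v y)"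
    using assms
    by (auto simp: scalar_prod_def atLeast0LessThan conjugate_complex_def
        sum_distrib_left mat_adjoint_index[OF A] mult_ac intro!: sum.cong)
  finally show ?thesis .
qed

lemma mat_adjoint_adjoint [simp]: "mat_adjoint (mat_adjoint (A :: complex mat)) = A"
proof -
  have A: "A \<in> carrier_mat (dim_row A) (dim_col A)" by simp
  show ?thesis
    by (intro eq_matI) (auto simp: mat_adjoint_index[OF mat_adjoint_carrier[OF A]]
        mat_adjoint_index[OF A])
qed

lemma vec_diff_add_diff:
  "\<lbrakk>u \<in> carrier_vec n; v \<in> carrier_vec n; w \<in> carrier_vec n\<rbrakk> \<Longrightarrow> (u - v) + (v - w) = u - (w :: complex vec)"
  by (intro eq_vecI) auto

lemma vec_diff_add:
  "\<lbrakk>u \<in> carrier_vec n; v \<in> carrier_vec n; w \<in> carrier_vec n\<rbrakk> \<Longrightarrow> u - (v + w) = u - v - (w :: complex vec)"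
  by (intro eq_vecI) auto

lemma mult_mat_vec_zero:
  "A \<in> carrier_mat n m \<Longrightarrow> A *\<^sub>v 0\<^sub>v m = (0\<^sub>v n :: complex vec)"
  by (intro eq_vecI) auto

text \<open>Each entry of \<open>A *\<^sub>v x\<close> is a row paired with \<open>x\<close>, so
  Cauchy-Schwarz by rows gives the Frobenius norm as a bound. The added 1 keeps \<open>K\<close>
  positive even for the zero matrix; later proofs divide by \<open>K\<close>.\<close>

lemma mult_mat_vec_norm_bound:
  assumes A: "(A :: complex mat) \<in> carrier_mat n m"
  shows "\<exists>K>0. \<forall>x \<in> carrier_vec m. vnorm (A *\<^sub>v x) \<le> K * vnorm x"
proof -
  define R where "R = (\<lambda>i. vnorm (conjugate (row A i)))"
  have "vnorm (A *\<^sub>v x) \<le> (L2_set R {..<n} + 1) * vnorm x" if x: "x \<in> carrier_vec m" for x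
  proof -
    have c: "cmod ((A *\<^sub>v x) $ i) \<le> R i * vnorm x" if "i < n" for i
    proof -
      have "(A *\<^sub>v x) $ i = x \<bullet>c conjugate (row A i)"
        using A x that by (simp add: comm_scalar_prod[of "row A i" m x])
      then show ?thesis
        using cscalar_Cauchy_Schwarz[of x m "conjugate (row A i)"] A x that
        by (simp add: R_def mult.commute)
    qed
    have "vnorm (A *\<^sub>v x) \<le> L2_set (\<lambda>i. R i * vnorm x) {..<n}"
      using A c by (auto simp: vnorm_L2_set intro!: L2_set_mono)
    also have "\<dots> = L2_set R {..<n} * vnorm x"
      by (simp add: L2_set_left_distrib)
    finally show ?thesis by (simp add: distrib_right add_increasing2)
  qed
  moreover have "L2_set R {..<n} + 1 > 0"
    using L2_set_nonneg[of R "{..<n}"] by linarith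
  ultimately show ?thesis by blast
qed

text \<open>\<open>mat_inv\<close> is unspecified on singular matrices; this is the gateway to it. A
  trivial kernel gives a nonzero determinant, hence a unit of the matrix ring, on which
  \<open>mat_inverse\<close> returns \<open>Some\<close>.\<close>

lemma mat_inverse_exists:
  assumes A: "(A :: complex mat) \<in> carrier_mat n n"
    and ker: "\<And>x. x \<in> carrier_vec n \<Longrightarrow> A *\<^sub>v x = 0\<^sub>v n \<Longrightarrow> x = 0\<^sub>v n"
  shows "det A \<noteq> 0"
    and "mat_inv A \<in> carrier_mat n n" "A * mat_inv A = 1\<^sub>m n" "mat_inv A * A = 1\<^sub>m n"
proof -
  show d: "det A \<noteq> 0"
    using det_0_iff_vec_prod_zero_field[OF A] ker by blast
  have "mat_inverse A \<noteq> None"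
    using mat_inverse(1)[OF A, of "()"] det_non_zero_imp_unit[OF A d, of "()"] by blast
  then have "mat_inverse A = Some (mat_inv A)"
    by (auto simp: mat_inv_def)
  from mat_inverse(2)[OF A this]
  show "mat_inv A \<in> carrier_mat n n" "A * mat_inv A = 1\<^sub>m n" "mat_inv A * A = 1\<^sub>m n" by auto
qed

lemma exists_unit_multiple:
  assumes x: "x \<in> carrier_vec n" "x \<noteq> 0\<^sub>v n"
  obtains u where "u \<in> carrier_vec n" "vnorm u = 1" "x = complex_of_real (vnorm x) \<cdot>\<^sub>v u"
proof
  note p = vnorm_pos[OF x]
  show "complex_of_real (1 / vnorm x) \<cdot>\<^sub>v x \<in> carrier_vec n" using x by simp
  show "vnorm (complex_of_real (1 / vnorm x) \<cdot>\<^sub>v x) = 1"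
    using p by (simp add: vnorm_smult norm_divide)
  show "x = complex_of_real (vnorm x) \<cdot>\<^sub>v (complex_of_real (1 / vnorm x) \<cdot>\<^sub>v x)"
    using p x by (simp add: smult_smult_assoc)
qed

section \<open>Quadratic forms and coercivity\<close>

lemma herm_form_smult:
  assumes "A \<in> carrier_mat n n" "x \<in> carrier_vec n"
  shows "herm_form A (complex_of_real r \<cdot>\<^sub>v x) = of_real (r\<^sup>2) * herm_form A x"
  unfolding herm_form_def using assms
  by (simp add: mult_mat_vec[of _ n n] conjugate_smult_vec conjugate_complex_def power2_eq_square)

text \<open>The form is homogeneous of degree two, so a bound on the unit sphere scales to all
  vectors. The zero vector cannot be normalised and is treated apart.\<close>

lemma herm_form_lower_bound:
  assumes A: "A \<in> carrier_mat n n"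
    and lb: "\<And>x. x \<in> carrier_vec n \<Longrightarrow> vnorm x = 1 \<Longrightarrow> Re (herm_form A x) \<ge> m"
    and x: "x \<in> carrier_vec n"
  shows "Re (herm_form A x) \<ge> m * (vnorm x)\<^sup>2"
proof (cases "x = 0\<^sub>v n")
  case True
  then show ?thesis using A by (simp add: herm_form_def mult_mat_vec_zero)
next
  case False
  obtain u where u: "u \<in> carrier_vec n" "vnorm u = 1" "x = complex_of_real (vnorm x) \<cdot>\<^sub>v u"
    using exists_unit_multiple[OF x False] .
  have "Re (herm_form A x) = (vnorm x)\<^sup>2 * Re (herm_form A u)"
    by (subst u(3)) (simp add: herm_form_smult[OF A u(1)])
  then show ?thesis
    using mult_left_mono[OF lb[OF u(1,2)], of "(vnorm x)\<^sup>2"] by (simp add: mult.commute)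
qed

lemma mat_vec_smult_one:
  "x \<in> carrier_vec n \<Longrightarrow> (a \<cdot>\<^sub>m 1\<^sub>m n) *\<^sub>v x = a \<cdot>\<^sub>v (x :: complex vec)"
  by (intro eq_vecI) auto

lemma smult_mat_mult_vec:
  assumes "A \<in> carrier_mat n m" "x \<in> carrier_vec m"
  shows "(a \<cdot>\<^sub>m A) *\<^sub>v x = a \<cdot>\<^sub>v (A *\<^sub>v (x :: complex vec))"
  using assms by (intro eq_vecI) auto

lemma vnorm_diff_sq:
  assumes "x \<in> carrier_vec n" "y \<in> carrier_vec n"
  shows "(vnorm (x - y))\<^sup>2 = (vnorm x)\<^sup>2 - 2 * Re (y \<bullet>c x) + (vnorm y)\<^sup>2"
proof -
  have "complex_of_real ((vnorm (x - y))\<^sup>2) = (x - y) \<bullet>c (x - y)"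
    by (simp add: cscalar_self)
  also have "\<dots> = x \<bullet>c x - y \<bullet>c x - x \<bullet>c y + y \<bullet>c y"
    using assms by (simp add: cscalar_simps[where n=n])
  finally have "Re (complex_of_real ((vnorm (x - y))\<^sup>2)) = Re (x \<bullet>c x - y \<bullet>c x - x \<bullet>c y + y \<bullet>c y)"
    by (rule arg_cong)
  then show ?thesis
    using Re_cscalar_sym[OF assms] by (simp add: cscalar_self del: of_real_power)
qed

lemma vnorm_add_sq:
  assumes "x \<in> carrier_vec n" "y \<in> carrier_vec n"
  shows "(vnorm (x + y))\<^sup>2 = (vnorm x)\<^sup>2 + 2 * Re (y \<bullet>c x) + (vnorm y)\<^sup>2"
proof -
  have "complex_of_real ((vnorm (x + y))\<^sup>2) = (x + y) \<bullet>c (x + y)"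
    by (simp add: cscalar_self)
  also have "\<dots> = x \<bullet>c x + y \<bullet>c x + x \<bullet>c y + y \<bullet>c y"
    using assms by (simp add: cscalar_simps[where n=n])
  finally have "Re (complex_of_real ((vnorm (x + y))\<^sup>2)) = Re (x \<bullet>c x + y \<bullet>c x + x \<bullet>c y + y \<bullet>c y)"
    by (rule arg_cong)
  then show ?thesis
    using Re_cscalar_sym[OF assms] by (simp add: cscalar_self del: of_real_power)
qed

lemma lower_bound_trivial_kernel:
  assumes A: "A \<in> carrier_mat n n" and d: "d > 0"
    and lb: "\<And>x. x \<in> carrier_vec n \<Longrightarrow> Re (herm_form A x) \<ge> d * (vnorm x)\<^sup>2"
    and x: "x \<in> carrier_vec n" "A *\<^sub>v x = 0\<^sub>v n"
  shows "x = 0\<^sub>v n"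
proof -
  have "d * (vnorm x)\<^sup>2 \<le> 0" using lb[OF x(1)] x by (simp add: herm_form_def)
  then have "vnorm x = 0" using d by (simp add: mult_le_0_iff)
  then show ?thesis using vnorm_eq_0_iff[OF x(1)] by simp
qed

section \<open>Extremal eigenvectors and the Sylvester equation\<close>

text \<open>Compactness of the unit sphere is avoided: if \<open>B = P - \<lambda>\<close> with the infimum \<open>\<lambda>\<close> of the
  quadratic form were invertible, then \<open>\<parallel>B x\<parallel>\<^sup>2 \<le> K \<cdot> x\<^sup>* B x\<close>, valid for positive
  semidefinite \<open>B\<close>, would push the form uniformly above \<open>\<lambda>\<close>.\<close>

lemma hermitian_min_eigenvector:
  fixes P :: "complex mat"
  assumes P: "P \<in> carrier_mat n n" and n: "n > 0"
    and herm: "\<And>x y. x \<in> carrier_vec n \<Longrightarrow> y \<in> carrier_vec n \<Longrightarrow> (P *\<^sub>v x) \<bullet>c y = x \<bullet>c (P *\<^sub>v y)"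
  obtains l v where "v \<in> carrier_vec n" "vnorm v = 1" "P *\<^sub>v v = complex_of_real l \<cdot>\<^sub>v v"
    "\<And>x. x \<in> carrier_vec n \<Longrightarrow> Re (herm_form P x) \<ge> l * (vnorm x)\<^sup>2"
proof -
  define S where "S = (\<lambda>x. Re (herm_form P x)) ` {x \<in> carrier_vec n. vnorm x = 1}"
  define l where "l = Inf S"
  obtain K0 where K0: "K0 > 0" "\<And>x. x \<in> carrier_vec n \<Longrightarrow> vnorm (P *\<^sub>v x) \<le> K0 * vnorm x"
    using mult_mat_vec_norm_bound[OF P] by blast
  have "unit_vec n 0 \<in> carrier_vec n" "vnorm (unit_vec n 0) = 1"
    using n by (auto intro: vnorm_unit_vec)
  then have ne: "S \<noteq> {}" unfolding S_def by blast
  have bdd: "bdd_below S"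
  proof (rule bdd_belowI[of _ "-K0"])
    fix s assume "s \<in> S"
    then obtain x where x: "x \<in> carrier_vec n" "vnorm x = 1" "s = Re (herm_form P x)"
      unfolding S_def by blast
    have "cmod (herm_form P x) \<le> K0"
      using cscalar_Cauchy_Schwarz[of "P *\<^sub>v x" n x] K0(2)[OF x(1)] P x
      by (simp add: herm_form_def)
    then show "-K0 \<le> s"
      using abs_Re_le_cmod[of "herm_form P x"] x(3) by linarith
  qed
  have low: "Re (herm_form P x) \<ge> l * (vnorm x)\<^sup>2" if "x \<in> carrier_vec n" for x
    by (rule herm_form_lower_bound[OF P _ that])
      (auto simp: l_def S_def intro!: cInf_lower bdd[unfolded S_def])
  define B where "B = P - complex_of_real l \<cdot>\<^sub>m 1\<^sub>m n"
  have B: "B \<in> carrier_mat n n" unfolding B_def using P by auto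
  have Bv: "B *\<^sub>v x = P *\<^sub>v x - complex_of_real l \<cdot>\<^sub>v x" if "x \<in> carrier_vec n" for x
    using P that by (simp add: B_def minus_mult_distrib_mat_vec[of _ n n] mat_vec_smult_one)
  have Bc [simp]: "B *\<^sub>v x \<in> carrier_vec n" if "x \<in> carrier_vec n" for x
    using B that by simp
  have Bherm: "(B *\<^sub>v x) \<bullet>c y = x \<bullet>c (B *\<^sub>v y)" if "x \<in> carrier_vec n" "y \<in> carrier_vec n" for x y
    using P that herm[OF that] by (simp add: Bv cscalar_simps[where n=n])
  have Bform: "Re ((B *\<^sub>v x) \<bullet>c x) = Re (herm_form P x) - l * (vnorm x)\<^sup>2"
    if "x \<in> carrier_vec n" for x
    using P that by (simp add: Bv cscalar_simps[where n=n] herm_form_def cscalar_self)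
  have psd: "Re ((B *\<^sub>v x) \<bullet>c x) \<ge> 0" if "x \<in> carrier_vec n" for x
    using Bform[OF that] low[OF that] by linarith
  have "\<exists>x. x \<in> carrier_vec n \<and> B *\<^sub>v x = 0\<^sub>v n \<and> x \<noteq> 0\<^sub>v n"
  proof (rule ccontr)
    assume no: "\<not> ?thesis"
    then have "\<And>x. x \<in> carrier_vec n \<Longrightarrow> B *\<^sub>v x = 0\<^sub>v n \<Longrightarrow> x = 0\<^sub>v n" by blast
    note inv = mat_inverse_exists(2,4)[OF B this]
    obtain K where K: "K > 0" "\<And>x. x \<in> carrier_vec n \<Longrightarrow> vnorm (B *\<^sub>v x) \<le> K * vnorm x"
      using mult_mat_vec_norm_bound[OF B] by blast
    obtain J where J: "J > 0" "\<And>x. x \<in> carrier_vec n \<Longrightarrow> vnorm (mat_inv B *\<^sub>v x) \<le> J * vnorm x"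
      using mult_mat_vec_norm_bound[OF inv(1)] by blast
    have "l + 1 / (J\<^sup>2 * K) \<le> s" if s: "s \<in> S" for s
    proof -
      obtain x where x: "x \<in> carrier_vec n" "vnorm x = 1" "s = Re (herm_form P x)"
        using s unfolding S_def by blast
      define z where "z = B *\<^sub>v x"
      have z: "z \<in> carrier_vec n" using x by (simp add: z_def)
      \<comment> \<open>A gradient step from \<open>x\<close>: expanding the nonnegative form of
        \<open>B\<close> at x - t z gives 0 \<le> x* B x - 2 t |z|^2 + t^2 z* B z, and t = 1/K
        reduces the last term to at most t |z|^2.\<close>
      define t where "t = 1 / K"
      define y where "y = x - complex_of_real t \<cdot>\<^sub>v z"
      have y: "y \<in> carrier_vec n" using x z by (simp add: y_def)
      have By: "B *\<^sub>v y = z - complex_of_real t \<cdot>\<^sub>v (B *\<^sub>v z)"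
        using x z B by (simp add: y_def mult_minus_distrib_mat_vec[of _ n n] mult_mat_vec[of _ n n] z_def)
      have zz: "(B *\<^sub>v z) \<bullet>c x = z \<bullet>c z"
        using Bherm[OF z x(1)] by (simp add: z_def)
      have "Re ((B *\<^sub>v y) \<bullet>c y) = Re (z \<bullet>c x) - 2 * t * (vnorm z)\<^sup>2 + t\<^sup>2 * Re ((B *\<^sub>v z) \<bullet>c z)"
        unfolding By using x z zz
        by (simp add: y_def cscalar_simps[where n=n] cscalar_self power2_eq_square algebra_simps)
      moreover have "Re ((B *\<^sub>v z) \<bullet>c z) \<le> K * (vnorm z)\<^sup>2"
      proof -
        have "Re ((B *\<^sub>v z) \<bullet>c z) \<le> vnorm (B *\<^sub>v z) * vnorm z"
          by (rule Re_cscalar_le[OF Bc[OF z] z])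
        also have "\<dots> \<le> K * vnorm z * vnorm z"
          using K(2)[OF z] by (intro mult_right_mono) auto
        finally show ?thesis by (simp add: power2_eq_square mult.assoc)
      qed
      then have "t\<^sup>2 * Re ((B *\<^sub>v z) \<bullet>c z) \<le> t\<^sup>2 * (K * (vnorm z)\<^sup>2)"
        by (rule mult_left_mono) simp
      then have "t\<^sup>2 * Re ((B *\<^sub>v z) \<bullet>c z) \<le> t * (vnorm z)\<^sup>2"
        using K(1) by (simp add: t_def power2_eq_square)
      ultimately have 1: "t * (vnorm z)\<^sup>2 \<le> Re (z \<bullet>c x)"
        using psd[OF y] by simp
      \<comment> \<open>Invertibility keeps |z| at least 1/J on the sphere, so the gap 1/(J^2 K)
        above \<open>l\<close> does not depend on \<open>x\<close>.\<close>
      have "mat_inv B *\<^sub>v z = x"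
        using inv B x by (simp add: z_def flip: assoc_mult_mat_vec)
      then have "1 \<le> J * vnorm z" using J(2)[OF z] x by simp
      then have "1 \<le> (J * vnorm z)\<^sup>2" by (simp add: one_le_power)
      then have "1 / J\<^sup>2 \<le> (vnorm z)\<^sup>2"
        using J(1) by (simp add: power_mult_distrib field_simps)
      then have "t * (1 / J\<^sup>2) \<le> t * (vnorm z)\<^sup>2"
        using K(1) by (intro mult_left_mono) (auto simp: t_def)
      with 1 have "1 / (J\<^sup>2 * K) \<le> Re (z \<bullet>c x)"
        by (simp add: t_def mult.commute)
      then show ?thesis
        using Bform[OF x(1)] x by (simp add: z_def)
    qed
    then have "l + 1 / (J\<^sup>2 * K) \<le> l"
      unfolding l_def using ne by (intro cInf_greatest) auto
    moreover have "1 / (J\<^sup>2 * K) > 0" using J K by simp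
    ultimately show False by linarith
  qed
  then obtain x where x: "x \<in> carrier_vec n" "B *\<^sub>v x = 0\<^sub>v n" "x \<noteq> 0\<^sub>v n" by blast
  obtain v where v: "v \<in> carrier_vec n" "vnorm v = 1" "x = complex_of_real (vnorm x) \<cdot>\<^sub>v v"
    using exists_unit_multiple[OF x(1,3)] .
  have vx: "v = complex_of_real (1 / vnorm x) \<cdot>\<^sub>v x"
  proof -
    have "complex_of_real (1 / r) \<cdot>\<^sub>v (complex_of_real r \<cdot>\<^sub>v v) = v" if "r \<noteq> 0" for r
      using that by (simp add: smult_smult_assoc)
    from this[of "vnorm x"] show ?thesis
      using vnorm_pos[OF x(1,3)] unfolding v(3)[symmetric] by simp
  qed
  have "B *\<^sub>v v = 0\<^sub>v n"
    unfolding vx using x B by (simp add: mult_mat_vec[of _ n n]) (intro eq_vecI, auto)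
  then have "P *\<^sub>v v - complex_of_real l \<cdot>\<^sub>v v = 0\<^sub>v n" using Bv[OF v(1)] by simp
  then have "P *\<^sub>v v = complex_of_real l \<cdot>\<^sub>v v"
    using P v by (intro eq_vecI) (auto simp: vec_eq_iff)
  with v low that show ?thesis by blast
qed

text \<open>The form of \<open>- D* D\<close> at \<open>x\<close> is -|D x|^2, so a minimal
  eigenvector of it maximises |D x| over the unit sphere; thus \<open>s\<close> is attained, an
  actual singular value and not merely a supremum.\<close>

lemma max_singular_vector:
  fixes D :: "complex mat"
  assumes D: "D \<in> carrier_mat n n" and n: "n > 0"
  obtains s v where "0 \<le> s" "v \<in> carrier_vec n" "vnorm v = 1" "vnorm (D *\<^sub>v v) = s"
    "mat_adjoint D *\<^sub>v (D *\<^sub>v v) = complex_of_real (s\<^sup>2) \<cdot>\<^sub>v v"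
    "\<And>x. x \<in> carrier_vec n \<Longrightarrow> vnorm (D *\<^sub>v x) \<le> s * vnorm x"
proof -
  define P where "P = (-1) \<cdot>\<^sub>m (mat_adjoint D * D)"
  have P: "P \<in> carrier_mat n n" using D mat_adjoint_carrier[OF D] by (simp add: P_def)
  have Pv: "P *\<^sub>v x = (-1) \<cdot>\<^sub>v (mat_adjoint D *\<^sub>v (D *\<^sub>v x))" if "x \<in> carrier_vec n" for x
    using that D mat_adjoint_carrier[OF D]
    by (simp add: P_def smult_mat_mult_vec[of _ n n] assoc_mult_mat_vec[of _ n n _ n])
  have Px: "(P *\<^sub>v x) \<bullet>c y = - ((D *\<^sub>v x) \<bullet>c (D *\<^sub>v y))"
    if "x \<in> carrier_vec n" "y \<in> carrier_vec n" for x y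
    using that D mat_adjoint_carrier[OF D]
      cscalar_adjoint[OF mat_adjoint_carrier[OF D], of "D *\<^sub>v x" y]
    by (simp add: Pv)
  have Py: "x \<bullet>c (P *\<^sub>v y) = - ((D *\<^sub>v x) \<bullet>c (D *\<^sub>v y))"
    if "x \<in> carrier_vec n" "y \<in> carrier_vec n" for x y
    using that P cscalar_cnj[of "P *\<^sub>v y" n x] Px[OF that(2,1)] cscalar_cnj[of "D *\<^sub>v x" n "D *\<^sub>v y"] D
    by simp
  obtain l v where v: "v \<in> carrier_vec n" "vnorm v = 1" "P *\<^sub>v v = complex_of_real l \<cdot>\<^sub>v v"
    and low: "\<And>x. x \<in> carrier_vec n \<Longrightarrow> Re (herm_form P x) \<ge> l * (vnorm x)\<^sup>2"
    using hermitian_min_eigenvector[OF P n] Px Py by metis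
  have hf: "Re (herm_form P x) = - (vnorm (D *\<^sub>v x))\<^sup>2" if "x \<in> carrier_vec n" for x
    using Px[OF that that] by (simp add: herm_form_def cscalar_self)
  have "Re (herm_form P v) = l"
    using v by (simp add: herm_form_def cscalar_self)
  then have l: "l = - (vnorm (D *\<^sub>v v))\<^sup>2" using hf[OF v(1)] by simp
  show ?thesis
  proof (rule that[of "vnorm (D *\<^sub>v v)" v])
    show "vnorm (D *\<^sub>v x) \<le> vnorm (D *\<^sub>v v) * vnorm x" if x: "x \<in> carrier_vec n" for x
    proof -
      have "(vnorm (D *\<^sub>v x))\<^sup>2 \<le> (vnorm (D *\<^sub>v v) * vnorm x)\<^sup>2"
        using low[OF x] hf[OF x] l by (simp add: power_mult_distrib)
      then show ?thesis by (rule power2_le_imp_le) simp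
    qed
    have "(-1) \<cdot>\<^sub>v (mat_adjoint D *\<^sub>v (D *\<^sub>v v)) = complex_of_real l \<cdot>\<^sub>v v"
      using v(3) Pv[OF v(1)] by simp
    then have "(-1) \<cdot>\<^sub>v ((-1) \<cdot>\<^sub>v (mat_adjoint D *\<^sub>v (D *\<^sub>v v))) = (-1) \<cdot>\<^sub>v (complex_of_real l \<cdot>\<^sub>v v)"
      by (rule arg_cong)
    then show "mat_adjoint D *\<^sub>v (D *\<^sub>v v) = complex_of_real ((vnorm (D *\<^sub>v v))\<^sup>2) \<cdot>\<^sub>v v"
      using v l by (simp add: smult_smult_assoc)
  qed (use v in auto)
qed

text \<open>A real \<open>SUP\<close> is an upper bound only of a set known to be bounded above;
  \<open>mult_mat_vec_norm_bound\<close> supplies this, and homogeneity then leaves the unit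
  sphere.\<close>

lemma spectral_norm_bound:
  assumes A: "A \<in> carrier_mat n n" and n: "n > 0" and x: "x \<in> carrier_vec n"
  shows "vnorm (A *\<^sub>v x) \<le> spectral_norm A * vnorm x"
proof -
  obtain K where K: "K > 0" "\<And>x. x \<in> carrier_vec n \<Longrightarrow> vnorm (A *\<^sub>v x) \<le> K * vnorm x"
    using mult_mat_vec_norm_bound[OF A] by blast
  have bdd: "bdd_above ((\<lambda>x. vnorm (A *\<^sub>v x)) ` {x \<in> carrier_vec n. vnorm x = 1})"
    using K(2) by (force intro!: bdd_aboveI[of _ K])
  show ?thesis
  proof (cases "x = 0\<^sub>v n")
    case True
    then show ?thesis using A by (simp add: mult_mat_vec_zero)
  next
    case False
    obtain u where u: "u \<in> carrier_vec n" "vnorm u = 1" "x = complex_of_real (vnorm x) \<cdot>\<^sub>v u"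
      using exists_unit_multiple[OF x False] .
    have "vnorm (A *\<^sub>v u) \<le> spectral_norm A"
      unfolding spectral_norm_def using A u bdd by (auto intro!: cSUP_upper)
    moreover have "vnorm (A *\<^sub>v x) = vnorm x * vnorm (A *\<^sub>v u)"
      using A u(1) by (subst u(3)) (simp add: mult_mat_vec[of _ n n] vnorm_smult)
    ultimately show ?thesis by (metis mult.commute mult_right_mono vnorm_nonneg)
  qed
qed

text \<open>The attained maximum \<open>s\<close> belongs to \<open>singular_values A\<close> and
  dominates the supremum. For \<open>Max\<close> the set must be finite: squaring maps it
  injectively, as its members are nonnegative, into the roots of a nonzero characteristic
  polynomial.\<close>

lemma spectral_norm_le_sigma_max:
  assumes A: "A \<in> carrier_mat n n" and n: "n > 0"
  shows "spectral_norm A \<le> sigma_max A"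
proof -
  let ?B = "mat_adjoint A * A"
  have B: "?B \<in> carrier_mat n n" using A mat_adjoint_carrier[OF A] by simp
  obtain s v where s: "0 \<le> s" "v \<in> carrier_vec n" "vnorm v = 1"
    "mat_adjoint A *\<^sub>v (A *\<^sub>v v) = complex_of_real (s\<^sup>2) \<cdot>\<^sub>v v"
    "\<And>x. x \<in> carrier_vec n \<Longrightarrow> vnorm (A *\<^sub>v x) \<le> s * vnorm x"
    using max_singular_vector[OF A n] by metis
  have "v \<noteq> 0\<^sub>v n" using s(3) by auto
  then have "eigenvalue ?B (complex_of_real (s\<^sup>2))"
    using s A mat_adjoint_carrier[OF A] unfolding eigenvalue_def eigenvector_def
    by (intro exI[of _ v]) (auto simp: assoc_mult_mat_vec[of _ n n _ n])
  then have mem: "s \<in> singular_values A"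
    using s(1) by (simp add: singular_values_def)
  have "finite {z. eigenvalue ?B z}"
  proof -
    have "char_poly ?B \<noteq> 0" using degree_monic_char_poly[OF B] by auto
    then show ?thesis
      using poly_roots_finite by (simp add: eigenvalue_root_char_poly[OF B])
  qed
  moreover have "inj_on (\<lambda>s. complex_of_real (s\<^sup>2)) (singular_values A)"
    by (auto simp: inj_on_def singular_values_def simp del: of_real_power)
  moreover have "(\<lambda>s. complex_of_real (s\<^sup>2)) ` singular_values A \<subseteq> {z. eigenvalue ?B z}"
    by (auto simp: singular_values_def)
  ultimately have "finite (singular_values A)"
    using finite_imageD finite_subset by blast
  then have "s \<le> sigma_max A"
    using mem by (simp add: sigma_max_def)
  moreover have "spectral_norm A \<le> s"
    unfolding spectral_norm_def
  proof (rule cSUP_least)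
    show "{x \<in> carrier_vec (dim_col A). vnorm x = 1} \<noteq> {}" using s(2,3) A by auto
  qed (use s(5) A in force)
  ultimately show ?thesis by linarith
qed

text \<open>For a singular vector \<open>v\<close> of \<open>D\<close> to its largest singular value \<open>s\<close>, the form
  \<open>(D v)\<^sup>* (X D + D Y) v\<close> equals \<open>(D v)\<^sup>* X (D v) + s\<^sup>2 v\<^sup>* Y v\<close>.\<close>

lemma sylvester_bound:
  fixes X Y D E :: "complex mat"
  assumes X: "X \<in> carrier_mat n n" and Y: "Y \<in> carrier_mat n n" and D: "D \<in> carrier_mat n n"
    and E: "E \<in> carrier_mat n n" and n: "n > 0"
    and Xlb: "\<And>x. x \<in> carrier_vec n \<Longrightarrow> Re (herm_form X x) \<ge> a * (vnorm x)\<^sup>2"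
    and Ylb: "\<And>x. x \<in> carrier_vec n \<Longrightarrow> Re (herm_form Y x) \<ge> c * (vnorm x)\<^sup>2"
    and Eub: "\<And>x. x \<in> carrier_vec n \<Longrightarrow> vnorm (E *\<^sub>v x) \<le> e * vnorm x"
    and syl: "\<And>x. x \<in> carrier_vec n \<Longrightarrow> X *\<^sub>v (D *\<^sub>v x) + D *\<^sub>v (Y *\<^sub>v x) = E *\<^sub>v x"
    and ac: "0 \<le> a + c" and x: "x \<in> carrier_vec n"
  shows "(a + c) * vnorm (D *\<^sub>v x) \<le> e * vnorm x"
proof -
  obtain s v where s: "0 \<le> s" "v \<in> carrier_vec n" "vnorm v = 1" "vnorm (D *\<^sub>v v) = s"
    "mat_adjoint D *\<^sub>v (D *\<^sub>v v) = complex_of_real (s\<^sup>2) \<cdot>\<^sub>v v"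
    and sb: "\<And>x. x \<in> carrier_vec n \<Longrightarrow> vnorm (D *\<^sub>v x) \<le> s * vnorm x"
    using max_singular_vector[OF D n] by metis
  have Dv: "D *\<^sub>v v \<in> carrier_vec n" and Yv: "Y *\<^sub>v v \<in> carrier_vec n" using D Y s by auto
  \<comment> \<open>Moving the outer \<open>D\<close> across the product meets
    \<open>mat_adjoint D * D\<close> at its eigenvector \<open>v\<close>, which leaves the form of
    \<open>Y\<close> at \<open>v\<close>; at an arbitrary vector the real part of this term has no
    known sign.\<close>
  have "(D *\<^sub>v (Y *\<^sub>v v)) \<bullet>c (D *\<^sub>v v) = complex_of_real (s\<^sup>2) * ((Y *\<^sub>v v) \<bullet>c v)"
    using cscalar_adjoint[OF D Yv Dv] s Yv by (simp add: cscalar_simps[where n=n])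
  then have "Re ((E *\<^sub>v v) \<bullet>c (D *\<^sub>v v)) = Re (herm_form X (D *\<^sub>v v)) + s\<^sup>2 * Re (herm_form Y v)"
    using s X D Y Dv Yv
    by (simp add: syl[symmetric] cscalar_add_left[where n=n] herm_form_def del: of_real_power)
  moreover have "Re (herm_form X (D *\<^sub>v v)) \<ge> a * s\<^sup>2" using Xlb[OF Dv] s by simp
  moreover have "s\<^sup>2 * Re (herm_form Y v) \<ge> s\<^sup>2 * c"
    using Ylb[OF s(2)] s by (intro mult_left_mono) auto
  moreover have "Re ((E *\<^sub>v v) \<bullet>c (D *\<^sub>v v)) \<le> e * s"
  proof -
    have "Re ((E *\<^sub>v v) \<bullet>c (D *\<^sub>v v)) \<le> vnorm (E *\<^sub>v v) * vnorm (D *\<^sub>v v)"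
      by (rule Re_cscalar_le[OF mult_mat_vec_carrier[OF E s(2)] Dv])
    also have "\<dots> \<le> e * s"
      using Eub[OF s(2)] s(1,3,4) by (simp add: mult_right_mono)
    finally show ?thesis .
  qed
  ultimately have le: "s * ((a + c) * s) \<le> s * e"
    by (simp add: power2_eq_square algebra_simps)
  have e: "0 \<le> e * vnorm x" using Eub[OF x] vnorm_nonneg order_trans by blast
  show ?thesis
  proof (cases "s = 0")
    case True
    then have "vnorm (D *\<^sub>v x) = 0" using sb[OF x] vnorm_nonneg[of "D *\<^sub>v x"] by simp
    then show ?thesis using e by simp
  next
    case False
    then have "(a + c) * s \<le> e" using le s(1) by simp
    then have "(a + c) * s * vnorm x \<le> e * vnorm x" by (simp add: mult_right_mono)
    moreover have "(a + c) * vnorm (D *\<^sub>v x) \<le> (a + c) * (s * vnorm x)"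
      using sb[OF x] ac by (intro mult_left_mono)
    ultimately show ?thesis by (simp add: mult.assoc)
  qed
qed

text \<open>\<open>X + mat_adjoint X\<close> is Hermitian, and its form is twice the real part of
  that of \<open>X\<close>, hence the halved eigenvalue. The eigenvector equation is solved for
  \<open>mat_adjoint X *\<^sub>v v\<close> because this factor appears when one \<open>X\<close> of
  \<open>X * X\<close> is moved across the product.\<close>

lemma hermitian_part_min:
  fixes X :: "complex mat"
  assumes X: "X \<in> carrier_mat n n" and n: "n > 0"
  obtains l v where "v \<in> carrier_vec n" "vnorm v = 1" "Re (herm_form X v) = l"
    "mat_adjoint X *\<^sub>v v = complex_of_real (2 * l) \<cdot>\<^sub>v v - X *\<^sub>v v"
    "\<And>x. x \<in> carrier_vec n \<Longrightarrow> Re (herm_form X x) \<ge> l * (vnorm x)\<^sup>2"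
proof -
  note X' = mat_adjoint_carrier[OF X]
  define P where "P = X + mat_adjoint X"
  have P: "P \<in> carrier_mat n n" using X X' by (simp add: P_def)
  have Pv: "P *\<^sub>v x = X *\<^sub>v x + mat_adjoint X *\<^sub>v x" if "x \<in> carrier_vec n" for x
    using that X X' by (simp add: P_def add_mult_distrib_mat_vec[of _ n n])
  have herm: "(P *\<^sub>v x) \<bullet>c y = x \<bullet>c (P *\<^sub>v y)"
    if xy: "x \<in> carrier_vec n" "y \<in> carrier_vec n" for x y
    using cscalar_adjoint[OF X xy] cscalar_adjoint[OF X' xy] xy X X'
    by (simp add: Pv cscalar_simps[where n=n])
  have hf: "Re (herm_form P x) = 2 * Re (herm_form X x)" if "x \<in> carrier_vec n" for x
    using that X X' cscalar_adjoint[OF X' that that] cscalar_cnj[of "X *\<^sub>v x" n x]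
    by (simp add: Pv herm_form_def cscalar_simps[where n=n])
  obtain l v where v: "v \<in> carrier_vec n" "vnorm v = 1" "P *\<^sub>v v = complex_of_real l \<cdot>\<^sub>v v"
    and low: "\<And>x. x \<in> carrier_vec n \<Longrightarrow> Re (herm_form P x) \<ge> l * (vnorm x)\<^sup>2"
    using hermitian_min_eigenvector[OF P n herm] by metis
  show ?thesis
  proof (rule that[of v "l / 2"])
    have "Re (herm_form P v) = l" using v by (simp add: herm_form_def cscalar_self)
    then show "Re (herm_form X v) = l / 2" using hf[OF v(1)] by simp
    have "X *\<^sub>v v + mat_adjoint X *\<^sub>v v = complex_of_real l \<cdot>\<^sub>v v" using Pv v by simp
    then show "mat_adjoint X *\<^sub>v v = complex_of_real (2 * (l / 2)) \<cdot>\<^sub>v v - X *\<^sub>v v"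
      using X X' v by (intro eq_vecI) (auto simp: vec_eq_iff algebra_simps)
    show "Re (herm_form X x) \<ge> l / 2 * (vnorm x)\<^sup>2" if "x \<in> carrier_vec n" for x
      using low[OF that] hf[OF that] by simp
  qed (use v in auto)
qed

text \<open>Since the minimum over the unit sphere is attained, pointwise positivity is already
  uniform positivity.\<close>

lemma positive_definite_lower_bound:
  assumes X: "X \<in> carrier_mat n n" and n: "n > 0" and pd: "positive_definite X"
  obtains d where "d > 0" "\<And>x. x \<in> carrier_vec n \<Longrightarrow> Re (herm_form X x) \<ge> d * (vnorm x)\<^sup>2"
proof -
  obtain l v where l: "v \<in> carrier_vec n" "vnorm v = 1" "Re (herm_form X v) = l"
    "\<And>x. x \<in> carrier_vec n \<Longrightarrow> Re (herm_form X x) \<ge> l * (vnorm x)\<^sup>2"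
    using hermitian_part_min[OF X n] by metis
  moreover have "l > 0" using pd l(1-3) X by (auto simp: positive_definite_def)
  ultimately show ?thesis using that by blast
qed

lemma positive_definiteI:
  assumes X: "X \<in> carrier_mat n n" and d: "d > 0"
    and "\<And>x. x \<in> carrier_vec n \<Longrightarrow> Re (herm_form X x) \<ge> d * (vnorm x)\<^sup>2"
  shows "positive_definite X"
  using assms by (fastforce simp: positive_definite_def square_mat.simps)

text \<open>At a minimal eigenvector \<open>v\<close> of the Hermitian part, with eigenvalue \<open>l\<close>, one has
  \<open>Re (v\<^sup>* X\<^sup>2 v) = 2 l\<^sup>2 - \<parallel>X v\<parallel>\<^sup>2 \<le> l\<^sup>2\<close>.\<close>

lemma sqrt_lower_bound:
  assumes X: "X \<in> carrier_mat n n" and n: "n > 0" and pd: "positive_definite X"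
    and m: "m > 0"
    and lb: "\<And>x. x \<in> carrier_vec n \<Longrightarrow> vnorm x = 1 \<Longrightarrow> Re (herm_form (X * X) x) \<ge> m\<^sup>2"
    and x: "x \<in> carrier_vec n"
  shows "Re (herm_form X x) \<ge> m * (vnorm x)\<^sup>2"
proof -
  obtain l v where l: "v \<in> carrier_vec n" "vnorm v = 1" "Re (herm_form X v) = l"
    "mat_adjoint X *\<^sub>v v = complex_of_real (2 * l) \<cdot>\<^sub>v v - X *\<^sub>v v"
    "\<And>x. x \<in> carrier_vec n \<Longrightarrow> Re (herm_form X x) \<ge> l * (vnorm x)\<^sup>2"
    using hermitian_part_min[OF X n] by metis
  have pos: "l > 0" using pd l(1-3) X by (auto simp: positive_definite_def)
  have Xv: "X *\<^sub>v v \<in> carrier_vec n" using X l by simp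
  have "herm_form (X * X) v = (X *\<^sub>v v) \<bullet>c (mat_adjoint X *\<^sub>v v)"
    using X l cscalar_adjoint[OF X Xv l(1)] by (simp add: herm_form_def assoc_mult_mat_vec[of _ n n _ n])
  also have "\<dots> = complex_of_real (2 * l) * herm_form X v - (X *\<^sub>v v) \<bullet>c (X *\<^sub>v v)"
    unfolding l(4) using Xv l by (simp add: cscalar_simps[where n=n] herm_form_def)
  finally have "Re (herm_form (X * X) v) = 2 * l * l - (vnorm (X *\<^sub>v v))\<^sup>2"
    using l(3) by (simp add: cscalar_self)
  moreover have "l \<le> vnorm (X *\<^sub>v v)"
    using cscalar_Cauchy_Schwarz[OF Xv l(1)] l(2,3) complex_Re_le_cmod[of "herm_form X v"]
    by (simp add: herm_form_def)
  then have "l\<^sup>2 \<le> (vnorm (X *\<^sub>v v))\<^sup>2" using pos by (intro power_mono) auto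
  ultimately have "m\<^sup>2 \<le> l\<^sup>2" using lb[OF l(1,2)] by (simp add: power2_eq_square)
  then have "m \<le> l" using pos by (intro power2_le_imp_le[of m l]) auto
  then have "m * (vnorm x)\<^sup>2 \<le> l * (vnorm x)\<^sup>2" by (simp add: mult_right_mono)
  then show ?thesis using l(5)[OF x] by linarith
qed

lemma mat_eqI_mult_vec:
  fixes A B :: "complex mat"
  assumes A: "A \<in> carrier_mat n m" and B: "B \<in> carrier_mat n m"
    and eq: "\<And>x. x \<in> carrier_vec m \<Longrightarrow> A *\<^sub>v x = B *\<^sub>v x"
  shows "A = B"
proof (rule eq_matI)
  fix i j assume "i < dim_row B" "j < dim_col B"
  then show "A $$ (i, j) = B $$ (i, j)"
    using eq[of "unit_vec m j"] A B by (auto simp: vec_eq_iff)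
qed (use A B in auto)

section \<open>Positive-definite square roots\<close>

text \<open>Column \<open>j\<close> is the image of a unit vector. This turns operator bounds on
  differences of iterates into bounds on entries, where convergence is scalar.\<close>

lemma entry_le_norm_bound:
  assumes A: "A \<in> carrier_mat n m" and ij: "i < n" "j < m"
    and bd: "\<And>x. x \<in> carrier_vec m \<Longrightarrow> vnorm (A *\<^sub>v x) \<le> r * vnorm x"
  shows "cmod (A $$ (i, j)) \<le> r"
  using vnorm_ge_entry[of i "A *\<^sub>v unit_vec m j"] bd[of "unit_vec m j"] A ij
  by (simp add: vnorm_unit_vec)

text \<open>The fixed point of \<open>Z \<mapsto> (C + Z\<^sup>2) / 2\<close>, a contraction on the ball of radius \<open>r\<close>.\<close>

lemma quadratic_fixed_point:
  fixes C :: "complex mat"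
  assumes C: "C \<in> carrier_mat n n" and r: "0 \<le> r" "r < 1"
    and Cb: "\<And>x. x \<in> carrier_vec n \<Longrightarrow> vnorm (C *\<^sub>v x) \<le> r * vnorm x"
  obtains Z where "Z \<in> carrier_mat n n"
    "\<And>x. x \<in> carrier_vec n \<Longrightarrow> vnorm (Z *\<^sub>v x) \<le> r * vnorm x"
    "\<And>x. x \<in> carrier_vec n \<Longrightarrow> 2 \<cdot>\<^sub>v (Z *\<^sub>v x) = C *\<^sub>v x + Z *\<^sub>v (Z *\<^sub>v x)"
proof -
  define F where "F = (\<lambda>Z. (1/2) \<cdot>\<^sub>m (C + Z * Z))"
  define Z where "Z = (\<lambda>m. (F ^^ m) (0\<^sub>m n n))"
  have Z0: "Z 0 = 0\<^sub>m n n" by (simp add: Z_def)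
  have ZS: "Z (Suc m) = (1/2) \<cdot>\<^sub>m (C + Z m * Z m)" for m by (simp add: Z_def F_def)
  have Zc: "Z m \<in> carrier_mat n n" for m
    by (induction m) (use C in \<open>auto simp: Z0 ZS\<close>)
  have ZSv: "Z (Suc m) *\<^sub>v x = (1/2) \<cdot>\<^sub>v (C *\<^sub>v x + Z m *\<^sub>v (Z m *\<^sub>v x))"
    if "x \<in> carrier_vec n" for m x
    using that C Zc[of m]
    by (simp add: ZS smult_mat_mult_vec[of _ n n] add_mult_distrib_mat_vec[of _ n n]
        assoc_mult_mat_vec[of _ n n _ n])
  have Zb: "vnorm (Z m *\<^sub>v x) \<le> r * vnorm x" if "x \<in> carrier_vec n" for m x
    using that
  proof (induction m arbitrary: x)
    case 0
    have "Z 0 *\<^sub>v x = 0\<^sub>v n" using 0 by (intro eq_vecI) (auto simp: Z0)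
    then show ?case using r by simp
  next
    case (Suc m)
    have zx: "Z m *\<^sub>v x \<in> carrier_vec n" by (rule mult_mat_vec_carrier[OF Zc Suc.prems])
    have "vnorm (C *\<^sub>v x + Z m *\<^sub>v (Z m *\<^sub>v x)) \<le> vnorm (C *\<^sub>v x) + vnorm (Z m *\<^sub>v (Z m *\<^sub>v x))"
      using C Zc[of m] Suc.prems zx by (intro vnorm_triangle[of _ n]) auto
    also have "vnorm (Z m *\<^sub>v (Z m *\<^sub>v x)) \<le> r * (r * vnorm x)"
      using Suc.IH[OF zx] Suc.IH[OF Suc.prems] r(1) mult_left_mono order_trans by blast
    \<comment> \<open>Invariance of the ball: half of r + r^2 is at most r, since r < 1.\<close>
    also have "r * (r * vnorm x) \<le> 1 * (r * vnorm x)"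
      using r by (intro mult_right_mono) auto
    also have "vnorm (C *\<^sub>v x) \<le> r * vnorm x" by (rule Cb[OF Suc.prems])
    finally show ?case
      by (simp add: ZSv[OF Suc.prems] vnorm_smult)
  qed
  have Zd: "vnorm (Z (Suc m) *\<^sub>v x - Z m *\<^sub>v x) \<le> r ^ Suc m * vnorm x" if "x \<in> carrier_vec n" for m x
    using that
  proof (induction m arbitrary: x)
    case 0
    have "Z 0 *\<^sub>v x = 0\<^sub>v n" using 0 by (intro eq_vecI) (auto simp: Z0)
    then show ?case using Zb[OF 0, of 1] Zc[of 1] 0 by simp
  next
    case (Suc m)
    let ?z = "\<lambda>m. Z m *\<^sub>v x"
    have zx: "?z m \<in> carrier_vec n" for m by (rule mult_mat_vec_carrier[OF Zc Suc.prems])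
    have dc: "?z (Suc m) - ?z m \<in> carrier_vec n" using zx by simp
    \<comment> \<open>With Z' the next iterate, Z'^2 - Z^2 = Z' (Z' - Z) + (Z' - Z) Z, a splitting
      that does not presume commutation; each summand gains a factor r, and the half makes r the
      contraction factor.\<close>
    have "?z (Suc (Suc m)) - ?z (Suc m) =
      (1/2) \<cdot>\<^sub>v (Z (Suc m) *\<^sub>v (?z (Suc m) - ?z m) + (Z (Suc m) *\<^sub>v ?z m - Z m *\<^sub>v ?z m))"
    proof -
      have Zz: "Z i *\<^sub>v ?z j \<in> carrier_vec n" for i j
        by (rule mult_mat_vec_carrier[OF Zc zx])
      have gen: "(1/2) \<cdot>\<^sub>v (a + u) - (1/2) \<cdot>\<^sub>v (a + w) = (1/2) \<cdot>\<^sub>v ((u - p) + (p - w))"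
        if "a \<in> carrier_vec n" "u \<in> carrier_vec n" "w \<in> carrier_vec n" "p \<in> carrier_vec n"
        for a u w p :: "complex vec"
        using that by (intro eq_vecI) (auto simp: field_simps)
      have "?z (Suc (Suc m)) - ?z (Suc m) =
        (1/2) \<cdot>\<^sub>v (C *\<^sub>v x + Z (Suc m) *\<^sub>v ?z (Suc m)) - (1/2) \<cdot>\<^sub>v (C *\<^sub>v x + Z m *\<^sub>v ?z m)"
        by (simp only: ZSv[OF Suc.prems])
      also have "\<dots> = (1/2) \<cdot>\<^sub>v ((Z (Suc m) *\<^sub>v ?z (Suc m) - Z (Suc m) *\<^sub>v ?z m) +
          (Z (Suc m) *\<^sub>v ?z m - Z m *\<^sub>v ?z m))"
        by (rule gen[OF mult_mat_vec_carrier[OF C Suc.prems] Zz Zz Zz])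
      also have "Z (Suc m) *\<^sub>v ?z (Suc m) - Z (Suc m) *\<^sub>v ?z m = Z (Suc m) *\<^sub>v (?z (Suc m) - ?z m)"
        by (rule mult_minus_distrib_mat_vec[OF Zc zx zx, symmetric])
      finally show ?thesis .
    qed
    then have "vnorm (?z (Suc (Suc m)) - ?z (Suc m)) =
      1/2 * vnorm (Z (Suc m) *\<^sub>v (?z (Suc m) - ?z m) + (Z (Suc m) *\<^sub>v ?z m - Z m *\<^sub>v ?z m))"
      by (simp add: vnorm_smult)
    also have "\<dots> \<le> 1/2 * (vnorm (Z (Suc m) *\<^sub>v (?z (Suc m) - ?z m)) + vnorm (Z (Suc m) *\<^sub>v ?z m - Z m *\<^sub>v ?z m))"
      using Zc[of m] Zc[of "Suc m"] zx[of m] zx[of "Suc m"]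
      by (intro mult_left_mono vnorm_triangle[of _ n]) auto
    also have "vnorm (Z (Suc m) *\<^sub>v (?z (Suc m) - ?z m)) \<le> r * (r ^ Suc m * vnorm x)"
      using Zb[OF dc, of "Suc m"] Suc.IH[OF Suc.prems] r(1) mult_left_mono order_trans by blast
    also have "vnorm (Z (Suc m) *\<^sub>v ?z m - Z m *\<^sub>v ?z m) \<le> r ^ Suc m * (r * vnorm x)"
      using Suc.IH[OF zx[of m]] mult_left_mono[OF Zb[OF Suc.prems, of m], of "r ^ Suc m"] r by simp
    finally show ?case by (simp add: algebra_simps)
  qed
  have conv: "convergent (\<lambda>m. Z m $$ (i, j))" if ij: "i < n" "j < n" for i j
  proof -
    have le: "cmod (Z (Suc m) $$ (i, j) - Z m $$ (i, j)) \<le> r ^ Suc m" for m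
    proof -
      have "cmod ((Z (Suc m) - Z m) $$ (i, j)) \<le> r ^ Suc m"
      proof (rule entry_le_norm_bound[OF _ ij])
        show "Z (Suc m) - Z m \<in> carrier_mat n n" by (rule minus_carrier_mat[OF Zc])
        show "vnorm ((Z (Suc m) - Z m) *\<^sub>v x) \<le> r ^ Suc m * vnorm x" if "x \<in> carrier_vec n" for x
          using Zd[OF that, of m] Zc that by (simp add: minus_mult_distrib_mat_vec[of _ n n])
      qed
      then show ?thesis using Zc[of m] Zc[of "Suc m"] ij by simp
    qed
    have "summable (\<lambda>m. r ^ Suc m)"
      using r by (simp add: summable_Suc_iff summable_geometric)
    then have "summable (\<lambda>m. Z (Suc m) $$ (i, j) - Z m $$ (i, j))"
      by (rule summable_comparison_test'[where N = 0]) (rule le)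
    then have "convergent (\<lambda>k. \<Sum>m<k. Z (Suc m) $$ (i, j) - Z m $$ (i, j))"
      by (simp add: summable_iff_convergent)
    then have "convergent (\<lambda>k. Z k $$ (i, j) - Z 0 $$ (i, j))"
      by (subst (asm) sum_lessThan_telescope)
    then show ?thesis using ij by (simp add: Z0)
  qed
  define L where "L = mat n n (\<lambda>(i, j). lim (\<lambda>m. Z m $$ (i, j)))"
  have L: "L \<in> carrier_mat n n" by (simp add: L_def)
  have lim: "(\<lambda>m. Z m $$ (i, j)) \<longlonglongrightarrow> L $$ (i, j)" if "i < n" "j < n" for i j
    using conv[OF that] that by (simp add: L_def convergent_LIMSEQ_iff)
  \<comment> \<open>The vector may vary with \<open>m\<close>, so that the statement can be iterated
    to reach \<open>Z m *\<^sub>v (Z m *\<^sub>v x)\<close>.\<close>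
  have limv: "(\<lambda>m. (Z m *\<^sub>v y m) $ i) \<longlonglongrightarrow> (L *\<^sub>v z) $ i"
    if "i < n" "\<And>m. y m \<in> carrier_vec n" "z \<in> carrier_vec n"
      "\<And>i. i < n \<Longrightarrow> (\<lambda>m. y m $ i) \<longlonglongrightarrow> z $ i" for i y z
  proof -
    have "(\<lambda>m. \<Sum>j<n. Z m $$ (i, j) * y m $ j) \<longlonglongrightarrow> (\<Sum>j<n. L $$ (i, j) * z $ j)"
      using that lim by (intro tendsto_sum tendsto_mult) auto
    moreover have "(Z m *\<^sub>v y m) $ i = (\<Sum>j<n. Z m $$ (i, j) * y m $ j)" for m
      using that(1) that(2)[of m] Zc[of m] by (simp add: scalar_prod_def atLeast0LessThan)
    moreover have "(L *\<^sub>v z) $ i = (\<Sum>j<n. L $$ (i, j) * z $ j)"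
      using that L by (simp add: scalar_prod_def atLeast0LessThan)
    ultimately show ?thesis by simp
  qed
  show ?thesis
  proof (rule that[OF L])
    fix x :: "complex vec" assume x: "x \<in> carrier_vec n"
    have l1: "(\<lambda>m. (Z m *\<^sub>v x) $ i) \<longlonglongrightarrow> (L *\<^sub>v x) $ i" if "i < n" for i
      using limv[of i "\<lambda>_. x" x] that x by simp
    have l2: "(\<lambda>m. (Z m *\<^sub>v (Z m *\<^sub>v x)) $ i) \<longlonglongrightarrow> (L *\<^sub>v (L *\<^sub>v x)) $ i" if "i < n" for i
      by (rule limv[OF that mult_mat_vec_carrier[OF Zc x] mult_mat_vec_carrier[OF L x] l1])
    have "(\<lambda>m. sqrt (\<Sum>i<n. (cmod ((Z m *\<^sub>v x) $ i))\<^sup>2)) \<longlonglongrightarrow> sqrt (\<Sum>i<n. (cmod ((L *\<^sub>v x) $ i))\<^sup>2)"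
      using l1 by (intro tendsto_intros) auto
    then have "(\<lambda>m. vnorm (Z m *\<^sub>v x)) \<longlonglongrightarrow> vnorm (L *\<^sub>v x)"
      using L carrier_matD[OF Zc] by (simp add: vnorm_def)
    then show "vnorm (L *\<^sub>v x) \<le> r * vnorm x"
      by (rule LIMSEQ_le_const2) (use Zb[OF x] in blast)
    show "2 \<cdot>\<^sub>v (L *\<^sub>v x) = C *\<^sub>v x + L *\<^sub>v (L *\<^sub>v x)"
    proof (rule eq_vecI)
      fix i assume "i < dim_vec (C *\<^sub>v x + L *\<^sub>v (L *\<^sub>v x))"
      then have i: "i < n" using L by simp
      have "(\<lambda>m. (Z (Suc m) *\<^sub>v x) $ i) \<longlonglongrightarrow> (1/2) * ((C *\<^sub>v x) $ i + (L *\<^sub>v (L *\<^sub>v x)) $ i)"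
      proof -
        have eq: "(Z (Suc m) *\<^sub>v x) $ i = (1/2) * ((C *\<^sub>v x) $ i + (Z m *\<^sub>v (Z m *\<^sub>v x)) $ i)" for m
          using i C Zc[of m] by (simp only: ZSv[OF x]) simp
        show ?thesis unfolding eq by (intro tendsto_intros l2[OF i])
      qed
      moreover have "(\<lambda>m. (Z (Suc m) *\<^sub>v x) $ i) \<longlonglongrightarrow> (L *\<^sub>v x) $ i"
        using l1[OF i] by (rule LIMSEQ_Suc)
      ultimately have "(L *\<^sub>v x) $ i = (1/2) * ((C *\<^sub>v x) $ i + (L *\<^sub>v (L *\<^sub>v x)) $ i)"
        by (rule LIMSEQ_unique[symmetric])
      then show "(2 \<cdot>\<^sub>v (L *\<^sub>v x)) $ i = (C *\<^sub>v x + L *\<^sub>v (L *\<^sub>v x)) $ i"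
        using i L by (simp add: mult.commute del: index_mult_mat_vec)
    qed (use L C in simp)
  qed
qed

text \<open>For large \<open>s\<close>, \<open>A = s (1 - C)\<close> with \<open>C\<close> a strict contraction, and the root is
  \<open>sqrt s (1 - Z)\<close> with \<open>2 Z = C + Z\<^sup>2\<close> and \<open>Z\<close> again a strict contraction.\<close>

lemma positive_definite_sqrt_exists:
  assumes A: "A \<in> carrier_mat n n" and n: "n > 0" and pd: "positive_definite A"
  shows "\<exists>X. X \<in> carrier_mat n n \<and> positive_definite X \<and> X * X = A"
proof -
  obtain d where d: "d > 0" "\<And>x. x \<in> carrier_vec n \<Longrightarrow> Re (herm_form A x) \<ge> d * (vnorm x)\<^sup>2"
    using positive_definite_lower_bound[OF A n pd] by metis
  obtain K where K: "K > 0" "\<And>x. x \<in> carrier_vec n \<Longrightarrow> vnorm (A *\<^sub>v x) \<le> K * vnorm x"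
    using mult_mat_vec_norm_bound[OF A] by blast
  \<comment> \<open>With C = 1 - t A the square of the norm is bounded by the factor 1 - 2 t d + t^2
    K^2; t = d/K^2 is its minimiser, with value 1 - d^2/K^2. The \<open>max\<close> in
    \<open>q\<close> makes the radicand nonnegative without a comparison of \<open>d\<close> and
    \<open>K\<close>.\<close>
  define t where "t = d / K\<^sup>2"
  define q where "q = max 0 (1 - d\<^sup>2 / K\<^sup>2)"
  define r where "r = sqrt q"
  have t: "t > 0" using d K by (simp add: t_def)
  have "d\<^sup>2 / K\<^sup>2 > 0" using d K by simp
  then have q: "0 \<le> q" "q < 1" by (auto simp: q_def)
  then have r: "0 \<le> r" "r < 1" by (auto simp: r_def)
  define C where "C = 1\<^sub>m n - complex_of_real t \<cdot>\<^sub>m A"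
  have C: "C \<in> carrier_mat n n" using A by (auto simp: C_def)
  have Cv: "C *\<^sub>v x = x - complex_of_real t \<cdot>\<^sub>v (A *\<^sub>v x)" if "x \<in> carrier_vec n" for x
    using A that by (simp add: C_def minus_mult_distrib_mat_vec[of _ n n] smult_mat_mult_vec[of _ n n])
  have Cb: "vnorm (C *\<^sub>v x) \<le> r * vnorm x" if x: "x \<in> carrier_vec n" for x
  proof -
    have "(vnorm (C *\<^sub>v x))\<^sup>2 = (vnorm x)\<^sup>2 - 2 * t * Re (herm_form A x) + t\<^sup>2 * (vnorm (A *\<^sub>v x))\<^sup>2"
      using x A t by (simp add: Cv vnorm_diff_sq[of _ n] herm_form_def vnorm_smult power_mult_distrib)
    also have "\<dots> \<le> (vnorm x)\<^sup>2 - 2 * t * (d * (vnorm x)\<^sup>2) + t\<^sup>2 * (K * vnorm x)\<^sup>2"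
      using d(2)[OF x] K(2)[OF x] t by (intro add_mono diff_mono mult_left_mono power_mono) auto
    also have "\<dots> = (1 - d\<^sup>2 / K\<^sup>2) * (vnorm x)\<^sup>2"
      using K(1) by (simp add: t_def field_simps power2_eq_square)
    also have "\<dots> \<le> q * (vnorm x)\<^sup>2"
      by (intro mult_right_mono) (auto simp: q_def)
    also have "\<dots> = (r * vnorm x)\<^sup>2"
      using q by (simp add: r_def power_mult_distrib)
    finally show ?thesis
      by (rule power2_le_imp_le) (use r in simp)
  qed
  obtain Z where Z: "Z \<in> carrier_mat n n"
    and Zb: "\<And>x. x \<in> carrier_vec n \<Longrightarrow> vnorm (Z *\<^sub>v x) \<le> r * vnorm x"
    and Ze: "\<And>x. x \<in> carrier_vec n \<Longrightarrow> 2 \<cdot>\<^sub>v (Z *\<^sub>v x) = C *\<^sub>v x + Z *\<^sub>v (Z *\<^sub>v x)"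
    using quadratic_fixed_point[OF C r Cb] by metis
  define c where "c = 1 / sqrt t"
  have c: "c > 0" using t by (simp add: c_def)
  have cct: "c * c * t = 1" using t by (simp add: c_def)
  define X where "X = complex_of_real c \<cdot>\<^sub>m (1\<^sub>m n - Z)"
  have X: "X \<in> carrier_mat n n" using Z by (auto simp: X_def)
  have Xv: "X *\<^sub>v x = complex_of_real c \<cdot>\<^sub>v (x - Z *\<^sub>v x)" if "x \<in> carrier_vec n" for x
    using Z that minus_carrier_mat[OF Z, of "1\<^sub>m n"] by (simp add: X_def minus_mult_distrib_mat_vec[of _ n n] smult_mat_mult_vec[of _ n n])
  have "X * X = A"
  proof (rule mat_eqI_mult_vec)
    fix x :: "complex vec" assume x: "x \<in> carrier_vec n"
    have zx: "Z *\<^sub>v x \<in> carrier_vec n" "Z *\<^sub>v (Z *\<^sub>v x) \<in> carrier_vec n" "A *\<^sub>v x \<in> carrier_vec n"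
      using A Z x by auto
    define y where "y = complex_of_real c \<cdot>\<^sub>v (x - Z *\<^sub>v x)"
    have y: "y \<in> carrier_vec n" using x zx by (simp add: y_def)
    have Zy: "Z *\<^sub>v y = complex_of_real c \<cdot>\<^sub>v (Z *\<^sub>v x - Z *\<^sub>v (Z *\<^sub>v x))"
      using x zx Z by (simp add: y_def mult_mat_vec[of Z n n] mult_minus_distrib_mat_vec[of Z n n])
    have "X *\<^sub>v (X *\<^sub>v x) = complex_of_real c \<cdot>\<^sub>v (y - Z *\<^sub>v y)"
      using Xv[OF y] by (simp add: Xv[OF x] y_def)
    also have "\<dots> = A *\<^sub>v x"
    proof (rule eq_vecI)
      fix i assume "i < dim_vec (A *\<^sub>v x)"
      then have i: "i < n" using A by simp
      have "2 * (Z *\<^sub>v x) $ i = x $ i - complex_of_real t * (A *\<^sub>v x) $ i + (Z *\<^sub>v (Z *\<^sub>v x)) $ i"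
        using arg_cong[OF Ze[OF x, unfolded Cv[OF x]], of "\<lambda>v. v $ i"] i zx x A Z
        by (simp del: index_mult_mat_vec)
      \<comment> \<open>This is (1 - Z)^2 = 1 - 2 Z + Z^2 = 1 - C = t A; the factor c^2 = 1/t then
        restores A.\<close>
      then have 1: "x $ i - (Z *\<^sub>v x) $ i - ((Z *\<^sub>v x) $ i - (Z *\<^sub>v (Z *\<^sub>v x)) $ i) =
        complex_of_real t * (A *\<^sub>v x) $ i"
        by (simp add: algebra_simps del: index_mult_mat_vec)
      have 2: "complex_of_real c * (complex_of_real c * (complex_of_real t * w)) = w" for w
        using cct by (metis mult.assoc mult_1 of_real_1 of_real_mult)
      have "complex_of_real c * (complex_of_real c *
        (x $ i - (Z *\<^sub>v x) $ i - ((Z *\<^sub>v x) $ i - (Z *\<^sub>v (Z *\<^sub>v x)) $ i))) = (A *\<^sub>v x) $ i"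
        unfolding 1 by (rule 2)
      then show "(complex_of_real c \<cdot>\<^sub>v (y - Z *\<^sub>v y)) $ i = (A *\<^sub>v x) $ i"
        unfolding Zy using i zx x A Z
        by (simp add: y_def algebra_simps del: index_mult_mat_vec)
    qed (use A Z in simp)
    finally show "(X * X) *\<^sub>v x = A *\<^sub>v x"
      using X x by (simp add: assoc_mult_mat_vec[of _ n n _ n])
  qed (use X A in auto)
  moreover have "positive_definite X"
  proof (rule positive_definiteI[OF X, of "c * (1 - r)"])
    fix x :: "complex vec" assume x: "x \<in> carrier_vec n"
    have zx: "Z *\<^sub>v x \<in> carrier_vec n" using Z x by auto
    have "Re ((Z *\<^sub>v x) \<bullet>c x) \<le> vnorm (Z *\<^sub>v x) * vnorm x"
      by (rule Re_cscalar_le[OF zx x])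
    also have "\<dots> \<le> r * vnorm x * vnorm x"
      using Zb[OF x] by (intro mult_right_mono) auto
    finally have "c * ((vnorm x)\<^sup>2 - Re ((Z *\<^sub>v x) \<bullet>c x)) \<ge> c * ((1 - r) * (vnorm x)\<^sup>2)"
      using c by (intro mult_left_mono) (auto simp: algebra_simps power2_eq_square)
    moreover have "Re (herm_form X x) = c * ((vnorm x)\<^sup>2 - Re ((Z *\<^sub>v x) \<bullet>c x))"
      using x zx by (simp add: herm_form_def Xv cscalar_simps[where n=n] cscalar_self del: of_real_power)
    ultimately show "c * (1 - r) * (vnorm x)\<^sup>2 \<le> Re (herm_form X x)"
      by (simp add: mult.assoc)
  qed (use c r in simp)
  ultimately show ?thesis using X by blast
qed

text \<open>The difference solves the homogeneous Sylvester equation X (X - Y) + (X - Y) Y = X^2 -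
  Y^2 = 0, so \<open>sylvester_bound\<close> with e = 0 makes it vanish. The two roots are not
  assumed to commute.\<close>

lemma positive_definite_sqrt_unique:
  assumes X: "X \<in> carrier_mat n n" "positive_definite X" and Y: "Y \<in> carrier_mat n n" "positive_definite Y"
    and n: "n > 0" and eq: "X * X = Y * Y"
  shows "X = Y"
proof (rule mat_eqI_mult_vec[OF X(1) Y(1)])
  fix x :: "complex vec" assume x: "x \<in> carrier_vec n"
  obtain a where a: "a > 0" "\<And>x. x \<in> carrier_vec n \<Longrightarrow> Re (herm_form X x) \<ge> a * (vnorm x)\<^sup>2"
    using positive_definite_lower_bound[OF X(1) n X(2)] by metis
  obtain c where c: "c > 0" "\<And>x. x \<in> carrier_vec n \<Longrightarrow> Re (herm_form Y x) \<ge> c * (vnorm x)\<^sup>2"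
    using positive_definite_lower_bound[OF Y(1) n Y(2)] by metis
  have D: "X - Y \<in> carrier_mat n n" using X Y by auto
  have Dv: "(X - Y) *\<^sub>v x = X *\<^sub>v x - Y *\<^sub>v x" if "x \<in> carrier_vec n" for x
    using X Y that by (simp add: minus_mult_distrib_mat_vec[of _ n n])
  have "(a + c) * vnorm ((X - Y) *\<^sub>v x) \<le> 0 * vnorm x"
  proof (rule sylvester_bound[OF X(1) Y(1) D zero_carrier_mat n a(2) c(2) _ _ _ x])
    fix x :: "complex vec" assume x: "x \<in> carrier_vec n"
    have z: "0\<^sub>m n n *\<^sub>v x = 0\<^sub>v n" using x by (intro eq_vecI) auto
    then show "vnorm (0\<^sub>m n n *\<^sub>v x) \<le> 0 * vnorm x" by simp
    have e: "X *\<^sub>v (X *\<^sub>v x) = Y *\<^sub>v (Y *\<^sub>v x)"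
      using eq X Y x by (metis assoc_mult_mat_vec)
    show "X *\<^sub>v ((X - Y) *\<^sub>v x) + (X - Y) *\<^sub>v (Y *\<^sub>v x) = 0\<^sub>m n n *\<^sub>v x"
      using X Y x e by (simp add: Dv z mult_minus_distrib_mat_vec[of _ n n])
        (intro eq_vecI, auto)
  qed (use a c in auto)
  then have "vnorm ((X - Y) *\<^sub>v x) \<le> 0" using a c by (simp add: mult_le_0_iff)
  then have "vnorm ((X - Y) *\<^sub>v x) = 0" by (rule order.antisym) simp
  then have "X *\<^sub>v x - Y *\<^sub>v x = 0\<^sub>v n"
    using vnorm_eq_0_iff[OF mult_mat_vec_carrier[OF D x]] Dv[OF x] by simp
  then show "X *\<^sub>v x = Y *\<^sub>v x"
    using X Y by (intro eq_vecI) (auto simp: vec_eq_iff)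
qed

lemma mat_sqrt:
  assumes A: "A \<in> carrier_mat n n" and n: "n > 0" and pd: "positive_definite A"
  shows "mat_sqrt A \<in> carrier_mat n n" "positive_definite (mat_sqrt A)" "mat_sqrt A * mat_sqrt A = A"
proof -
  have "\<exists>!X. X \<in> carrier_mat (dim_row A) (dim_row A) \<and> positive_definite X \<and> X * X = A"
    using positive_definite_sqrt_exists[OF A n pd] positive_definite_sqrt_unique[OF _ _ _ _ n] A by auto
  from theI'[OF this]
  show "mat_sqrt A \<in> carrier_mat n n" "positive_definite (mat_sqrt A)" "mat_sqrt A * mat_sqrt A = A"
    using A unfolding mat_sqrt_def by auto
qed

section \<open>Integral representation of the square root\<close>

text \<open>For w = (1 + X)^-1 x one has x = w + X w, and the Cayley transform sends x to w - X w.
  The squared norm thus drops by 4 Re (w* X w) \<ge> 4 d |w|^2, while |x| \<le> (1 + K) |w|, so the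
  transform is a strict contraction, whether X is normal or not. The recurrence is stated free of
  the inverse, the form in which the series uses it.\<close>

lemma cayley_sequence:
  assumes X: "X \<in> carrier_mat n n" and d: "d > 0"
    and lb: "\<And>x. x \<in> carrier_vec n \<Longrightarrow> Re (herm_form X x) \<ge> d * (vnorm x)\<^sup>2"
    and v: "v \<in> carrier_vec n"
  obtains p r where "0 \<le> r" "r < 1" "p 0 = v" "\<And>l. p l \<in> carrier_vec n"
    "\<And>l. vnorm (p l) \<le> r ^ l * vnorm v"
    "\<And>l. p (Suc l) + X *\<^sub>v p (Suc l) = p l - X *\<^sub>v p l"
proof -
  obtain K where K: "K > 0" "\<And>x. x \<in> carrier_vec n \<Longrightarrow> vnorm (X *\<^sub>v x) \<le> K * vnorm x"
    using mult_mat_vec_norm_bound[OF X] by blast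
  have X1: "1\<^sub>m n + X \<in> carrier_mat n n" using X by auto
  have X1v: "(1\<^sub>m n + X) *\<^sub>v x = x + X *\<^sub>v x" if "x \<in> carrier_vec n" for x
    using X that by (simp add: add_mult_distrib_mat_vec[of _ n n])
  have low1: "Re (herm_form (1\<^sub>m n + X) x) \<ge> 1 * (vnorm x)\<^sup>2" if x: "x \<in> carrier_vec n" for x
  proof -
    have "0 \<le> d * (vnorm x)\<^sup>2" using d by simp
    moreover have "Re (herm_form (1\<^sub>m n + X) x) = (vnorm x)\<^sup>2 + Re (herm_form X x)"
      using x X by (simp add: herm_form_def X1v cscalar_add_left[of _ n] cscalar_self)
    ultimately show ?thesis using lb[OF x] by simp
  qed
  have "x = 0\<^sub>v n" if "x \<in> carrier_vec n" "(1\<^sub>m n + X) *\<^sub>v x = 0\<^sub>v n" for x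
    by (rule lower_bound_trivial_kernel[OF X1 _ low1 that]) simp_all
  note inv = mat_inverse_exists[OF X1 this]
  define W where "W = mat_inv (1\<^sub>m n + X)"
  have W: "W \<in> carrier_mat n n" using inv by (simp add: W_def)
  have Wv: "W *\<^sub>v x + X *\<^sub>v (W *\<^sub>v x) = x" if x: "x \<in> carrier_vec n" for x
  proof -
    have "(1\<^sub>m n + X) *\<^sub>v (W *\<^sub>v x) = x"
      using inv(3) x X1 W by (simp add: W_def flip: assoc_mult_mat_vec)
    then show ?thesis using X1v[of "W *\<^sub>v x"] W x by simp
  qed
  define S where "S = (\<lambda>x. W *\<^sub>v x - X *\<^sub>v (W *\<^sub>v x))"
  define q where "q = max 0 (1 - 4 * d / (1 + K)\<^sup>2)"
  define r where "r = sqrt q"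
  have "4 * d / (1 + K)\<^sup>2 > 0" using d K by (intro divide_pos_pos) auto
  then have q: "0 \<le> q" "q < 1" by (auto simp: q_def)
  then have r: "0 \<le> r" "r < 1" by (auto simp: r_def)
  have Sc: "S x \<in> carrier_vec n" if "x \<in> carrier_vec n" for x
    using X W that by (simp add: S_def)
  have Sb: "vnorm (S x) \<le> r * vnorm x" if x: "x \<in> carrier_vec n" for x
  proof -
    define w where "w = W *\<^sub>v x"
    have w: "w \<in> carrier_vec n" "X *\<^sub>v w \<in> carrier_vec n" using W X x by (auto simp: w_def)
    have xw: "x = w + X *\<^sub>v w" using Wv[OF x] by (simp add: w_def)
    have "vnorm x \<le> vnorm w + K * vnorm w"
      using vnorm_triangle[OF w] K(2)[OF w(1)] xw by simp
    then have "(vnorm x)\<^sup>2 \<le> ((1 + K) * vnorm w)\<^sup>2"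
      by (intro power_mono) (auto simp: algebra_simps)
    then have "(vnorm x)\<^sup>2 / (1 + K)\<^sup>2 \<le> (vnorm w)\<^sup>2"
      using K(1) by (simp add: power_mult_distrib pos_divide_le_eq mult.commute)
    then have "4 * d * ((vnorm x)\<^sup>2 / (1 + K)\<^sup>2) \<le> 4 * d * (vnorm w)\<^sup>2"
      using d by (intro mult_left_mono) auto
    moreover have "(vnorm (S x))\<^sup>2 = (vnorm x)\<^sup>2 - 4 * Re (herm_form X w)"
      using vnorm_diff_sq[OF w] vnorm_add_sq[OF w]
      unfolding xw[symmetric] herm_form_def S_def w_def[symmetric] by simp
    ultimately have "(vnorm (S x))\<^sup>2 \<le> (vnorm x)\<^sup>2 - 4 * d * ((vnorm x)\<^sup>2 / (1 + K)\<^sup>2)"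
      using lb[OF w(1)] by simp
    also have "\<dots> = (1 - 4 * d / (1 + K)\<^sup>2) * (vnorm x)\<^sup>2" by (simp add: algebra_simps)
    also have "\<dots> \<le> q * (vnorm x)\<^sup>2" by (intro mult_right_mono) (auto simp: q_def)
    also have "\<dots> = (r * vnorm x)\<^sup>2" using q by (simp add: r_def power_mult_distrib)
    finally show ?thesis by (rule power2_le_imp_le) (use r in simp)
  qed
  define p where "p = (\<lambda>l. (S ^^ l) v)"
  have pc: "p l \<in> carrier_vec n" for l
    by (induction l) (auto simp: p_def v Sc)
  have pS: "p (Suc l) = S (p l)" for l by (simp add: p_def)
  show ?thesis
  proof (rule that[OF r, of p])
    show "p 0 = v" by (simp add: p_def)
    show "p l \<in> carrier_vec n" for l by (rule pc)
    show "vnorm (p l) \<le> r ^ l * vnorm v" for l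
    proof (induction l)
      case (Suc l)
      have "vnorm (p (Suc l)) \<le> r * vnorm (p l)" using Sb[OF pc] by (simp add: pS)
      also have "\<dots> \<le> r * (r ^ l * vnorm v)" using Suc r by (intro mult_left_mono)
      finally show ?case by (simp add: mult.assoc)
    qed (simp add: p_def)
    show "p (Suc l) + X *\<^sub>v p (Suc l) = p l - X *\<^sub>v p l" for l
    proof -
      define w where "w = W *\<^sub>v p l"
      have w: "w \<in> carrier_vec n" unfolding w_def by (rule mult_mat_vec_carrier[OF W pc])
      have Xw: "X *\<^sub>v w \<in> carrier_vec n" "X *\<^sub>v (X *\<^sub>v w) \<in> carrier_vec n" using X w by auto
      have 1: "p l = w + X *\<^sub>v w" using Wv[OF pc] by (simp add: w_def)
      have 2: "p (Suc l) = w - X *\<^sub>v w" by (simp add: pS S_def w_def)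
      show ?thesis
        unfolding 1 2 mult_add_distrib_mat_vec[OF X w Xw(1)] mult_minus_distrib_mat_vec[OF X w Xw(1)]
        using w Xw by (intro eq_vecI) (auto simp del: index_mult_mat_vec)
    qed
  qed
qed

text \<open>Expanding in powers \<open>p\<^sub>l = C\<^sup>l X b\<close> of the Cayley transform \<open>C = (1 + X)\<^sup>-\<^sup>1 (1 - X)\<close>, the
  integrand is the Fourier series \<open>p\<^sub>0 + \<Sum>\<^sub>l 2 cos (2 l \<theta>) p\<^sub>l\<close>, which converges uniformly.\<close>

lemma sqrt_integral_representation:
  fixes z :: "real \<Rightarrow> complex vec"
  assumes X: "X \<in> carrier_mat n n" and A: "A \<in> carrier_mat n n" and XX: "X * X = A"
    and d: "d > 0" and Xlb: "\<And>x. x \<in> carrier_vec n \<Longrightarrow> Re (herm_form X x) \<ge> d * (vnorm x)\<^sup>2"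
    and a: "a > 0" and Alb: "\<And>x. x \<in> carrier_vec n \<Longrightarrow> Re (herm_form A x) \<ge> a * (vnorm x)\<^sup>2"
    and b: "b \<in> carrier_vec n" and y: "y \<in> carrier_vec n"
    and z: "\<And>\<theta>. z \<theta> \<in> carrier_vec n"
      "\<And>\<theta>. complex_of_real ((cos \<theta>)\<^sup>2) \<cdot>\<^sub>v (A *\<^sub>v z \<theta>) + complex_of_real ((sin \<theta>)\<^sup>2) \<cdot>\<^sub>v z \<theta> = b"
  shows "((\<lambda>\<theta>. (A *\<^sub>v z \<theta>) \<bullet>c y) has_integral (complex_of_real (pi / 2) * ((X *\<^sub>v b) \<bullet>c y))) {0..pi/2}"
proof -
  have Xb: "X *\<^sub>v b \<in> carrier_vec n" using X b by simp
  obtain p r where r: "0 \<le> r" "r < 1" and p0: "p 0 = X *\<^sub>v b" and pc: "\<And>l. p l \<in> carrier_vec n"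
    and pb: "\<And>l. vnorm (p l) \<le> r ^ l * vnorm (X *\<^sub>v b)"
    and prec: "\<And>l. p (Suc l) + X *\<^sub>v p (Suc l) = p l - X *\<^sub>v p l"
    using cayley_sequence[OF X d Xlb Xb] by metis
  have Xp: "X *\<^sub>v p l \<in> carrier_vec n" for l by (rule mult_mat_vec_carrier[OF X pc])
  have Ap: "A *\<^sub>v p l \<in> carrier_vec n" for l by (rule mult_mat_vec_carrier[OF A pc])
  have XXp: "X *\<^sub>v (X *\<^sub>v x) = A *\<^sub>v x" if "x \<in> carrier_vec n" for x
    using X that XX by (metis assoc_mult_mat_vec)
  \<comment> \<open>Note that \<open>c 0\<close> is 2, twice the weight of \<open>p 0\<close> in the
    series: the recurrence \<open>crec\<close> requires this value, while \<open>V\<close> starts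
    with \<open>p 0\<close> itself.\<close>
  define c where "c = (\<lambda>l (\<theta>::real). 2 * cos (2 * real l * \<theta>))"
  have crec: "c (Suc (Suc l)) \<theta> = 2 * cos (2 * \<theta>) * c (Suc l) \<theta> - c l \<theta>" for l \<theta>
  proof -
    have "2 * real (Suc (Suc l)) * \<theta> = 2 * real (Suc l) * \<theta> + 2 * \<theta>"
      "2 * real l * \<theta> = 2 * real (Suc l) * \<theta> - 2 * \<theta>"
      by (simp_all add: algebra_simps)
    then show ?thesis unfolding c_def by (simp only: cos_add cos_diff) (simp add: algebra_simps)
  qed
  have cb: "\<bar>c l \<theta>\<bar> \<le> 2" for l \<theta> by (simp add: c_def abs_mult)
  define V where "V = (\<lambda>L \<theta>. rec_nat (p 0) (\<lambda>l v. v + complex_of_real (c (Suc l) \<theta>) \<cdot>\<^sub>v p (Suc l)) L)"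
  have V0: "V 0 \<theta> = p 0" for \<theta> by (simp add: V_def)
  have VS: "V (Suc L) \<theta> = V L \<theta> + complex_of_real (c (Suc L) \<theta>) \<cdot>\<^sub>v p (Suc L)" for L \<theta>
    by (simp add: V_def)
  have Vc: "V L \<theta> \<in> carrier_vec n" for L \<theta>
    by (induction L) (auto simp: V0 VS pc)
  have AV: "A *\<^sub>v V L \<theta> \<in> carrier_vec n" for L \<theta> by (rule mult_mat_vec_carrier[OF A Vc])
  have AVS: "A *\<^sub>v V (Suc L) \<theta> = A *\<^sub>v V L \<theta> + complex_of_real (c (Suc L) \<theta>) \<cdot>\<^sub>v (A *\<^sub>v p (Suc L))" for L \<theta>
    using Vc[of L \<theta>] pc[of "Suc L"] A
    by (simp add: VS mult_add_distrib_mat_vec[of _ n n] mult_mat_vec[of _ n n])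
  \<comment> \<open>Applying cos^2 A + sin^2 to the partial sum telescopes against the recurrence of
    \<open>c\<close>; \<open>rem\<close> collects the boundary terms left at index \<open>L\<close>,
    and it decays like r^L.\<close>
  define rem where "rem = (\<lambda>L \<theta>. complex_of_real (c (Suc L) \<theta> / 4) \<cdot>\<^sub>v (p L - A *\<^sub>v p L)
      - complex_of_real (c L \<theta> / 4) \<cdot>\<^sub>v (p (Suc L) - A *\<^sub>v p (Suc L)))"
  have remc: "rem L \<theta> \<in> carrier_vec n" for L \<theta>
    using pc Ap by (simp add: rem_def)
  have entry: "complex_of_real ((cos \<theta>)\<^sup>2) * (A *\<^sub>v V L \<theta>) $ i + complex_of_real ((sin \<theta>)\<^sup>2) * V L \<theta> $ i
      = (A *\<^sub>v b) $ i - rem L \<theta> $ i" if i: "i < n" for L \<theta> i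
  proof -
    let ?u = "\<lambda>l. p l $ i" and ?x = "\<lambda>l. (X *\<^sub>v p l) $ i" and ?w = "\<lambda>l. (A *\<^sub>v p l) $ i"
    have e1: "?u (Suc l) + ?x (Suc l) = ?u l - ?x l" for l
      using arg_cong[OF prec[of l], of "\<lambda>v. v $ i"] i carrier_vecD[OF pc] carrier_vecD[OF Xp] X
      by (simp del: index_mult_mat_vec)
    have e2: "?x (Suc l) + ?w (Suc l) = ?x l - ?w l" for l
    proof -
      have "X *\<^sub>v p (Suc l) + A *\<^sub>v p (Suc l) = X *\<^sub>v (p (Suc l) + X *\<^sub>v p (Suc l))"
        using mult_add_distrib_mat_vec[OF X pc[of "Suc l"] Xp[of "Suc l"]] XXp[OF pc] by simp
      also have "\<dots> = X *\<^sub>v p l - A *\<^sub>v p l"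
        unfolding prec using mult_minus_distrib_mat_vec[OF X pc[of l] Xp[of l]] XXp[OF pc] by simp
      finally show ?thesis
        using arg_cong[of _ _ "\<lambda>v. v $ i"] i Xp[of l] Xp[of "Suc l"] Ap[of l] Ap[of "Suc l"]
        by (metis index_add_vec(1) index_minus_vec(1) carrier_vecD)
    qed
    have J1: "?u (Suc l) - ?w (Suc l) = ?u l - 2 * ?x l + ?w l" for l
    proof -
      have "?u (Suc l) - ?w (Suc l) = (?u (Suc l) + ?x (Suc l)) - (?x (Suc l) + ?w (Suc l))"
        by (simp del: index_mult_mat_vec)
      also have "\<dots> = ?u l - 2 * ?x l + ?w l"
        unfolding e1 e2 by (simp del: index_mult_mat_vec)
      finally show ?thesis .
    qed
    have cs: "complex_of_real (cos (2 * \<theta>)) = (complex_of_real (cos \<theta>))\<^sup>2 - (complex_of_real (sin \<theta>))\<^sup>2"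
      by (simp add: cos_double)
    have sn: "(complex_of_real (sin \<theta>))\<^sup>2 = 1 - (complex_of_real (cos \<theta>))\<^sup>2"
      by (simp add: sin_squared_eq flip: of_real_power)
    \<comment> \<open>Write J l for (1 - A) p l. The operator 4 (cos^2 A + sin^2) equals 2 (1 + A) -
      2 cos (2 \<theta>) (1 - A). As 1 - A = (1 - X) (1 + X), the vectors J l and J (l + 2) are (1 +
      X)^2 and (1 - X)^2 applied to p (l + 1), and they add up to 2 (1 + A) p (l + 1).\<close>
    have step: "4 * ((complex_of_real (cos \<theta>))\<^sup>2 * ?w (Suc l) + (complex_of_real (sin \<theta>))\<^sup>2 * ?u (Suc l)) =
      (?u l - ?w l) - 2 * complex_of_real (cos (2 * \<theta>)) * (?u (Suc l) - ?w (Suc l))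
        + (?u (Suc (Suc l)) - ?w (Suc (Suc l)))" for l
    proof -
      have "?u l - ?w l = (?u l - ?x l) + (?x l - ?w l)" by (simp del: index_mult_mat_vec)
      also have "\<dots> = ?u (Suc l) + 2 * ?x (Suc l) + ?w (Suc l)"
        unfolding e1[symmetric] e2[symmetric] by (simp del: index_mult_mat_vec)
      finally have uw: "?u l - ?w l = ?u (Suc l) + 2 * ?x (Suc l) + ?w (Suc l)" .
      show ?thesis
        unfolding J1[of "Suc l"] uw cs sn by (simp add: algebra_simps del: index_mult_mat_vec)
    qed
    have rem: "rem L \<theta> $ i = complex_of_real (c (Suc L) \<theta> / 4) * (?u L - ?w L)
       - complex_of_real (c L \<theta> / 4) * (?u (Suc L) - ?w (Suc L))" for L
      using i carrier_vecD[OF pc] carrier_vecD[OF Ap] A by (simp add: rem_def del: index_mult_mat_vec)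
    show ?thesis
    proof (induction L)
      case 0
      \<comment> \<open>The right-hand side enters through the constant term, as p 0 = X b; all
        further terms only telescope.\<close>
      have "X *\<^sub>v p 0 = A *\<^sub>v b" using XXp[OF b] by (simp add: p0)
      then have x0: "?x 0 = (A *\<^sub>v b) $ i" by simp
      have "4 * ((complex_of_real (cos \<theta>))\<^sup>2 * ?w 0 + (complex_of_real (sin \<theta>))\<^sup>2 * ?u 0) =
        4 * ?x 0 - 2 * complex_of_real (cos (2 * \<theta>)) * (?u 0 - ?w 0) + 2 * (?u (Suc 0) - ?w (Suc 0))"
        unfolding J1 cs sn by (simp add: algebra_simps del: index_mult_mat_vec)
      moreover have "4 * (rem 0 \<theta> $ i) = 2 * complex_of_real (cos (2 * \<theta>)) * (?u 0 - ?w 0) - 2 * (?u (Suc 0) - ?w (Suc 0))"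
        unfolding rem by (simp add: c_def field_simps del: index_mult_mat_vec)
      ultimately have "4 * ((complex_of_real (cos \<theta>))\<^sup>2 * ?w 0 + (complex_of_real (sin \<theta>))\<^sup>2 * ?u 0) =
          4 * ((A *\<^sub>v b) $ i - rem 0 \<theta> $ i)"
        unfolding x0 by (simp add: right_diff_distrib del: index_mult_mat_vec)
      then have "(complex_of_real (cos \<theta>))\<^sup>2 * ?w 0 + (complex_of_real (sin \<theta>))\<^sup>2 * ?u 0 =
          (A *\<^sub>v b) $ i - rem 0 \<theta> $ i"
        by (rule mult_left_cancel[THEN iffD1, rotated]) simp
      then show ?case by (simp add: V0 del: index_mult_mat_vec)
    next
      case (Suc L)
      define g where "g = complex_of_real (c (Suc L) \<theta>)"
      have VSi: "V (Suc L) \<theta> $ i = V L \<theta> $ i + g * ?u (Suc L)"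
        using i carrier_vecD[OF pc] carrier_vecD[OF Vc] by (simp add: VS g_def)
      have AVSi: "(A *\<^sub>v V (Suc L) \<theta>) $ i = (A *\<^sub>v V L \<theta>) $ i + g * ?w (Suc L)"
        using i carrier_vecD[OF Ap] carrier_vecD[OF AV] A
        by (simp add: AVS g_def del: index_mult_mat_vec)
      have rS: "4 * (rem L \<theta> $ i) = g * (?u L - ?w L) - complex_of_real (c L \<theta>) * (?u (Suc L) - ?w (Suc L))"
        unfolding rem g_def by (simp add: field_simps del: index_mult_mat_vec)
      have rSS: "4 * (rem (Suc L) \<theta> $ i) = (2 * complex_of_real (cos (2 * \<theta>)) * g - complex_of_real (c L \<theta>)) *
          (?u (Suc L) - ?w (Suc L)) - g * (?u (Suc (Suc L)) - ?w (Suc (Suc L)))"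
        unfolding rem crec g_def by (simp add: field_simps del: index_mult_mat_vec)
      let ?C = "(complex_of_real (cos \<theta>))\<^sup>2" and ?S = "(complex_of_real (sin \<theta>))\<^sup>2"
      have "4 * (?C * (A *\<^sub>v V (Suc L) \<theta>) $ i + ?S * V (Suc L) \<theta> $ i) =
          4 * (?C * (A *\<^sub>v V L \<theta>) $ i + ?S * V L \<theta> $ i) + g * (4 * (?C * ?w (Suc L) + ?S * ?u (Suc L)))"
        unfolding VSi AVSi by (simp add: algebra_simps del: index_mult_mat_vec)
      also have "4 * (?C * (A *\<^sub>v V L \<theta>) $ i + ?S * V L \<theta> $ i) = 4 * (A *\<^sub>v b) $ i - 4 * (rem L \<theta> $ i)"
        using Suc.IH by (simp del: index_mult_mat_vec)
      also have "4 * (A *\<^sub>v b) $ i - 4 * (rem L \<theta> $ i) + g * (4 * (?C * ?w (Suc L) + ?S * ?u (Suc L))) =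
          4 * (A *\<^sub>v b) $ i - 4 * (rem (Suc L) \<theta> $ i)"
        unfolding rS rSS step by (simp add: algebra_simps del: index_mult_mat_vec)
      finally have "4 * (?C * (A *\<^sub>v V (Suc L) \<theta>) $ i + ?S * V (Suc L) \<theta> $ i) =
          4 * ((A *\<^sub>v b) $ i - rem (Suc L) \<theta> $ i)"
        by (simp add: right_diff_distrib del: index_mult_mat_vec)
      then have "?C * (A *\<^sub>v V (Suc L) \<theta>) $ i + ?S * V (Suc L) \<theta> $ i = (A *\<^sub>v b) $ i - rem (Suc L) \<theta> $ i"
        by (rule mult_left_cancel[THEN iffD1, rotated]) simp
      then show ?case by (simp del: index_mult_mat_vec)
    qed
  qed
  obtain K where K: "K > 0" "\<And>x. x \<in> carrier_vec n \<Longrightarrow> vnorm (A *\<^sub>v x) \<le> K * vnorm x"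
    using mult_mat_vec_norm_bound[OF A] by blast
  \<comment> \<open>cos^2 a + sin^2 is an average of \<open>a\<close> and 1, so \<open>k\<close> is
    a coercivity constant of cos^2 A + sin^2 for all \<theta> at once.\<close>
  define k where "k = min a 1"
  have k: "k > 0" using a by (simp add: k_def)
  define E where "E = (1 + K) * vnorm (X *\<^sub>v b) / k"
  have remb: "vnorm (rem L \<theta>) \<le> (1 + K) * vnorm (X *\<^sub>v b) * r ^ L" for L \<theta>
  proof -
    have pA: "vnorm (p l - A *\<^sub>v p l) \<le> (1 + K) * (r ^ l * vnorm (X *\<^sub>v b))" for l
    proof -
      have "vnorm (p l - A *\<^sub>v p l) \<le> vnorm (p l) + K * vnorm (p l)"
        using vnorm_triangle_minus[OF pc Ap, of l l] K(2)[OF pc[of l]] by linarith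
      also have "\<dots> = (1 + K) * vnorm (p l)" by (simp add: algebra_simps)
      also have "\<dots> \<le> (1 + K) * (r ^ l * vnorm (X *\<^sub>v b))"
        using K(1) pb[of l] by (intro mult_left_mono) auto
      finally show ?thesis .
    qed
    have q: "\<bar>c l \<theta> / 4\<bar> \<le> 1 / 2" for l using cb[of l \<theta>] by simp
    have dc: "p l - A *\<^sub>v p l \<in> carrier_vec n" for l using pc Ap by simp
    have "vnorm (rem L \<theta>) \<le> \<bar>c (Suc L) \<theta> / 4\<bar> * vnorm (p L - A *\<^sub>v p L) +
        \<bar>c L \<theta> / 4\<bar> * vnorm (p (Suc L) - A *\<^sub>v p (Suc L))"
      using vnorm_triangle_minus[OF iffD2[OF smult_carrier_vec dc] iffD2[OF smult_carrier_vec dc],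
          of "complex_of_real (c (Suc L) \<theta> / 4)" L "complex_of_real (c L \<theta> / 4)" "Suc L"]
      unfolding rem_def by (simp only: vnorm_smult norm_of_real)
    also have "\<dots> \<le> 1/2 * ((1 + K) * (r ^ L * vnorm (X *\<^sub>v b))) + 1/2 * ((1 + K) * (r ^ L * vnorm (X *\<^sub>v b)))"
    proof (intro add_mono mult_mono q pA)
      have "r ^ Suc L * vnorm (X *\<^sub>v b) \<le> r ^ L * vnorm (X *\<^sub>v b)"
        using r by (intro mult_right_mono power_decreasing) auto
      then show "vnorm (p (Suc L) - A *\<^sub>v p (Suc L)) \<le> (1 + K) * (r ^ L * vnorm (X *\<^sub>v b))"
        using K(1) by (intro order_trans[OF pA[of "Suc L"]] mult_left_mono) auto
    qed auto
    finally show ?thesis by (simp add: algebra_simps)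
  qed
  \<comment> \<open>The vector \<open>A *\<^sub>v z \<theta>\<close> solves exactly the system that
    \<open>V L \<theta>\<close> solves up to \<open>rem\<close>, so coercivity turns the residual
    into an error bound uniform in \<theta>.\<close>
  have close: "vnorm (A *\<^sub>v z \<theta> - V L \<theta>) \<le> E * r ^ L" for L \<theta>
  proof -
    define e where "e = A *\<^sub>v z \<theta> - V L \<theta>"
    have Az: "A *\<^sub>v z \<theta> \<in> carrier_vec n" by (rule mult_mat_vec_carrier[OF A z(1)])
    have e: "e \<in> carrier_vec n" using Az Vc by (simp add: e_def)
    have Ae: "A *\<^sub>v e = A *\<^sub>v (A *\<^sub>v z \<theta>) - A *\<^sub>v V L \<theta>"
      unfolding e_def by (rule mult_minus_distrib_mat_vec[OF A Az Vc])
    have "A *\<^sub>v b = complex_of_real ((cos \<theta>)\<^sup>2) \<cdot>\<^sub>v (A *\<^sub>v (A *\<^sub>v z \<theta>)) + complex_of_real ((sin \<theta>)\<^sup>2) \<cdot>\<^sub>v (A *\<^sub>v z \<theta>)"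
      unfolding z(2)[of \<theta>, symmetric] using A Az z(1)[of \<theta>]
      by (simp add: mult_add_distrib_mat_vec[of _ n n] mult_mat_vec[of _ n n])
    then have Be: "complex_of_real ((cos \<theta>)\<^sup>2) \<cdot>\<^sub>v (A *\<^sub>v e) + complex_of_real ((sin \<theta>)\<^sup>2) \<cdot>\<^sub>v e = rem L \<theta>"
      unfolding Ae using entry[of _ \<theta> L] carrier_vecD[OF remc] carrier_vecD[OF Az] A carrier_vecD[OF Vc]
      by (intro eq_vecI) (auto simp: e_def algebra_simps simp del: index_mult_mat_vec)
    have "k * (vnorm e)\<^sup>2 \<le> (cos \<theta>)\<^sup>2 * (a * (vnorm e)\<^sup>2) + (sin \<theta>)\<^sup>2 * (vnorm e)\<^sup>2"
    proof -
      have "k * (vnorm e)\<^sup>2 = (cos \<theta>)\<^sup>2 * (k * (vnorm e)\<^sup>2) + (sin \<theta>)\<^sup>2 * (k * (vnorm e)\<^sup>2)"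
        by (metis distrib_right mult_1 sin_cos_squared_add2 )
      also have "\<dots> \<le> (cos \<theta>)\<^sup>2 * (a * (vnorm e)\<^sup>2) + (sin \<theta>)\<^sup>2 * (1 * (vnorm e)\<^sup>2)"
        by (intro add_mono mult_left_mono mult_right_mono) (auto simp: k_def)
      finally show ?thesis by simp
    qed
    also have "\<dots> \<le> (cos \<theta>)\<^sup>2 * Re (herm_form A e) + (sin \<theta>)\<^sup>2 * (vnorm e)\<^sup>2"
      using Alb[OF e] by (intro add_mono mult_left_mono) auto
    also have "\<dots> = Re (rem L \<theta> \<bullet>c e)"
      unfolding Be[symmetric] using e A
      by (simp add: cscalar_simps[where n=n] herm_form_def cscalar_self del: of_real_power)
    also have "\<dots> \<le> vnorm (rem L \<theta>) * vnorm e" by (rule Re_cscalar_le[OF remc e])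
    finally have "vnorm e * (k * vnorm e) \<le> vnorm e * vnorm (rem L \<theta>)"
      by (simp add: power2_eq_square algebra_simps)
    then have "k * vnorm e \<le> vnorm (rem L \<theta>) \<or> vnorm e = 0"
      using vnorm_nonneg[of e] by (metis mult_le_cancel_left_pos less_eq_real_def)
    then have "k * vnorm e \<le> vnorm (rem L \<theta>)" by auto
    then have "k * vnorm e \<le> (1 + K) * vnorm (X *\<^sub>v b) * r ^ L"
      using remb[of L \<theta>] by linarith
    then show ?thesis
      using k by (simp add: E_def e_def field_simps)
  qed
  define f where "f = (\<lambda>L \<theta>. V L \<theta> \<bullet>c y)"
  have f0: "f 0 \<theta> = p 0 \<bullet>c y" for \<theta> by (simp add: f_def V0)
  have fS: "f (Suc L) \<theta> = f L \<theta> + complex_of_real (c (Suc L) \<theta>) * (p (Suc L) \<bullet>c y)" for L \<theta>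
    unfolding f_def VS using Vc pc y by (simp add: cscalar_simps[where n=n])
  \<comment> \<open>For l \<ge> 1 the integral of cos (2 l \<theta>) over [0, pi/2] is sin (l pi) /
    (2 l) = 0, so all partial sums share the integral of the constant term and the limit is that of
    a constant sequence.\<close>
  have fint: "(f L has_integral (complex_of_real (pi / 2) * (p 0 \<bullet>c y))) {0..pi/2}" for L
  proof (induction L)
    case 0
    have "((\<lambda>\<theta>. p 0 \<bullet>c y) has_integral ((pi / 2 - 0) *\<^sub>R (p 0 \<bullet>c y))) {0..pi/2}"
      using has_integral_const_real[of "p 0 \<bullet>c y" 0 "pi/2"] by simp
    then show ?case by (simp add: f0[abs_def] scaleR_conv_of_real)
  next
    case (Suc L)
    let ?m = "2 * real (Suc L)"
    have m: "?m > 0" by simp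
    have "((\<lambda>\<theta>. c (Suc L) \<theta>) has_integral (2 * (sin (?m * (pi/2)) / ?m) - 2 * (sin (?m * 0) / ?m))) {0..pi/2}"
    proof (rule fundamental_theorem_of_calculus)
      show "((\<lambda>\<theta>. 2 * (sin (?m * \<theta>) / ?m)) has_vector_derivative c (Suc L) x) (at x within {0..pi/2})" for x
        using m unfolding c_def has_real_derivative_iff_has_vector_derivative[symmetric]
        by (auto intro!: derivative_eq_intros simp del: of_nat_Suc)
    qed simp
    moreover have "?m * (pi/2) = real (Suc L) * pi" by simp
    then have "sin (?m * (pi/2)) = 0" by (simp only: sin_npi)
    ultimately have "((\<lambda>\<theta>. c (Suc L) \<theta>) has_integral 0) {0..pi/2}" by simp
    from has_integral_linear[OF this bounded_linear_of_real]
    have "((\<lambda>\<theta>. complex_of_real (c (Suc L) \<theta>)) has_integral 0) {0..pi/2}"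
      by (simp add: o_def)
    from has_integral_add[OF Suc.IH has_integral_mult_left[OF this, of "p (Suc L) \<bullet>c y"]]
    show ?case by (simp add: fS[abs_def])
  qed
  have "uniform_limit {0..pi/2} f (\<lambda>\<theta>. (A *\<^sub>v z \<theta>) \<bullet>c y) sequentially"
  proof (rule uniform_limitI)
    fix e :: real assume e: "e > 0"
    have "(\<lambda>L. E * vnorm y * r ^ L) \<longlonglongrightarrow> E * vnorm y * 0"
      using r by (intro tendsto_mult tendsto_const LIMSEQ_power_zero) auto
    then have "\<forall>\<^sub>F L in sequentially. E * vnorm y * r ^ L < e"
      using e by (intro order_tendstoD(2)) auto
    then show "\<forall>\<^sub>F L in sequentially. \<forall>\<theta>\<in>{0..pi/2}. dist (f L \<theta>) ((A *\<^sub>v z \<theta>) \<bullet>c y) < e"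
    proof (rule eventually_mono, intro ballI)
      fix L \<theta> assume L: "E * vnorm y * r ^ L < e"
      have Az: "A *\<^sub>v z \<theta> \<in> carrier_vec n" by (rule mult_mat_vec_carrier[OF A z(1)])
      have "dist (f L \<theta>) ((A *\<^sub>v z \<theta>) \<bullet>c y) = cmod ((A *\<^sub>v z \<theta> - V L \<theta>) \<bullet>c y)"
        using Az Vc y by (simp add: f_def cscalar_simps[where n=n] dist_norm norm_minus_commute)
      also have "\<dots> \<le> vnorm (A *\<^sub>v z \<theta> - V L \<theta>) * vnorm y"
        using Az Vc y by (intro cscalar_Cauchy_Schwarz) auto
      also have "\<dots> \<le> E * r ^ L * vnorm y"
        using close by (intro mult_right_mono) auto
      finally show "dist (f L \<theta>) ((A *\<^sub>v z \<theta>) \<bullet>c y) < e" using L by (simp add: mult_ac)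
    qed
  qed
  moreover have "continuous_on {0..pi/2} (f L)" for L
    by (induction L) (auto simp: f0[abs_def] fS[abs_def] c_def intro!: continuous_intros)
  ultimately obtain I J where IJ: "\<And>L. (f L has_integral I L) {0..pi/2}"
      "((\<lambda>\<theta>. (A *\<^sub>v z \<theta>) \<bullet>c y) has_integral J) {0..pi/2}" "I \<longlonglongrightarrow> J"
    by (rule uniform_limit_integral[where F = sequentially]) auto
  have I: "I = (\<lambda>L. complex_of_real (pi / 2) * (p 0 \<bullet>c y))"
    using has_integral_unique[OF IJ(1) fint] by (intro ext)
  have J: "J = complex_of_real (pi / 2) * (p 0 \<bullet>c y)"
    using LIMSEQ_unique[OF IJ(3)[unfolded I] tendsto_const] .
  show ?thesis using IJ(2) unfolding J p0 .
qed

section \<open>Determinants of shifted Hessenberg matrices\<close>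

text \<open>Up to sign the determinant is the characteristic polynomial at 0, a product of
  \<open>k\<close> linear factors over the complex numbers; each root is an eigenvalue and therefore
  at most \<open>r\<close> in modulus.\<close>

lemma det_norm_bound:
  fixes G :: "complex mat"
  assumes G: "G \<in> carrier_mat k k" and r: "0 \<le> r"
    and Gb: "\<And>x. x \<in> carrier_vec k \<Longrightarrow> vnorm (G *\<^sub>v x) \<le> r * vnorm x"
  shows "cmod (det G) \<le> r ^ k"
proof -
  obtain as where as: "char_poly G = (\<Prod>a\<leftarrow>as. [:- a, 1:])" "length as = k"
    using char_poly_factorized[OF G] by blast
  have ev: "cmod a \<le> r" if "a \<in> set as" for a
  proof -
    have "poly (char_poly G) a = 0"
      using that by (auto simp: as(1) poly_prod_list prod_list_zero_iff)
    then have "eigenvalue G a" by (simp add: eigenvalue_root_char_poly[OF G])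
    then obtain v where v: "v \<in> carrier_vec k" "v \<noteq> 0\<^sub>v k" "G *\<^sub>v v = a \<cdot>\<^sub>v v"
      using G by (auto simp: eigenvalue_def eigenvector_def)
    have "cmod a * vnorm v \<le> r * vnorm v" using Gb[OF v(1)] v(3) by (simp add: vnorm_smult)
    then show ?thesis using vnorm_pos[OF v(1,2)] by simp
  qed
  have "poly (char_poly G) 0 = det (- G)"
  proof -
    have "char_matrix G 0 = G" using G by (intro eq_matI) (auto simp: char_matrix_def)
    then show ?thesis using char_poly_matrix[OF G, of 0] by simp
  qed
  also have "- G = (-1) \<cdot>\<^sub>m G" using G by (intro eq_matI) auto
  also have "det \<dots> = (-1) ^ k * det G" using G by simp
  finally have "cmod (det G) = cmod (poly (char_poly G) 0)" by (simp add: norm_mult norm_power)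
  also have "\<dots> = (\<Prod>a\<leftarrow>as. cmod a)"
    unfolding as(1) by (induction as) (auto simp: norm_mult)
  also have "\<dots> \<le> r ^ length as"
    using ev
  proof (induction as)
    case (Cons a as)
    then show ?case using r
      by (auto intro!: mult_mono prod_list_nonneg)
  qed simp
  finally show ?thesis by (simp add: as(2))
qed

lemma vnorm_shift_lower_bound:
  assumes A: "A \<in> carrier_mat n n" and x: "x \<in> carrier_vec n"
    and re: "0 \<le> Re (herm_form A x)" and s: "s > 0" "vnorm (A *\<^sub>v x) \<le> s * vnorm x"
    and pq: "0 \<le> p" "0 \<le> q"
  shows "sqrt (p\<^sup>2 + (q / s)\<^sup>2) * vnorm (A *\<^sub>v x)
    \<le> vnorm (complex_of_real p \<cdot>\<^sub>v (A *\<^sub>v x) + complex_of_real q \<cdot>\<^sub>v x)"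
proof (rule power2_le_imp_le)
  let ?u = "complex_of_real p \<cdot>\<^sub>v (A *\<^sub>v x)" and ?v = "complex_of_real q \<cdot>\<^sub>v x"
  have Ax: "A *\<^sub>v x \<in> carrier_vec n" using A x by simp
  have "(vnorm (?u + ?v))\<^sup>2 = p\<^sup>2 * (vnorm (A *\<^sub>v x))\<^sup>2 + 2 * Re (?v \<bullet>c ?u) + q\<^sup>2 * (vnorm x)\<^sup>2"
    using vnorm_add_sq[of ?u n ?v] Ax x by (simp add: vnorm_smult power_mult_distrib)
  also have "Re (?v \<bullet>c ?u) = p * q * Re (herm_form A x)"
    using Re_cscalar_sym[OF x Ax] Ax x by (simp add: cscalar_simps[where n=n] herm_form_def)
  finally have eq: "(vnorm (?u + ?v))\<^sup>2 =
    p\<^sup>2 * (vnorm (A *\<^sub>v x))\<^sup>2 + 2 * (p * q * Re (herm_form A x)) + q\<^sup>2 * (vnorm x)\<^sup>2" .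
  have "vnorm (A *\<^sub>v x) / s \<le> vnorm x" using s by (simp add: pos_divide_le_eq mult.commute)
  then have "(vnorm (A *\<^sub>v x) / s)\<^sup>2 \<le> (vnorm x)\<^sup>2"
    using s by (intro power_mono) auto
  then have "q\<^sup>2 * (vnorm (A *\<^sub>v x) / s)\<^sup>2 \<le> q\<^sup>2 * (vnorm x)\<^sup>2" by (rule mult_left_mono) simp
  moreover have "0 \<le> p * q * Re (herm_form A x)" using pq re by simp
  moreover have "(sqrt (p\<^sup>2 + (q / s)\<^sup>2) * vnorm (A *\<^sub>v x))\<^sup>2 =
      p\<^sup>2 * (vnorm (A *\<^sub>v x))\<^sup>2 + q\<^sup>2 * (vnorm (A *\<^sub>v x) / s)\<^sup>2"
    by (simp add: power_mult_distrib power_divide algebra_simps)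
  ultimately show "(sqrt (p\<^sup>2 + (q / s)\<^sup>2) * vnorm (A *\<^sub>v x))\<^sup>2 \<le> (vnorm (?u + ?v))\<^sup>2"
    unfolding eq by linarith
qed simp

text \<open>The quotient of the determinants is the determinant of G = H (p H + q)^-1, and
  \<open>vnorm_shift_lower_bound\<close> says that G has norm at most 1/t, with t the square root in
  the statement. The same bound puts the kernel of p H + q inside that of H, which is
  trivial.\<close>

lemma det_shift_lower_bound:
  fixes H :: "complex mat"
  assumes H: "H \<in> carrier_mat k k" and s: "s > 0" and m: "m > 0"
    and lb: "\<And>x. x \<in> carrier_vec k \<Longrightarrow> Re (herm_form H x) \<ge> m * (vnorm x)\<^sup>2"
    and ub: "\<And>x. x \<in> carrier_vec k \<Longrightarrow> vnorm (H *\<^sub>v x) \<le> s * vnorm x"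
    and pq: "0 \<le> p" "0 \<le> q" "p + q > 0"
  shows "sqrt (p\<^sup>2 + (q / s)\<^sup>2) ^ k * cmod (det H)
      \<le> cmod (det (complex_of_real p \<cdot>\<^sub>m H + complex_of_real q \<cdot>\<^sub>m 1\<^sub>m k))"
    and "det (complex_of_real p \<cdot>\<^sub>m H + complex_of_real q \<cdot>\<^sub>m 1\<^sub>m k) \<noteq> 0"
proof -
  define B where "B = complex_of_real p \<cdot>\<^sub>m H + complex_of_real q \<cdot>\<^sub>m 1\<^sub>m k"
  define t where "t = sqrt (p\<^sup>2 + (q / s)\<^sup>2)"
  have "p\<^sup>2 + (q / s)\<^sup>2 > 0"
    using pq s by (cases "p > 0") (auto intro: add_pos_nonneg add_nonneg_pos)
  then have t: "t > 0" by (simp add: t_def)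
  have B: "B \<in> carrier_mat k k" using H by (auto simp: B_def)
  have Bv: "B *\<^sub>v x = complex_of_real p \<cdot>\<^sub>v (H *\<^sub>v x) + complex_of_real q \<cdot>\<^sub>v x" if x: "x \<in> carrier_vec k" for x
  proof -
    have "B *\<^sub>v x = (complex_of_real p \<cdot>\<^sub>m H) *\<^sub>v x + (complex_of_real q \<cdot>\<^sub>m 1\<^sub>m k) *\<^sub>v x"
      unfolding B_def by (rule add_mult_distrib_mat_vec[OF _ _ x]) (use H in auto)
    then show ?thesis using H x by (simp add: smult_mat_mult_vec[of _ k k] mat_vec_smult_one)
  qed
  have re: "0 \<le> Re (herm_form H x)" if "x \<in> carrier_vec k" for x
  proof -
    have "0 \<le> m * (vnorm x)\<^sup>2" using m by simp
    then show ?thesis using lb[OF that] by linarith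
  qed
  have low: "t * vnorm (H *\<^sub>v x) \<le> vnorm (B *\<^sub>v x)" if x: "x \<in> carrier_vec k" for x
    using vnorm_shift_lower_bound[OF H x re[OF x] s ub[OF x] pq(1,2)] by (simp add: Bv[OF x] t_def)
  have ker: "x = 0\<^sub>v k" if x: "x \<in> carrier_vec k" "B *\<^sub>v x = 0\<^sub>v k" for x
  proof -
    have "t * vnorm (H *\<^sub>v x) \<le> 0" using low[OF x(1)] x(2) by simp
    then have "vnorm (H *\<^sub>v x) \<le> 0" using t by (simp add: mult_le_0_iff)
    then have "vnorm (H *\<^sub>v x) = 0" by (rule order.antisym) simp
    then have "H *\<^sub>v x = 0\<^sub>v k"
      using vnorm_eq_0_iff[OF mult_mat_vec_carrier[OF H x(1)]] by simp
    then show ?thesis using lower_bound_trivial_kernel[OF H m lb x(1)] by simp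
  qed
  note inv = mat_inverse_exists[OF B ker]
  show "det (complex_of_real p \<cdot>\<^sub>m H + complex_of_real q \<cdot>\<^sub>m 1\<^sub>m k) \<noteq> 0"
    using inv(1) by (simp add: B_def)
  define G where "G = H * mat_inv B"
  have G: "G \<in> carrier_mat k k" using H inv by (simp add: G_def)
  have "vnorm (G *\<^sub>v x) \<le> (1 / t) * vnorm x" if x: "x \<in> carrier_vec k" for x
  proof -
    define y where "y = mat_inv B *\<^sub>v x"
    have y: "y \<in> carrier_vec k" using inv x by (simp add: y_def)
    have "B *\<^sub>v y = x"
      using inv x B by (simp add: y_def flip: assoc_mult_mat_vec)
    moreover have "G *\<^sub>v x = H *\<^sub>v y"
      using inv x H by (simp add: y_def G_def)
    ultimately show ?thesis using low[OF y] t by (simp add: pos_le_divide_eq mult.commute)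
  qed
  then have 1: "cmod (det G) \<le> (1 / t) ^ k"
    using t by (intro det_norm_bound[OF G]) auto
  have "G * B = H"
    using H inv B by (simp add: G_def assoc_mult_mat[of _ k k _ k _ k])
  then have "det H = det G * det B"
    using det_mult[OF G B] by simp
  then have "t ^ k * cmod (det H) = t ^ k * cmod (det G) * cmod (det B)" by (simp add: norm_mult)
  also have "\<dots> \<le> t ^ k * (1 / t) ^ k * cmod (det B)"
    using 1 t by (intro mult_right_mono mult_left_mono) auto
  also have "\<dots> = cmod (det B)" using t by (simp add: power_one_over)
  finally show "sqrt (p\<^sup>2 + (q / s)\<^sup>2) ^ k * cmod (det H)
      \<le> cmod (det (complex_of_real p \<cdot>\<^sub>m H + complex_of_real q \<cdot>\<^sub>m 1\<^sub>m k))"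
    by (simp add: t_def B_def)
qed

text \<open>Cramer's rule: deleting the first row and the last column of an upper Hessenberg matrix
  leaves an upper triangular matrix with the subdiagonal on its diagonal.\<close>

lemma hessenberg_last_entry:
  fixes T :: "complex mat"
  assumes T: "T \<in> carrier_mat k k" and k: "k > 0"
    and hess: "\<And>i j. i < k \<Longrightarrow> Suc j < i \<Longrightarrow> T $$ (i, j) = 0"
    and y: "y \<in> carrier_vec k" and eq: "T *\<^sub>v y = c \<cdot>\<^sub>v unit_vec k 0"
  shows "det T * y $ (k - 1) = c * (-1) ^ (k - 1) * (\<Prod>j<k-1. T $$ (Suc j, j))"
proof -
  define D where "D = mat_delete T 0 (k - 1)"
  have D: "D \<in> carrier_mat (k - 1) (k - 1)" using T by (auto simp: D_def mat_delete_def)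
  have Dij: "D $$ (i, j) = T $$ (Suc i, j)" if "i < k - 1" "j < k - 1" for i j
  proof -
    have "0 < k" "k - 1 < k" using k by auto
    then show ?thesis
      using that T by (simp add: D_def mat_delete_def)
  qed
  have "upper_triangular D"
    using D Dij hess by (auto simp: upper_triangular_def)
  then have "det D = prod_list (diag_mat D)" using D by (rule det_upper_triangular)
  also have "\<dots> = (\<Prod>j<k-1. T $$ (Suc j, j))"
    using D Dij by (simp add: prod_list_diag_prod atLeast0LessThan)
  finally have detD: "det D = (\<Prod>j<k-1. T $$ (Suc j, j))" .
  note adj = adj_mat[OF T]
  \<comment> \<open>Multiplying by the adjugate instead of an inverse keeps the identity valid for
    singular \<open>T\<close>; the last entry picks the cofactor of position (0, k - 1) with its
    sign.\<close>
  have "det T \<cdot>\<^sub>v y = (adj_mat T * T) *\<^sub>v y"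
    unfolding adj(3) using y by (simp add: mat_vec_smult_one)
  also have "\<dots> = adj_mat T *\<^sub>v (c \<cdot>\<^sub>v unit_vec k 0)"
    using adj(1) T y eq by simp
  also have "\<dots> = c \<cdot>\<^sub>v (adj_mat T *\<^sub>v unit_vec k 0)"
    using adj(1) by (simp add: mult_mat_vec[of _ k k])
  finally have "(det T \<cdot>\<^sub>v y) $ (k - 1) = (c \<cdot>\<^sub>v (adj_mat T *\<^sub>v unit_vec k 0)) $ (k - 1)"
    by (rule arg_cong)
  then have "det T * y $ (k - 1) = c * adj_mat T $$ (k - 1, 0)"
    using y k adj(1) by simp
  also have "adj_mat T $$ (k - 1, 0) = (-1) ^ (k - 1) * det D"
    using T k by (simp add: adj_mat_def cofactor_def D_def)
  finally show ?thesis by (simp add: detD)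
qed

text \<open>A shift changes only the diagonal, so the subdiagonal product of p H + q is p^(k-1)
  times that of H. As the right-hand sides agree, that product is eliminated between two instances
  of \<open>hessenberg_last_entry\<close>.\<close>

lemma hessenberg_shift_last_entry:
  fixes H :: "complex mat"
  assumes H: "H \<in> carrier_mat k k" and k: "k > 0"
    and hess: "\<And>i j. i < k \<Longrightarrow> Suc j < i \<Longrightarrow> H $$ (i, j) = 0"
    and y0: "y0 \<in> carrier_vec k" "H *\<^sub>v y0 = c \<cdot>\<^sub>v unit_vec k 0"
    and y: "y \<in> carrier_vec k" "p \<cdot>\<^sub>v (H *\<^sub>v y) + q \<cdot>\<^sub>v y = c \<cdot>\<^sub>v unit_vec k 0"
  shows "det (p \<cdot>\<^sub>m H + q \<cdot>\<^sub>m 1\<^sub>m k) * y $ (k - 1) = p ^ (k - 1) * (det H * y0 $ (k - 1))"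
proof -
  define T where "T = p \<cdot>\<^sub>m H + q \<cdot>\<^sub>m 1\<^sub>m k"
  have T: "T \<in> carrier_mat k k" using H by (auto simp: T_def)
  have "T *\<^sub>v y = (p \<cdot>\<^sub>m H) *\<^sub>v y + (q \<cdot>\<^sub>m 1\<^sub>m k) *\<^sub>v y"
    unfolding T_def by (rule add_mult_distrib_mat_vec[OF _ _ y(1)]) (use H in auto)
  then have Ty: "T *\<^sub>v y = c \<cdot>\<^sub>v unit_vec k 0"
    using H y by (simp add: smult_mat_mult_vec[of _ k k] mat_vec_smult_one)
  have "(\<Prod>j<k-1. T $$ (Suc j, j)) = (\<Prod>j<k-1. p * H $$ (Suc j, j))"
    using H by (intro prod.cong) (auto simp: T_def)
  also have "\<dots> = p ^ (k - 1) * (\<Prod>j<k-1. H $$ (Suc j, j))"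
    by (simp add: prod.distrib)
  finally show ?thesis
    using hessenberg_last_entry[OF T k _ y(1) Ty] hessenberg_last_entry[OF H k hess y0] H hess
    by (simp add: T_def)
qed

section \<open>The Arnoldi process\<close>

lemma arnoldi_carrier:
  assumes A: "A \<in> carrier_mat n n" and b: "b \<in> carrier_vec n"
  shows "arnoldi_q A b j \<in> carrier_vec n" "arnoldi_w A b j i \<in> carrier_vec n"
  using assms
  by (induction A b j and A b j i rule: arnoldi_q_arnoldi_w.induct) auto

text \<open>Modified Gram-Schmidt takes each coefficient from the current work vector: a step
  annihilates the component along its own basis vector and, by orthonormality, leaves the components
  removed before at zero.\<close>

lemma arnoldi_w_orthogonal:
  assumes A: "A \<in> carrier_mat n n" and b: "b \<in> carrier_vec n"
    and on: "\<And>i l. i \<le> j \<Longrightarrow> l \<le> j \<Longrightarrow>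
      arnoldi_q A b i \<bullet>c arnoldi_q A b l = (if i = l then 1 else 0)"
  shows "i \<le> Suc j \<Longrightarrow> l < i \<Longrightarrow> arnoldi_w A b j i \<bullet>c arnoldi_q A b l = 0"
proof (induction i)
  case (Suc i)
  note cs = arnoldi_carrier[OF A b]
  have "arnoldi_w A b j (Suc i) \<bullet>c arnoldi_q A b l = arnoldi_w A b j i \<bullet>c arnoldi_q A b l -
     (arnoldi_w A b j i \<bullet>c arnoldi_q A b i) * (arnoldi_q A b i \<bullet>c arnoldi_q A b l)"
    using cs by (simp add: cscalar_diff_left[of _ n] cscalar_smult_left[of _ n])
  then show ?case using Suc on[of i l] by (cases "l = i") auto
qed simp

lemma arnoldi_orthonormal:
  assumes A: "A \<in> carrier_mat n n" and b: "b \<in> carrier_vec n" "b \<noteq> 0\<^sub>v n"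
    and def: "arnoldi_defined A b k"
  shows "j < k \<Longrightarrow> i \<le> j \<Longrightarrow> l \<le> j \<Longrightarrow>
    arnoldi_q A b i \<bullet>c arnoldi_q A b l = (if i = l then 1 else 0)"
proof (induction j arbitrary: i l)
  case 0
  have "vnorm (arnoldi_q A b 0) = 1"
    using vnorm_pos[OF b] by (simp add: vnorm_smult norm_divide)
  then show ?case using 0 by (simp add: cscalar_self del: arnoldi_q.simps)
next
  case (Suc j)
  note cs = arnoldi_carrier[OF A b(1)]
  have IH: "arnoldi_q A b i \<bullet>c arnoldi_q A b l = (if i = l then 1 else 0)" if "i \<le> j" "l \<le> j" for i l
    using Suc that by auto
  \<comment> \<open>\<open>Suc j < k\<close> is exactly the range in which
    \<open>arnoldi_defined\<close> excludes breakdown; the work vector of the last step is never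
    normalised here.\<close>
  have "arnoldi_h A b (Suc j) j \<noteq> 0" using def Suc.prems(1) by (simp add: arnoldi_defined_def)
  then have w0: "vnorm (arnoldi_w A b j (Suc j)) \<noteq> 0" by (simp add: arnoldi_h_def)
  have orth: "arnoldi_q A b (Suc j) \<bullet>c arnoldi_q A b l = 0" if "l \<le> j" for l
    using arnoldi_w_orthogonal[where j = j and i = "Suc j" and l = l, OF A b(1) IH] that cs(2)[of j "Suc j"] cs(1)[of l]
    by (simp add: cscalar_smult_left[of _ n] del: arnoldi_w.simps)
  have orth': "arnoldi_q A b l \<bullet>c arnoldi_q A b (Suc j) = 0" if "l \<le> j" for l
    using cscalar_cnj[OF cs(1) cs(1), of "Suc j" l] orth[OF that] by (simp del: arnoldi_q.simps)
  have "vnorm (arnoldi_q A b (Suc j)) = 1"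
    using w0 by (simp add: vnorm_smult norm_divide del: arnoldi_w.simps)
  then have self: "arnoldi_q A b (Suc j) \<bullet>c arnoldi_q A b (Suc j) = 1"
    by (simp add: cscalar_self del: arnoldi_q.simps)
  show ?case
    using Suc.prems IH orth orth' self by (auto simp: le_Suc_eq simp del: arnoldi_q.simps)
qed

text \<open>The loop invariant of the orthogonalisation, obtained by undoing the subtractions; with
  all \<open>Suc j\<close> steps done it yields column \<open>j\<close> of the Arnoldi
  relation.\<close>

lemma arnoldi_w_expansion:
  assumes A: "A \<in> carrier_mat n n" and b: "b \<in> carrier_vec n" and r: "r < n"
  shows "m \<le> Suc j \<Longrightarrow> (A *\<^sub>v arnoldi_q A b j) $ r =
    (\<Sum>i<m. arnoldi_h A b i j * arnoldi_q A b i $ r) + arnoldi_w A b j m $ r"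
proof (induction m)
  case (Suc m)
  note cs = arnoldi_carrier[OF A b]
  have "arnoldi_w A b j (Suc m) $ r = arnoldi_w A b j m $ r - arnoldi_h A b m j * arnoldi_q A b m $ r"
    using r Suc.prems carrier_vecD[OF cs(1)] by (simp add: arnoldi_h_def)
  then show ?case using Suc by (simp del: arnoldi_w.simps index_mult_mat_vec)
qed simp

text \<open>The residual direction of the last step, \<open>h\<^bsub>k+1,k\<^esub> q\<^bsub>k+1\<^esub>\<close> in the usual notation.\<close>

definition arnoldi_residual :: "complex mat \<Rightarrow> complex vec \<Rightarrow> nat \<Rightarrow> complex vec" where
  "arnoldi_residual A b k = arnoldi_w A b (k - 1) k"

locale arnoldi_process =
  fixes A :: "complex mat" and b :: "complex vec" and n k :: nat
  assumes A: "A \<in> carrier_mat n n" and b: "b \<in> carrier_vec n" "b \<noteq> 0\<^sub>v n"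
    and k: "k > 0" and def: "arnoldi_defined A b k"
begin

abbreviation "Q \<equiv> arnoldi_Q A b k"
abbreviation "H \<equiv> arnoldi_H A b k"
abbreviation "qv \<equiv> arnoldi_q A b"
abbreviation "wv \<equiv> arnoldi_residual A b k"

lemma arnoldi_Q_carrier: "Q \<in> carrier_mat n k"
  using b by (auto simp: arnoldi_Q_def)

lemma arnoldi_H_carrier: "H \<in> carrier_mat k k"
  by (simp add: arnoldi_H_def)

lemma arnoldi_residual_carrier: "wv \<in> carrier_vec n"
  using arnoldi_carrier[OF A b(1)] by (simp add: arnoldi_residual_def)

lemma arnoldi_Q_mult_index:
  assumes "g \<in> carrier_vec k" "r < n"
  shows "(Q *\<^sub>v g) $ r = (\<Sum>j<k. g $ j * qv j $ r)"
  using assms arnoldi_Q_carrier b carrier_vecD[OF arnoldi_carrier(1)[OF A b(1)]]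
  by (auto simp: scalar_prod_def atLeast0LessThan arnoldi_Q_def mat_of_cols_index mult.commute
      intro!: sum.cong)

lemma arnoldi_Q_cscalar:
  assumes g: "g \<in> carrier_vec k" and v: "v \<in> carrier_vec n"
  shows "(Q *\<^sub>v g) \<bullet>c v = (\<Sum>j<k. g $ j * (qv j \<bullet>c v))"
proof -
  have "(Q *\<^sub>v g) \<bullet>c v = (\<Sum>r<n. (Q *\<^sub>v g) $ r * cnj (v $ r))"
    using v by (simp add: scalar_prod_def atLeast0LessThan conjugate_complex_def del: index_mult_mat_vec)
  also have "\<dots> = (\<Sum>r<n. \<Sum>j<k. g $ j * qv j $ r * cnj (v $ r))"
    using arnoldi_Q_mult_index[OF g] by (simp add: sum_distrib_right del: index_mult_mat_vec)
  also have "\<dots> = (\<Sum>j<k. \<Sum>r<n. g $ j * qv j $ r * cnj (v $ r))"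
    by (rule sum.swap)
  also have "\<dots> = (\<Sum>j<k. g $ j * (qv j \<bullet>c v))"
    using v by (simp add: scalar_prod_def atLeast0LessThan conjugate_complex_def sum_distrib_left mult.assoc)
  finally show ?thesis .
qed

lemma arnoldi_orthonormal': "i < k \<Longrightarrow> j < k \<Longrightarrow> qv i \<bullet>c qv j = (if i = j then 1 else 0)"
  using arnoldi_orthonormal[OF A b def, of "max i j" i j] by auto

lemma arnoldi_Q_adjoint_index:
  assumes v: "v \<in> carrier_vec n" and i: "i < k"
  shows "(mat_adjoint Q *\<^sub>v v) $ i = v \<bullet>c qv i"
proof -
  have "Q $$ (r, i) = qv i $ r" if "r < n" for r
    using that i b by (simp add: arnoldi_Q_def mat_of_cols_index)
  then show ?thesis
    using assms arnoldi_Q_carrier carrier_vecD[OF arnoldi_carrier(1)[OF A b(1)]]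
      mat_adjoint_carrier[OF arnoldi_Q_carrier]
    by (auto simp: scalar_prod_def atLeast0LessThan mat_adjoint_index[OF arnoldi_Q_carrier]
        conjugate_complex_def mult.commute intro!: sum.cong)
qed

lemma arnoldi_Q_adjoint_Q:
  assumes g: "g \<in> carrier_vec k"
  shows "mat_adjoint Q *\<^sub>v (Q *\<^sub>v g) = g"
proof (rule eq_vecI)
  fix i assume "i < dim_vec g"
  then have i: "i < k" using g by simp
  have "(mat_adjoint Q *\<^sub>v (Q *\<^sub>v g)) $ i = (Q *\<^sub>v g) \<bullet>c qv i"
    by (rule arnoldi_Q_adjoint_index[OF mult_mat_vec_carrier[OF arnoldi_Q_carrier g] i])
  also have "\<dots> = (\<Sum>j<k. g $ j * (if j = i then 1 else 0))"
    using arnoldi_Q_cscalar[OF g arnoldi_carrier(1)[OF A b(1)]] arnoldi_orthonormal'[OF _ i] by simp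
  also have "\<dots> = g $ i"
    using i by (simp add: if_distrib cong: if_cong)
  finally show "(mat_adjoint Q *\<^sub>v (Q *\<^sub>v g)) $ i = g $ i" .
qed (use g arnoldi_Q_carrier in auto)

lemma arnoldi_Q_cscalar_Q:
  assumes "g \<in> carrier_vec k" "g' \<in> carrier_vec k"
  shows "(Q *\<^sub>v g) \<bullet>c (Q *\<^sub>v g') = g \<bullet>c g'"
  using cscalar_adjoint[OF arnoldi_Q_carrier assms(1) mult_mat_vec_carrier[OF arnoldi_Q_carrier assms(2)]]
  by (simp add: arnoldi_Q_adjoint_Q[OF assms(2)])

lemma vnorm_arnoldi_Q: "g \<in> carrier_vec k \<Longrightarrow> vnorm (Q *\<^sub>v g) = vnorm g"
  using arnoldi_Q_cscalar_Q[of g g] by (simp add: cscalar_self flip: of_real_power)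

text \<open>The last work vector has passed all \<open>k\<close> orthogonalisation steps. It is kept
  unnormalised, so the statement also covers a breakdown at step \<open>k\<close>, where it is
  zero.\<close>

lemma arnoldi_residual_orthogonal:
  assumes g: "g \<in> carrier_vec k"
  shows "wv \<bullet>c (Q *\<^sub>v g) = 0"
proof -
  have "qv j \<bullet>c wv = 0" if "j < k" for j
  proof -
    have "wv \<bullet>c qv j = 0"
      using arnoldi_w_orthogonal[where j = "k - 1" and i = k and l = j,
          OF A b(1) arnoldi_orthonormal[OF A b def, of "k - 1"]] k that
      by (simp add: arnoldi_residual_def del: arnoldi_w.simps arnoldi_q.simps)
    then show ?thesis
      using cscalar_cnj[OF arnoldi_residual_carrier arnoldi_carrier(1)[OF A b(1)], of j] by simp
  qed
  then have "(Q *\<^sub>v g) \<bullet>c wv = 0"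
    by (simp add: arnoldi_Q_cscalar[OF g arnoldi_residual_carrier])
  then show ?thesis
    using cscalar_cnj[OF mult_mat_vec_carrier[OF arnoldi_Q_carrier g] arnoldi_residual_carrier] by simp
qed

text \<open>The matrix relation behind this is A Q = Q H + w e_k^T. In every column but the last the
  remaining work vector is a multiple of the next basis vector and is absorbed by the subdiagonal of
  \<open>H\<close>.\<close>

lemma arnoldi_relation:
  assumes g: "g \<in> carrier_vec k"
  shows "A *\<^sub>v (Q *\<^sub>v g) = Q *\<^sub>v (H *\<^sub>v g) + g $ (k - 1) \<cdot>\<^sub>v wv"
proof (rule eq_vecI)
  note cs = arnoldi_carrier[OF A b(1)]
  fix r assume "r < dim_vec (Q *\<^sub>v (H *\<^sub>v g) + g $ (k - 1) \<cdot>\<^sub>v wv)"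
  then have r: "r < n" using arnoldi_residual_carrier by simp
  have col: "(A *\<^sub>v qv j) $ r = (\<Sum>i<k. arnoldi_h A b i j * qv i $ r) + (if j = k - 1 then wv $ r else 0)"
    if j: "j < k" for j
  proof (cases "j = k - 1")
    case True
    then show ?thesis
      using arnoldi_w_expansion[OF A b(1) r, of k j] k
      by (simp add: arnoldi_residual_def del: arnoldi_w.simps arnoldi_q.simps index_mult_mat_vec)
  next
    case False
    then have j': "Suc j < k" using j by simp
    have "arnoldi_h A b (Suc j) j \<noteq> 0" using def j' by (simp add: arnoldi_defined_def)
    then have w0: "vnorm (arnoldi_w A b j (Suc j)) \<noteq> 0" by (simp add: arnoldi_h_def)
    have "arnoldi_w A b j (Suc j) $ r = arnoldi_h A b (Suc j) j * qv (Suc j) $ r"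
      using w0 r carrier_vecD[OF cs(2)] by (simp add: arnoldi_h_def del: arnoldi_w.simps)
    then have "(A *\<^sub>v qv j) $ r = (\<Sum>i<Suc (Suc j). arnoldi_h A b i j * qv i $ r)"
      using arnoldi_w_expansion[OF A b(1) r, of "Suc j" j]
      by (simp del: arnoldi_w.simps arnoldi_q.simps index_mult_mat_vec)
    also have "\<dots> = (\<Sum>i<k. arnoldi_h A b i j * qv i $ r)"
      using j' by (intro sum.mono_neutral_left) (auto simp: arnoldi_h_def)
    finally show ?thesis using False by simp
  qed
  have "(A *\<^sub>v (Q *\<^sub>v g)) $ r = (\<Sum>c<n. A $$ (r, c) * (Q *\<^sub>v g) $ c)"
    using r A arnoldi_Q_carrier by (simp add: scalar_prod_def atLeast0LessThan)
  also have "\<dots> = (\<Sum>c<n. \<Sum>j<k. A $$ (r, c) * (g $ j * qv j $ c))"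
    using arnoldi_Q_mult_index[OF g] by (simp add: sum_distrib_left del: index_mult_mat_vec)
  also have "\<dots> = (\<Sum>j<k. \<Sum>c<n. A $$ (r, c) * (g $ j * qv j $ c))"
    by (rule sum.swap)
  also have "\<dots> = (\<Sum>j<k. g $ j * (A *\<^sub>v qv j) $ r)"
    using r A carrier_vecD[OF cs(1)]
    by (simp add: scalar_prod_def atLeast0LessThan sum_distrib_left mult_ac)
  also have "\<dots> = (\<Sum>j<k. \<Sum>i<k. g $ j * (arnoldi_h A b i j * qv i $ r)) +
      (\<Sum>j<k. g $ j * (if j = k - 1 then wv $ r else 0))"
    using col by (simp add: distrib_left sum.distrib sum_distrib_left del: index_mult_mat_vec)
  also have "(\<Sum>j<k. g $ j * (if j = k - 1 then wv $ r else 0)) = (\<Sum>j<k. if j = k - 1 then g $ (k - 1) * wv $ r else 0)"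
    by (intro sum.cong) auto
  also have "\<dots> = g $ (k - 1) * wv $ r"
    using k by simp
  also have "(\<Sum>j<k. \<Sum>i<k. g $ j * (arnoldi_h A b i j * qv i $ r)) =
      (\<Sum>i<k. \<Sum>j<k. g $ j * (arnoldi_h A b i j * qv i $ r))"
    by (rule sum.swap)
  also have "\<dots> = (\<Sum>i<k. (H *\<^sub>v g) $ i * qv i $ r)"
    using g by (simp add: arnoldi_H_def scalar_prod_def atLeast0LessThan sum_distrib_left sum_distrib_right mult_ac)
  also have "\<dots> = (Q *\<^sub>v (H *\<^sub>v g)) $ r"
    using arnoldi_Q_mult_index[OF mult_mat_vec_carrier[OF arnoldi_H_carrier g] r] by simp
  finally show "(A *\<^sub>v (Q *\<^sub>v g)) $ r = (Q *\<^sub>v (H *\<^sub>v g) + g $ (k - 1) \<cdot>\<^sub>v wv) $ r"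
    using r arnoldi_Q_carrier carrier_vecD[OF arnoldi_residual_carrier]
    by (simp del: index_mult_mat_vec)
qed (use A arnoldi_residual_carrier in simp)

lemma arnoldi_Q_b:
  shows "mat_adjoint Q *\<^sub>v b = complex_of_real (vnorm b) \<cdot>\<^sub>v unit_vec k 0"
    and "Q *\<^sub>v (complex_of_real (vnorm b) \<cdot>\<^sub>v unit_vec k 0) = b"
proof -
  let ?g = "complex_of_real (vnorm b) \<cdot>\<^sub>v unit_vec k 0"
  have g: "?g \<in> carrier_vec k" by simp
  show eq: "Q *\<^sub>v ?g = b"
  proof (rule eq_vecI)
    fix r assume "r < dim_vec b"
    then have r: "r < n" using b by simp
    have "(Q *\<^sub>v ?g) $ r = (\<Sum>j<k. ?g $ j * qv j $ r)" by (rule arnoldi_Q_mult_index[OF g r])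
    also have "\<dots> = (\<Sum>j<k. if j = 0 then complex_of_real (vnorm b) * qv 0 $ r else 0)"
      using k by (intro sum.cong) auto
    also have "\<dots> = b $ r"
      using k r b vnorm_pos[OF b] by simp
    finally show "(Q *\<^sub>v ?g) $ r = b $ r" .
  qed (use arnoldi_Q_carrier b in simp)
  show "mat_adjoint Q *\<^sub>v b = ?g"
    using arnoldi_Q_adjoint_Q[OF g] eq by simp
qed

text \<open>This is H = Q* A Q at the level of forms: the residual part of the Arnoldi relation is
  orthogonal to the range of \<open>Q\<close>. Through it \<open>H\<close> inherits the lower bound
  on the real part.\<close>

lemma herm_form_arnoldi_H:
  assumes g: "g \<in> carrier_vec k"
  shows "herm_form H g = herm_form A (Q *\<^sub>v g)"
proof -
  have Hg: "H *\<^sub>v g \<in> carrier_vec k" by (rule mult_mat_vec_carrier[OF arnoldi_H_carrier g])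
  note Qc = mult_mat_vec_carrier[OF arnoldi_Q_carrier]
  have "herm_form A (Q *\<^sub>v g) = (Q *\<^sub>v (H *\<^sub>v g) + g $ (k - 1) \<cdot>\<^sub>v wv) \<bullet>c (Q *\<^sub>v g)"
    by (simp add: herm_form_def arnoldi_relation[OF g])
  also have "\<dots> = (Q *\<^sub>v (H *\<^sub>v g)) \<bullet>c (Q *\<^sub>v g) + g $ (k - 1) * (wv \<bullet>c (Q *\<^sub>v g))"
    using Qc[OF Hg] Qc[OF g] arnoldi_residual_carrier
    by (simp add: cscalar_simps[where n=n])
  finally show ?thesis
    by (simp add: arnoldi_residual_orthogonal[OF g] arnoldi_Q_cscalar_Q[OF Hg g] herm_form_def)
qed

text \<open>Q H g is the orthogonal projection of A Q g onto the range of \<open>Q\<close>; testing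
  A Q g against it gives |H g|^2, and one factor |H g| cancels.\<close>

lemma vnorm_arnoldi_H:
  assumes g: "g \<in> carrier_vec k"
  shows "vnorm (H *\<^sub>v g) \<le> vnorm (A *\<^sub>v (Q *\<^sub>v g))"
proof -
  have Hg: "H *\<^sub>v g \<in> carrier_vec k" by (rule mult_mat_vec_carrier[OF arnoldi_H_carrier g])
  note Qc = mult_mat_vec_carrier[OF arnoldi_Q_carrier]
  have "(vnorm (H *\<^sub>v g))\<^sup>2 = Re ((A *\<^sub>v (Q *\<^sub>v g)) \<bullet>c (Q *\<^sub>v (H *\<^sub>v g)))"
    using Qc[OF Hg] arnoldi_residual_carrier
    by (simp add: arnoldi_relation[OF g] cscalar_simps[where n=n] arnoldi_residual_orthogonal[OF Hg]
        vnorm_arnoldi_Q[OF Hg] cscalar_self del: of_real_power)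
  also have "\<dots> \<le> vnorm (A *\<^sub>v (Q *\<^sub>v g)) * vnorm (H *\<^sub>v g)"
    using Re_cscalar_le[OF mult_mat_vec_carrier[OF A Qc[OF g]] Qc[OF Hg]] vnorm_arnoldi_Q[OF Hg] by simp
  finally have "vnorm (H *\<^sub>v g) * vnorm (H *\<^sub>v g) \<le> vnorm (A *\<^sub>v (Q *\<^sub>v g)) * vnorm (H *\<^sub>v g)"
    by (simp add: power2_eq_square)
  then show ?thesis
    using vnorm_nonneg[of "H *\<^sub>v g"] vnorm_nonneg[of "A *\<^sub>v (Q *\<^sub>v g)"]
    by (metis mult_le_cancel_right_pos less_eq_real_def)
qed

end

section \<open>The Beta integral\<close>

text \<open>z + 1/4 is the mean of z and z + 1 with weights 3/4 and 1/4, so log-convexity gives the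
  bound Gamma(z)^(3/4) (z Gamma(z))^(1/4).\<close>

lemma Gamma_quarter_shift_bound:
  fixes z :: real
  assumes z: "z > 0"
  shows "Gamma (z + 1/4) \<le> z powr (1/4) * Gamma z"
proof -
  have "(ln \<circ> Gamma) ((1 - 1/4) *\<^sub>R z + (1/4) *\<^sub>R (z + 1)) \<le>
      (1 - 1/4) * (ln \<circ> Gamma) z + (1/4) * (ln \<circ> Gamma) (z + 1)"
    using z by (intro convex_onD[OF log_convex_Gamma_real]) auto
  moreover have "(1 - 1/4) *\<^sub>R z + (1/4) *\<^sub>R (z + 1) = z + 1/4" by (simp add: field_simps)
  ultimately have le: "ln (Gamma (z + 1/4)) \<le> (1 - 1/4) * ln (Gamma z) + (1/4) * ln (Gamma (z + 1))"
    by (simp only: o_def)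
  have g: "Gamma z > 0" using z by simp
  have "Gamma (z + 1) = z * Gamma z" using z by (intro Gamma_plus1) (auto elim!: nonpos_Ints_cases)
  then have L1: "ln (Gamma (z + 1)) = ln z + ln (Gamma z)" using z g by (simp add: ln_mult_pos)
  have L2: "ln (z powr (1/4) * Gamma z) = (1/4) * ln z + ln (Gamma z)"
    using z g by (simp add: ln_mult_pos ln_powr)
  have "ln (Gamma (z + 1/4)) \<le> ln (z powr (1/4) * Gamma z)"
  proof -
    have "(1 - 1/4) * y + (1/4) * (x + y) = (1/4) * x + y" for x y :: real
      by (simp add: field_simps)
    then show ?thesis unfolding L2 using le unfolding L1 by simp
  qed
  then show ?thesis using z by (simp add: ln_le_cancel_iff)
qed

text \<open>With z = k/2 the Beta value is Gamma(3/4) Gamma(z - 3/4) / Gamma(z). The functional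
  equation Gamma(z - 3/4) = Gamma(z + 1/4) / (z - 3/4) makes
  \<open>Gamma_quarter_shift_bound\<close> applicable; z - 3/4 = (2k - 3)/4 is the source of the
  denominator 2k - 3, and z^(1/4) = k k^(-3/4) / 2^(1/4) of the other factors.\<close>

lemma Beta_half_shift_bound:
  fixes k :: nat
  assumes k: "k \<ge> 2"
  shows "Beta (3/4) (real k / 2 - 3/4) / (2 * pi) \<le>
    Gamma (3/4) / (2 powr (1/4) * pi) * (2 * real k / (2 * real k - 3)) * real k powr (-3/4)"
proof -
  define z where "z = real k / 2"
  have z: "z \<ge> 1" using k by (simp add: z_def)
  have "Gamma (z - 3/4 + 1) = (z - 3/4) * Gamma (z - 3/4)"
    using z by (intro Gamma_plus1) (auto elim!: nonpos_Ints_cases)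
  then have "(z - 3/4) * Gamma (z - 3/4) \<le> z powr (1/4) * Gamma z"
    using Gamma_quarter_shift_bound[of z] z by (simp add: add.commute)
  then have "Gamma (z - 3/4) / Gamma z \<le> z powr (1/4) / (z - 3/4)"
    using z Gamma_real_pos[of z] by (simp add: divide_simps mult.commute)
  then have "Gamma (3/4) * (Gamma (z - 3/4) / Gamma z) \<le> Gamma (3/4) * (z powr (1/4) / (z - 3/4))"
    using Gamma_real_pos[of "3/4"] by (intro mult_left_mono) auto
  then have "Beta (3/4) (z - 3/4) \<le> Gamma (3/4) * (z powr (1/4) / (z - 3/4))"
    by (simp add: Beta_def)
  then have "Beta (3/4) (z - 3/4) / (2 * pi) \<le> Gamma (3/4) * (z powr (1/4) / (z - 3/4)) / (2 * pi)"
    by (rule divide_right_mono) simp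
  also have "z powr (1/4) / (z - 3/4) = 2 / 2 powr (1/4) * (2 * real k / (2 * real k - 3)) * real k powr (-3/4)"
  proof -
    have 1: "z powr (1/4) = real k powr (1/4) / 2 powr (1/4)"
      by (simp add: z_def powr_divide)
    have 2: "real k powr (1/4) = real k * real k powr (-3/4)"
      using k powr_mult_base[of "real k" "-3/4"] by simp
    have 3: "z - 3/4 = (2 * real k - 3) / 4" by (simp add: z_def field_simps)
    show ?thesis unfolding 1 2 3 by simp
  qed
  finally show ?thesis by (simp add: z_def mult_ac)
qed

text \<open>The substitution \<open>t = sin\<^sup>4 \<theta> / (s\<^sup>2 cos\<^sup>4 \<theta> + sin\<^sup>4 \<theta>)\<close> turns the integrand into that of the
  Beta function.\<close>

lemma trig_Beta_integral:
  fixes s :: real and k :: nat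
  assumes s: "s > 0" and k: "k \<ge> 2"
  shows "((\<lambda>\<theta>. (sin \<theta>)\<^sup>2 * (cos \<theta>) ^ (2 * (k - 2)) / sqrt (((cos \<theta>)\<^sup>2)\<^sup>2 + ((sin \<theta>)\<^sup>2 / s)\<^sup>2) ^ k)
    has_integral (s powr (3/2) / 4 * Beta (3/4) (real k / 2 - 3/4))) {0..pi/2}"
proof -
  define a b where "a = (3/4 :: real)" and "b = real k / 2 - 3/4"
  have ab: "a > 0" "b > 0" using k by (auto simp: a_def b_def)
  define h where "h = (\<lambda>t. t powr (a - 1) * (1 - t) powr (b - 1) :: real)"
  have hB: "(h has_integral Beta a b) {0..1}"
    unfolding h_def by (rule has_integral_Beta_real[OF ab])
  \<comment> \<open>\<open>h\<close> is unbounded near 0, and near 1 when k \<le> 3, so the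
    substitution goes through its indefinite integral: continuity of \<open>G\<close> on the closed
    interval and a derivative in the open one suffice for the fundamental theorem.\<close>
  define F where "F = (\<lambda>x. integral {0..x} h)"
  define D where "D = (\<lambda>\<theta>. s\<^sup>2 * cos \<theta> ^ 4 + sin \<theta> ^ 4)"
  define X where "X = (\<lambda>\<theta>. sin \<theta> ^ 4 / D \<theta>)"
  have D: "D \<theta> > 0" for \<theta>
  proof (cases "cos \<theta> = 0")
    case True
    then have "sin \<theta> \<noteq> 0" using sin_cos_squared_add[of \<theta>] by auto
    then show ?thesis using True by (simp add: D_def)
  next
    case False
    then show ?thesis using s by (simp add: D_def add_pos_nonneg)
  qed
  have X01: "0 \<le> X \<theta>" "X \<theta> \<le> 1" for \<theta>
    using D[of \<theta>] by (simp_all add: X_def) (simp add: D_def)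
  define G where "G = (\<lambda>\<theta>. s powr (3/2) / 4 * F (X \<theta>))"
  have contF: "continuous_on {0..1} F"
    unfolding F_def using hB by (intro indefinite_integral_continuous_1) auto
  have contX: "continuous_on {0..pi/2} X"
    unfolding X_def D_def using D by (intro continuous_intros) (auto simp: D_def dest: less_imp_neq[symmetric])
  have contG: "continuous_on {0..pi/2} G"
    unfolding G_def using X01
    by (intro continuous_intros continuous_on_compose2[OF contF contX]) auto
  have deriv: "(G has_vector_derivative
      ((sin \<theta>)\<^sup>2 * (cos \<theta>) ^ (2 * (k - 2)) / sqrt (((cos \<theta>)\<^sup>2)\<^sup>2 + ((sin \<theta>)\<^sup>2 / s)\<^sup>2) ^ k)) (at \<theta>)"
    if th: "\<theta> \<in> {0<..<pi/2}" for \<theta>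
  proof -
    have sc: "sin \<theta> > 0" "cos \<theta> > 0" using th by (auto intro: sin_gt_zero cos_gt_zero)
    have X0: "X \<theta> > 0" using sc D by (simp add: X_def)
    have X1': "1 - X \<theta> = s\<^sup>2 * cos \<theta> ^ 4 / D \<theta>"
      using D[of \<theta>] by (simp add: X_def field_simps) (simp add: D_def)
    moreover have "s\<^sup>2 * cos \<theta> ^ 4 / D \<theta> > 0" using s sc D by simp
    ultimately have X1: "X \<theta> < 1" by simp
    have "(F has_vector_derivative h (X \<theta>)) (at (X \<theta>) within {0..1})"
      unfolding F_def
    proof (rule integral_has_vector_derivative_continuous_at[where S = "{}", simplified])
      show "continuous (at (X \<theta>) within {0..1}) h"
        unfolding h_def using X0 X1 by (intro continuous_intros) auto
    qed (use hB X0 X1 in auto)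
    then have F': "(F has_real_derivative h (X \<theta>)) (at (X \<theta>))"
      using X0 X1 at_within_interior[of "X \<theta>" "{0..1}"]
      by (simp add: has_real_derivative_iff_has_vector_derivative interior_atLeastAtMost_real)
    have X': "(X has_real_derivative 4 * s\<^sup>2 * sin \<theta> ^ 3 * cos \<theta> ^ 3 / (D \<theta>)\<^sup>2) (at \<theta>)"
    proof -
      have "(X has_real_derivative ((4 * sin \<theta> ^ 3 * cos \<theta>) * D \<theta> -
          sin \<theta> ^ 4 * (s\<^sup>2 * (4 * cos \<theta> ^ 3 * (- sin \<theta>)) + 4 * sin \<theta> ^ 3 * cos \<theta>)) / (D \<theta> * D \<theta>)) (at \<theta>)"
        using D[of \<theta>] unfolding X_def D_def
        by (auto intro!: derivative_eq_intros simp: algebra_simps)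
      \<comment> \<open>The factor C^2 + S^2 is 1 at cosine and sine, which leaves a monomial over
        \<open>(D \<theta>)\<^sup>2\<close> as the derivative of \<open>X\<close>.\<close>
      moreover have "(4 * S ^ 3 * C) * (s\<^sup>2 * C ^ 4 + S ^ 4) -
          S ^ 4 * (s\<^sup>2 * (4 * C ^ 3 * (- S)) + 4 * S ^ 3 * C) =
          4 * s\<^sup>2 * S ^ 3 * C ^ 3 * (C\<^sup>2 + S\<^sup>2)" for S C :: real
        by (simp add: algebra_simps power_numeral_reduce)
      from this[of "sin \<theta>" "cos \<theta>"]
      have "(4 * sin \<theta> ^ 3 * cos \<theta>) * D \<theta> -
          sin \<theta> ^ 4 * (s\<^sup>2 * (4 * cos \<theta> ^ 3 * (- sin \<theta>)) + 4 * sin \<theta> ^ 3 * cos \<theta>) =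
          4 * s\<^sup>2 * sin \<theta> ^ 3 * cos \<theta> ^ 3 * ((cos \<theta>)\<^sup>2 + (sin \<theta>)\<^sup>2)"
        by (simp only: D_def)
      ultimately show ?thesis
        by (simp only: sin_cos_squared_add2 mult_1_right power2_eq_square[of "D \<theta>"])
    qed
    have "(G has_real_derivative s powr (3/2) / 4 *
        (h (X \<theta>) * (4 * s\<^sup>2 * sin \<theta> ^ 3 * cos \<theta> ^ 3 / (D \<theta>)\<^sup>2))) (at \<theta>)"
      unfolding G_def by (intro DERIV_cmult DERIV_chain2[OF F' X'])
    moreover have "s powr (3/2) / 4 * (h (X \<theta>) * (4 * s\<^sup>2 * sin \<theta> ^ 3 * cos \<theta> ^ 3 / (D \<theta>)\<^sup>2)) =
      (sin \<theta>)\<^sup>2 * (cos \<theta>) ^ (2 * (k - 2)) / sqrt (((cos \<theta>)\<^sup>2)\<^sup>2 + ((sin \<theta>)\<^sup>2 / s)\<^sup>2) ^ k"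
    proof -
      have e: "((cos \<theta>)\<^sup>2)\<^sup>2 + ((sin \<theta>)\<^sup>2 / s)\<^sup>2 = D \<theta> / s\<^sup>2"
        using s by (simp add: D_def field_simps)
      have "\<sigma> powr (3/2) / 4 * ((S ^ 4 / d) powr (a - 1) * (\<sigma>\<^sup>2 * C ^ 4 / d) powr (b - 1)
            * (4 * \<sigma>\<^sup>2 * S ^ 3 * C ^ 3 / d\<^sup>2)) = S\<^sup>2 * C ^ (2 * (k - 2)) / sqrt (d / \<sigma>\<^sup>2) ^ k"
        if pos: "\<sigma> > 0" "S > 0" "C > 0" "d > 0" for \<sigma> S C d :: real
      proof -
        have k2: "real (k - 2) = real k - 2" using k by (simp add: of_nat_diff)
        \<comment> \<open>Both sides are products of powers of positive quantities, so after taking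
          logarithms the identity is linear in the logarithms of the four variables.\<close>
        have "ln (\<sigma> powr (3/2) / 4 * ((S ^ 4 / d) powr (a - 1) * (\<sigma>\<^sup>2 * C ^ 4 / d) powr (b - 1)
            * (4 * \<sigma>\<^sup>2 * S ^ 3 * C ^ 3 / d\<^sup>2))) = ln (S\<^sup>2 * C ^ (2 * (k - 2)) / sqrt (d / \<sigma>\<^sup>2) ^ k)"
          using pos by (simp add: ln_mult ln_div ln_powr ln_realpow ln_sqrt k2 a_def b_def) (simp add: field_simps)
        then show ?thesis using pos by (subst (asm) ln_inj_iff) auto
      qed
      from this[OF s sc D[of \<theta>]] show ?thesis
        unfolding e h_def X1' by (simp add: X_def)
    qed
    ultimately show ?thesis by (simp add: has_real_derivative_iff_has_vector_derivative)
  qed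
  have "((\<lambda>\<theta>. (sin \<theta>)\<^sup>2 * (cos \<theta>) ^ (2 * (k - 2)) / sqrt (((cos \<theta>)\<^sup>2)\<^sup>2 + ((sin \<theta>)\<^sup>2 / s)\<^sup>2) ^ k)
    has_integral G (pi/2) - G 0) {0..pi/2}"
    by (rule fundamental_theorem_of_calculus_interior[OF _ contG deriv]) simp_all
  moreover have "X (pi/2) = 1" "X 0 = 0" by (simp_all add: X_def D_def)
  moreover have "F 1 = Beta a b" "F 0 = 0"
    using hB by (simp_all add: F_def integral_unique)
  ultimately show ?thesis by (simp add: G_def a_def b_def)
qed

section \<open>Error bounds\<close>

text \<open>The real part of the form of p A + q is at least (p a + q) |x|^2, and p a + q is
  positive because p and q do not both vanish. Solutions are stated in place of an inverse matrix,
  so that a family in \<theta> can be obtained by choice and vectors can be identified by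
  uniqueness.\<close>

lemma shift_inverse:
  assumes A: "A \<in> carrier_mat n n" and a: "a > 0"
    and lb: "\<And>x. x \<in> carrier_vec n \<Longrightarrow> Re (herm_form A x) \<ge> a * (vnorm x)\<^sup>2"
    and pq: "0 \<le> p" "0 \<le> q" "p + q > 0"
  shows "\<And>v. v \<in> carrier_vec n \<Longrightarrow>
      \<exists>x\<in>carrier_vec n. complex_of_real p \<cdot>\<^sub>v (A *\<^sub>v x) + complex_of_real q \<cdot>\<^sub>v x = v"
    and "\<And>x y. x \<in> carrier_vec n \<Longrightarrow> y \<in> carrier_vec n \<Longrightarrow>
      complex_of_real p \<cdot>\<^sub>v (A *\<^sub>v x) + complex_of_real q \<cdot>\<^sub>v x =
      complex_of_real p \<cdot>\<^sub>v (A *\<^sub>v y) + complex_of_real q \<cdot>\<^sub>v y \<Longrightarrow> x = y"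
proof -
  define B where "B = complex_of_real p \<cdot>\<^sub>m A + complex_of_real q \<cdot>\<^sub>m 1\<^sub>m n"
  have B: "B \<in> carrier_mat n n" using A by (auto simp: B_def)
  have Bv: "B *\<^sub>v x = complex_of_real p \<cdot>\<^sub>v (A *\<^sub>v x) + complex_of_real q \<cdot>\<^sub>v x" if x: "x \<in> carrier_vec n" for x
  proof -
    have "B *\<^sub>v x = (complex_of_real p \<cdot>\<^sub>m A) *\<^sub>v x + (complex_of_real q \<cdot>\<^sub>m 1\<^sub>m n) *\<^sub>v x"
      unfolding B_def by (rule add_mult_distrib_mat_vec[OF _ _ x]) (use A in auto)
    then show ?thesis using A x by (simp add: smult_mat_mult_vec[of _ n n] mat_vec_smult_one)
  qed
  have low: "Re (herm_form B x) \<ge> (p * a + q) * (vnorm x)\<^sup>2" if x: "x \<in> carrier_vec n" for x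
  proof -
    have "Re (herm_form B x) = p * Re (herm_form A x) + q * (vnorm x)\<^sup>2"
      using A x by (simp add: herm_form_def Bv cscalar_simps[where n=n] cscalar_self del: of_real_power)
    then show ?thesis
      using mult_left_mono[OF lb[OF x] pq(1)] by (simp add: algebra_simps)
  qed
  have pos: "p * a + q > 0"
    using pq a by (cases "p > 0") (auto intro: add_pos_nonneg)
  have ker: "x = 0\<^sub>v n" if "x \<in> carrier_vec n" "B *\<^sub>v x = 0\<^sub>v n" for x
    by (rule lower_bound_trivial_kernel[OF B pos low that])
  note inv = mat_inverse_exists[OF B ker]
  show "\<exists>x\<in>carrier_vec n. complex_of_real p \<cdot>\<^sub>v (A *\<^sub>v x) + complex_of_real q \<cdot>\<^sub>v x = v"
    if v: "v \<in> carrier_vec n" for v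
  proof
    show "mat_inv B *\<^sub>v v \<in> carrier_vec n" using inv v by simp
    have "B *\<^sub>v (mat_inv B *\<^sub>v v) = v"
      using inv(3) v B inv(2) by (simp flip: assoc_mult_mat_vec)
    then show "complex_of_real p \<cdot>\<^sub>v (A *\<^sub>v (mat_inv B *\<^sub>v v)) + complex_of_real q \<cdot>\<^sub>v (mat_inv B *\<^sub>v v) = v"
      using Bv[of "mat_inv B *\<^sub>v v"] inv v by simp
  qed
  show "x = y" if xy: "x \<in> carrier_vec n" "y \<in> carrier_vec n"
    and eq: "complex_of_real p \<cdot>\<^sub>v (A *\<^sub>v x) + complex_of_real q \<cdot>\<^sub>v x =
      complex_of_real p \<cdot>\<^sub>v (A *\<^sub>v y) + complex_of_real q \<cdot>\<^sub>v y" for x y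
  proof -
    have "mat_inv B *\<^sub>v (B *\<^sub>v x) = mat_inv B *\<^sub>v (B *\<^sub>v y)"
      using eq xy by (simp add: Bv)
    then show ?thesis
      using inv(4) xy B inv(2) by (simp flip: assoc_mult_mat_vec)
  qed
qed

lemma mat_inv_mult_vec:
  assumes A: "A \<in> carrier_mat n n" and a: "a > 0"
    and lb: "\<And>x. x \<in> carrier_vec n \<Longrightarrow> Re (herm_form A x) \<ge> a * (vnorm x)\<^sup>2"
    and v: "v \<in> carrier_vec n"
  shows "mat_inv A *\<^sub>v v \<in> carrier_vec n" "A *\<^sub>v (mat_inv A *\<^sub>v v) = v"
proof -
  have "x = 0\<^sub>v n" if "x \<in> carrier_vec n" "A *\<^sub>v x = 0\<^sub>v n" for x
    by (rule lower_bound_trivial_kernel[OF A a lb that])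
  note inv = mat_inverse_exists[OF A this]
  show "mat_inv A *\<^sub>v v \<in> carrier_vec n" by (rule mult_mat_vec_carrier[OF inv(2) v])
  have "A *\<^sub>v (mat_inv A *\<^sub>v v) = (A * mat_inv A) *\<^sub>v v"
    by (rule assoc_mult_mat_vec[OF A inv(2) v, symmetric])
  also have "\<dots> = v" using inv(3) v by simp
  finally show "A *\<^sub>v (mat_inv A *\<^sub>v v) = v" .
qed

section \<open>Error of the Krylov approximation to the square root of \<open>A\<close>\<close>

context arnoldi_process
begin

lemma arnoldi_H_lower_bound:
  assumes lb: "\<And>x. x \<in> carrier_vec n \<Longrightarrow> Re (herm_form A x) \<ge> a * (vnorm x)\<^sup>2"
    and g: "g \<in> carrier_vec k"
  shows "Re (herm_form H g) \<ge> a * (vnorm g)\<^sup>2"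
  using lb[OF mult_mat_vec_carrier[OF arnoldi_Q_carrier g]]
  by (simp add: herm_form_arnoldi_H[OF g] vnorm_arnoldi_Q[OF g])

lemma arnoldi_H_norm_bound:
  assumes ub: "\<And>x. x \<in> carrier_vec n \<Longrightarrow> vnorm (A *\<^sub>v x) \<le> s * vnorm x"
    and g: "g \<in> carrier_vec k"
  shows "vnorm (H *\<^sub>v g) \<le> s * vnorm g"
  using vnorm_arnoldi_H[OF g] ub[OF mult_mat_vec_carrier[OF arnoldi_Q_carrier g]]
  by (simp add: vnorm_arnoldi_Q[OF g])

text \<open>All shifted residuals are multiples of the residual direction \<open>wv\<close>; by Cramer's rule the
  factor relative to the unshifted system is \<open>p\<^bsup>k-1\<^esup> det H / det (p H + q)\<close>.\<close>

lemma shifted_fom_error: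
  assumes a: "a > 0" and lb: "\<And>x. x \<in> carrier_vec n \<Longrightarrow> Re (herm_form A x) \<ge> a * (vnorm x)\<^sup>2"
    and s: "s > 0" and ub: "\<And>x. x \<in> carrier_vec n \<Longrightarrow> vnorm (A *\<^sub>v x) \<le> s * vnorm x"
    and pq: "0 \<le> p" "0 \<le> q" "p + q > 0" and k2: "k \<ge> 2"
    and z: "z \<in> carrier_vec n" "complex_of_real p \<cdot>\<^sub>v (A *\<^sub>v z) + complex_of_real q \<cdot>\<^sub>v z = b"
    and y: "y \<in> carrier_vec k"
      "complex_of_real p \<cdot>\<^sub>v (H *\<^sub>v y) + complex_of_real q \<cdot>\<^sub>v y = complex_of_real (vnorm b) \<cdot>\<^sub>v unit_vec k 0"
  shows "vnorm (A *\<^sub>v z - Q *\<^sub>v (H *\<^sub>v y)) \<le>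
    q * p ^ (k - 2) / sqrt (p\<^sup>2 + (q / s)\<^sup>2) ^ k * vnorm (fom_error A b k)"
proof -
  note Hlb = arnoldi_H_lower_bound[OF lb] and Hub = arnoldi_H_norm_bound[OF ub]
  note Qc = mult_mat_vec_carrier[OF arnoldi_Q_carrier]
  define g where "g = complex_of_real (vnorm b) \<cdot>\<^sub>v unit_vec k 0"
  have g: "g \<in> carrier_vec k" by (simp add: g_def)
  define y0 where "y0 = mat_inv H *\<^sub>v g"
  have y0: "y0 \<in> carrier_vec k" "H *\<^sub>v y0 = g"
    using mat_inv_mult_vec[OF arnoldi_H_carrier a Hlb g] by (auto simp: y0_def)
  define x0 where "x0 = mat_inv A *\<^sub>v b"
  have x0: "x0 \<in> carrier_vec n" "A *\<^sub>v x0 = b"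
    using mat_inv_mult_vec[OF A a lb b(1)] by (auto simp: x0_def)
  define \<xi> where "\<xi> = x0 - Q *\<^sub>v y0"
  have xi: "\<xi> \<in> carrier_vec n" using x0 Qc[OF y0(1)] by (simp add: \<xi>_def)
  have fom: "fom_error A b k = \<xi>" by (simp add: fom_error_def \<xi>_def x0_def y0_def g_def)
  define B where "B = complex_of_real p \<cdot>\<^sub>m H + complex_of_real q \<cdot>\<^sub>m 1\<^sub>m k"
  define t where "t = sqrt (p\<^sup>2 + (q / s)\<^sup>2)"
  have "p\<^sup>2 + (q / s)\<^sup>2 > 0"
    using pq s by (cases "p > 0") (auto intro: add_pos_nonneg add_nonneg_pos)
  then have t: "t > 0" by (simp add: t_def)
  have tp: "p \<le> t" unfolding t_def by (rule real_le_rsqrt) simp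
  define \<kappa> where "\<kappa> = det H / det B"
  have dB: "det B \<noteq> 0" and "t ^ k * cmod (det H) \<le> cmod (det B)"
    using det_shift_lower_bound[OF arnoldi_H_carrier s a Hlb Hub pq] by (auto simp: B_def t_def)
  then have kb: "cmod \<kappa> \<le> 1 / t ^ k"
    using t by (simp add: \<kappa>_def norm_divide divide_simps mult.commute)
  have "det B * y $ (k - 1) = complex_of_real p ^ (k - 1) * (det H * y0 $ (k - 1))"
    unfolding B_def
    by (rule hessenberg_shift_last_entry[OF arnoldi_H_carrier k _ y0(1) _ y])
      (use y0(2) in \<open>auto simp: arnoldi_H_def arnoldi_h_def g_def\<close>)
  then have \<zeta>: "y $ (k - 1) = complex_of_real p ^ (k - 1) * \<kappa> * y0 $ (k - 1)"
    using dB by (simp add: \<kappa>_def field_simps)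
  note w = arnoldi_residual_carrier
  note rel = arnoldi_relation
  define d where "d = A *\<^sub>v z - Q *\<^sub>v (H *\<^sub>v y)"
  have Hy: "H *\<^sub>v y \<in> carrier_vec k" by (rule mult_mat_vec_carrier[OF arnoldi_H_carrier y(1)])
  have Az: "A *\<^sub>v z \<in> carrier_vec n" using A z by simp
  have d: "d \<in> carrier_vec n" using Az Qc[OF Hy] by (simp add: d_def)
  \<comment> \<open>A \<xi> is the residual of the unshifted system: \<open>b\<close> cancels
    against Q g, and only the \<open>wv\<close> part of the Arnoldi relation is left.\<close>
  have Ax0: "A *\<^sub>v \<xi> = (- (y0 $ (k - 1))) \<cdot>\<^sub>v wv"
  proof -
    have "A *\<^sub>v \<xi> = b - (Q *\<^sub>v g + y0 $ (k - 1) \<cdot>\<^sub>v wv)"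
      using mult_minus_distrib_mat_vec[OF A x0(1) Qc[OF y0(1)]] rel[OF y0(1)]
      by (simp add: \<xi>_def x0 y0)
    also have "Q *\<^sub>v g = b" using arnoldi_Q_b(2) by (simp add: g_def)
    finally show ?thesis using b w by (intro eq_vecI) auto
  qed
  define e where "e = z - Q *\<^sub>v y"
  have e: "e \<in> carrier_vec n" using z Qc[OF y(1)] by (simp add: e_def)
  \<comment> \<open>\<open>Q\<close> carries the reduced shifted system to one with right-hand side
    \<open>b\<close>; subtracting it from the full system links d = A z - Q H y to the plain error e
    = z - Q y.\<close>
  have 1: "complex_of_real p \<cdot>\<^sub>v d + complex_of_real q \<cdot>\<^sub>v e = 0\<^sub>v n"
  proof -
    have "Q *\<^sub>v (complex_of_real p \<cdot>\<^sub>v (H *\<^sub>v y) + complex_of_real q \<cdot>\<^sub>v y) = b"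
      unfolding y(2) by (rule arnoldi_Q_b(2))
    then have "complex_of_real p \<cdot>\<^sub>v (Q *\<^sub>v (H *\<^sub>v y)) + complex_of_real q \<cdot>\<^sub>v (Q *\<^sub>v y) = b"
      using mult_add_distrib_mat_vec[OF arnoldi_Q_carrier smult_carrier_vec[THEN iffD2, OF Hy]
          smult_carrier_vec[THEN iffD2, OF y(1)]]
      by (simp only: mult_mat_vec[OF arnoldi_Q_carrier Hy] mult_mat_vec[OF arnoldi_Q_carrier y(1)])
    with z(2) have eq: "complex_of_real p \<cdot>\<^sub>v (A *\<^sub>v z) + complex_of_real q \<cdot>\<^sub>v z =
        complex_of_real p \<cdot>\<^sub>v (Q *\<^sub>v (H *\<^sub>v y)) + complex_of_real q \<cdot>\<^sub>v (Q *\<^sub>v y)" by simp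
    show ?thesis
    proof (rule eq_vecI)
      fix i assume "i < dim_vec (0\<^sub>v n :: complex vec)"
      then have i: "i < n" by simp
      have "complex_of_real p * (A *\<^sub>v z) $ i + complex_of_real q * z $ i =
        complex_of_real p * (Q *\<^sub>v (H *\<^sub>v y)) $ i + complex_of_real q * (Q *\<^sub>v y) $ i"
        using arg_cong[OF eq, of "\<lambda>v. v $ i"] i carrier_vecD[OF Az] carrier_vecD[OF z(1)]
          carrier_vecD[OF Qc[OF Hy]] carrier_vecD[OF Qc[OF y(1)]] A arnoldi_Q_carrier
        by (simp del: index_mult_mat_vec)
      then show "(complex_of_real p \<cdot>\<^sub>v d + complex_of_real q \<cdot>\<^sub>v e) $ i = 0\<^sub>v n $ i"
        using i carrier_vecD[OF Az] carrier_vecD[OF z(1)]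
          carrier_vecD[OF Qc[OF Hy]] carrier_vecD[OF Qc[OF y(1)]] A arnoldi_Q_carrier
        by (simp add: d_def e_def algebra_simps del: index_mult_mat_vec)
    qed (use d e in simp)
  qed
  have Ae: "A *\<^sub>v e = d - y $ (k - 1) \<cdot>\<^sub>v wv"
    unfolding e_def d_def mult_minus_distrib_mat_vec[OF A z(1) Qc[OF y(1)]] rel[OF y(1)]
    by (rule vec_diff_add[OF Az Qc[OF Hy] smult_carrier_vec[THEN iffD2, OF w]])
  have Ad: "A *\<^sub>v d \<in> carrier_vec n" "A *\<^sub>v e \<in> carrier_vec n" using A d e by auto
  have "complex_of_real p \<cdot>\<^sub>v (A *\<^sub>v d) + complex_of_real q \<cdot>\<^sub>v (A *\<^sub>v e) = A *\<^sub>v 0\<^sub>v n"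
    unfolding 1[symmetric] using A d e
    by (simp add: mult_add_distrib_mat_vec[of _ n n] mult_mat_vec[of _ n n])
  \<comment> \<open>Substituting \<open>Ae\<close> eliminates \<open>e\<close> and leaves p A d + q
    d = q y_(k-1) w, a shifted system for \<open>d\<close> alone.\<close>
  then have 2: "complex_of_real p \<cdot>\<^sub>v (A *\<^sub>v d) + complex_of_real q \<cdot>\<^sub>v (d - y $ (k - 1) \<cdot>\<^sub>v wv) = 0\<^sub>v n"
    using A by (simp add: Ae mult_mat_vec_zero)
  obtain x where x: "x \<in> carrier_vec n" "complex_of_real p \<cdot>\<^sub>v (A *\<^sub>v x) + complex_of_real q \<cdot>\<^sub>v x = \<xi>"
    using shift_inverse(1)[OF A a lb pq xi] by blast
  have Ax: "A *\<^sub>v x \<in> carrier_vec n" using A x by simp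
  define \<gamma> where "\<gamma> = - complex_of_real q * complex_of_real p ^ (k - 1) * \<kappa>"
  have AAx: "complex_of_real p \<cdot>\<^sub>v (A *\<^sub>v (A *\<^sub>v x)) + complex_of_real q \<cdot>\<^sub>v (A *\<^sub>v x) = A *\<^sub>v \<xi>"
    unfolding x(2)[symmetric] using A x(1) Ax
    by (simp add: mult_add_distrib_mat_vec[of _ n n] mult_mat_vec[of _ n n])
  \<comment> \<open>\<gamma> is chosen so that \<gamma> A x and \<open>d\<close> have the same image
    under p A + q: that of A x is A \<xi> = -y0_(k-1) w, whence the minus sign, and y_(k-1) =
    p^(k-1) \<kappa> y0_(k-1).\<close>
  have dx: "d = \<gamma> \<cdot>\<^sub>v (A *\<^sub>v x)"
  proof (rule shift_inverse(2)[OF A a lb pq d])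
    show "\<gamma> \<cdot>\<^sub>v (A *\<^sub>v x) \<in> carrier_vec n" using Ax by simp
    have AAc: "A *\<^sub>v (A *\<^sub>v x) \<in> carrier_vec n" using A Ax by simp
    have "complex_of_real p \<cdot>\<^sub>v (A *\<^sub>v (\<gamma> \<cdot>\<^sub>v (A *\<^sub>v x))) + complex_of_real q \<cdot>\<^sub>v (\<gamma> \<cdot>\<^sub>v (A *\<^sub>v x)) =
        \<gamma> \<cdot>\<^sub>v (A *\<^sub>v \<xi>)"
      unfolding AAx[symmetric] mult_mat_vec[OF A Ax] using Ax AAc
      by (intro eq_vecI) (auto simp: algebra_simps simp del: index_mult_mat_vec)
    also have "\<dots> = (complex_of_real q * y $ (k - 1)) \<cdot>\<^sub>v wv"
      unfolding Ax0 \<gamma>_def \<zeta> by (simp add: smult_smult_assoc mult_ac)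
    also have "\<dots> = complex_of_real p \<cdot>\<^sub>v (A *\<^sub>v d) + complex_of_real q \<cdot>\<^sub>v d"
    proof (rule eq_vecI)
      fix i assume "i < dim_vec (complex_of_real p \<cdot>\<^sub>v (A *\<^sub>v d) + complex_of_real q \<cdot>\<^sub>v d)"
      then have i: "i < n" using d by simp
      then show "((complex_of_real q * y $ (k - 1)) \<cdot>\<^sub>v wv) $ i =
          (complex_of_real p \<cdot>\<^sub>v (A *\<^sub>v d) + complex_of_real q \<cdot>\<^sub>v d) $ i"
        using arg_cong[OF 2, of "\<lambda>v. v $ i"] carrier_vecD[OF d] carrier_vecD[OF w] carrier_vecD[OF Ad(1)] A
        by (simp add: algebra_simps del: index_mult_mat_vec)
    qed (use d w in simp)
    finally show "complex_of_real p \<cdot>\<^sub>v (A *\<^sub>v d) + complex_of_real q \<cdot>\<^sub>v d =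
        complex_of_real p \<cdot>\<^sub>v (A *\<^sub>v (\<gamma> \<cdot>\<^sub>v (A *\<^sub>v x))) + complex_of_real q \<cdot>\<^sub>v (\<gamma> \<cdot>\<^sub>v (A *\<^sub>v x))" ..
  qed
  have re: "0 \<le> Re (herm_form A x)"
  proof -
    have "0 \<le> a * (vnorm x)\<^sup>2" using a by simp
    then show ?thesis using lb[OF x(1)] by linarith
  qed
  have "t * vnorm (A *\<^sub>v x) \<le> vnorm \<xi>"
    using vnorm_shift_lower_bound[OF A x(1) re s ub[OF x(1)] pq(1,2)] by (simp add: x(2) t_def)
  moreover have "p * vnorm (A *\<^sub>v x) \<le> t * vnorm (A *\<^sub>v x)" using tp by (intro mult_right_mono) auto
  ultimately have pA: "p * vnorm (A *\<^sub>v x) \<le> vnorm \<xi>" by linarith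
  have pk: "p ^ (k - 1) = p ^ (k - 2) * p"
  proof -
    have "k - 1 = Suc (k - 2)" using k2 by simp
    then show ?thesis by (simp only: power_Suc2)
  qed
  have "vnorm d = q * p ^ (k - 1) * cmod \<kappa> * vnorm (A *\<^sub>v x)"
    using pq by (simp add: dx vnorm_smult \<gamma>_def norm_mult norm_power)
  also have "\<dots> = (q * p ^ (k - 2)) * cmod \<kappa> * (p * vnorm (A *\<^sub>v x))"
    unfolding pk by (simp only: mult_ac)
  also have "\<dots> \<le> (q * p ^ (k - 2)) * (1 / t ^ k) * vnorm \<xi>"
    using pq kb pA t by (intro mult_mono) auto
  finally show ?thesis by (simp add: d_def fom t_def)
qed

text \<open>The difference of the integrals for \<open>A\<close> and \<open>H\<close> is paired with
  the error \<open>E\<close> itself, so the left side becomes pi/2 |E|^2, while Cauchy-Schwarz under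
  the integral leaves one factor |E| on the right to cancel.\<close>

lemma arnoldi_sqrt_error:
  assumes a: "a > 0" and lb: "\<And>x. x \<in> carrier_vec n \<Longrightarrow> Re (herm_form A x) \<ge> a * (vnorm x)\<^sup>2"
    and s: "s > 0" and ub: "\<And>x. x \<in> carrier_vec n \<Longrightarrow> vnorm (A *\<^sub>v x) \<le> s * vnorm x"
    and k2: "k \<ge> 2"
  shows "vnorm (mat_sqrt A *\<^sub>v b - Arn_sqrt A b k) \<le>
    Beta (3/4) (real k / 2 - 3/4) / (2 * pi) * s powr (3/2) * vnorm (fom_error A b k)"
proof -
  note Hlb = arnoldi_H_lower_bound[OF lb] and Hub = arnoldi_H_norm_bound[OF ub]
  note Qc = mult_mat_vec_carrier[OF arnoldi_Q_carrier]
  have n: "n > 0" using b by (cases "n = 0") auto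
  define g where "g = complex_of_real (vnorm b) \<cdot>\<^sub>v unit_vec k 0"
  have g: "g \<in> carrier_vec k" by (simp add: g_def)
  define Y where "Y = mat_sqrt A"
  define Z where "Z = mat_sqrt H"
  note Y = mat_sqrt[OF A n positive_definiteI[OF A a lb], folded Y_def]
  note Z = mat_sqrt[OF arnoldi_H_carrier k positive_definiteI[OF arnoldi_H_carrier a Hlb], folded Z_def]
  obtain dY where dY: "dY > 0" "\<And>x. x \<in> carrier_vec n \<Longrightarrow> Re (herm_form Y x) \<ge> dY * (vnorm x)\<^sup>2"
    using positive_definite_lower_bound[OF Y(1) n Y(2)] by metis
  obtain dZ where dZ: "dZ > 0" "\<And>x. x \<in> carrier_vec k \<Longrightarrow> Re (herm_form Z x) \<ge> dZ * (vnorm x)\<^sup>2"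
    using positive_definite_lower_bound[OF Z(1) k Z(2)] by metis
  define E where "E = Y *\<^sub>v b - Q *\<^sub>v (Z *\<^sub>v g)"
  have Zg: "Z *\<^sub>v g \<in> carrier_vec k" by (rule mult_mat_vec_carrier[OF Z(1) g])
  have Yb: "Y *\<^sub>v b \<in> carrier_vec n" by (rule mult_mat_vec_carrier[OF Y(1) b(1)])
  have E: "E \<in> carrier_vec n" using Yb Qc[OF Zg] by (simp add: E_def)
  have QE: "mat_adjoint Q *\<^sub>v E \<in> carrier_vec k"
    by (rule mult_mat_vec_carrier[OF mat_adjoint_carrier[OF arnoldi_Q_carrier] E])
  have pq: "0 \<le> (cos \<theta>)\<^sup>2" "0 \<le> (sin \<theta>)\<^sup>2" "(cos \<theta>)\<^sup>2 + (sin \<theta>)\<^sup>2 > 0" for \<theta> :: real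
    by simp_all
  \<comment> \<open>The solutions are chosen pointwise; \<open>sqrt_integral_representation\<close>
    asks for no regularity of \<open>z\<close> in \<theta>.\<close>
  obtain z where z: "\<And>\<theta>. z \<theta> \<in> carrier_vec n"
    "\<And>\<theta>. complex_of_real ((cos \<theta>)\<^sup>2) \<cdot>\<^sub>v (A *\<^sub>v z \<theta>) + complex_of_real ((sin \<theta>)\<^sup>2) \<cdot>\<^sub>v z \<theta> = b"
    using shift_inverse(1)[OF A a lb pq b(1)] by metis
  obtain y where y: "\<And>\<theta>. y \<theta> \<in> carrier_vec k"
    "\<And>\<theta>. complex_of_real ((cos \<theta>)\<^sup>2) \<cdot>\<^sub>v (H *\<^sub>v y \<theta>) + complex_of_real ((sin \<theta>)\<^sup>2) \<cdot>\<^sub>v y \<theta> = g"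
    using shift_inverse(1)[OF arnoldi_H_carrier a Hlb pq g] by metis
  have Hy: "H *\<^sub>v y \<theta> \<in> carrier_vec k" for \<theta> by (rule mult_mat_vec_carrier[OF arnoldi_H_carrier y(1)])
  have Az: "A *\<^sub>v z \<theta> \<in> carrier_vec n" for \<theta> by (rule mult_mat_vec_carrier[OF A z(1)])
  define f where "f = (\<lambda>\<theta>. (A *\<^sub>v z \<theta> - Q *\<^sub>v (H *\<^sub>v y \<theta>)) \<bullet>c E)"
  have I1: "((\<lambda>\<theta>. (A *\<^sub>v z \<theta>) \<bullet>c E) has_integral (complex_of_real (pi / 2) * ((Y *\<^sub>v b) \<bullet>c E))) {0..pi/2}"
    by (rule sqrt_integral_representation[OF Y(1) A Y(3) dY a lb b(1) E z])
  \<comment> \<open>\<open>Q\<close> is moved onto the test vector, so that the representation can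
    be applied to \<open>H\<close> in dimension \<open>k\<close>.\<close>
  have "((\<lambda>\<theta>. (H *\<^sub>v y \<theta>) \<bullet>c (mat_adjoint Q *\<^sub>v E)) has_integral
      (complex_of_real (pi / 2) * ((Z *\<^sub>v g) \<bullet>c (mat_adjoint Q *\<^sub>v E)))) {0..pi/2}"
    by (rule sqrt_integral_representation[OF Z(1) arnoldi_H_carrier Z(3) dZ a Hlb g QE y])
  then have I2: "((\<lambda>\<theta>. (Q *\<^sub>v (H *\<^sub>v y \<theta>)) \<bullet>c E) has_integral
      (complex_of_real (pi / 2) * ((Q *\<^sub>v (Z *\<^sub>v g)) \<bullet>c E))) {0..pi/2}"
    by (simp only: cscalar_adjoint[OF arnoldi_Q_carrier Hy E] cscalar_adjoint[OF arnoldi_Q_carrier Zg E])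
  have feq: "f \<theta> = (A *\<^sub>v z \<theta>) \<bullet>c E - (Q *\<^sub>v (H *\<^sub>v y \<theta>)) \<bullet>c E" for \<theta>
    unfolding f_def by (rule cscalar_diff_left[OF Az Qc[OF Hy] E])
  have "complex_of_real (pi / 2) * ((Y *\<^sub>v b) \<bullet>c E) - complex_of_real (pi / 2) * ((Q *\<^sub>v (Z *\<^sub>v g)) \<bullet>c E)
      = complex_of_real (pi / 2) * (E \<bullet>c E)"
    using cscalar_diff_left[OF Yb Qc[OF Zg] E] by (simp add: E_def[symmetric] right_diff_distrib[symmetric])
  also have "\<dots> = complex_of_real (pi / 2 * (vnorm E)\<^sup>2)"
    by (simp add: cscalar_self)
  finally have fint: "(f has_integral complex_of_real (pi / 2 * (vnorm E)\<^sup>2)) {0..pi/2}"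
    using has_integral_diff[OF I1 I2] unfolding feq[abs_def] by (simp only:)
  define h where "h = (\<lambda>\<theta>. (sin \<theta>)\<^sup>2 * (cos \<theta>) ^ (2 * (k - 2)) / sqrt (((cos \<theta>)\<^sup>2)\<^sup>2 + ((sin \<theta>)\<^sup>2 / s)\<^sup>2) ^ k)"
  define \<beta> where "\<beta> = s powr (3/2) / 4 * Beta (3/4) (real k / 2 - 3/4)"
  have hint: "((\<lambda>\<theta>. h \<theta> * (vnorm (fom_error A b k) * vnorm E)) has_integral
      \<beta> * (vnorm (fom_error A b k) * vnorm E)) {0..pi/2}"
    unfolding h_def \<beta>_def by (intro has_integral_mult_left trig_Beta_integral[OF s k2])
  have fb: "cmod (f \<theta>) \<le> h \<theta> * (vnorm (fom_error A b k) * vnorm E)" for \<theta>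
  proof -
    have "vnorm (A *\<^sub>v z \<theta> - Q *\<^sub>v (H *\<^sub>v y \<theta>)) \<le> h \<theta> * vnorm (fom_error A b k)"
      using shifted_fom_error[OF a lb s ub pq k2 z y[unfolded g_def]] by (simp add: h_def power_mult)
    moreover have "cmod (f \<theta>) \<le> vnorm (A *\<^sub>v z \<theta> - Q *\<^sub>v (H *\<^sub>v y \<theta>)) * vnorm E"
      unfolding f_def using Az Qc[OF Hy] E by (intro cscalar_Cauchy_Schwarz) auto
    ultimately show ?thesis
      using mult_right_mono[OF _ vnorm_nonneg[of E]] by (fastforce simp: mult.assoc)
  qed
  have "cmod (integral {0..pi/2} f) \<le> integral {0..pi/2} (\<lambda>\<theta>. h \<theta> * (vnorm (fom_error A b k) * vnorm E))"
    using fint hint fb by (intro integral_norm_bound_integral) auto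
  then have "pi / 2 * (vnorm E)\<^sup>2 \<le> \<beta> * (vnorm (fom_error A b k) * vnorm E)"
    unfolding integral_unique[OF fint] integral_unique[OF hint] norm_of_real by simp
  then have le: "vnorm E * (pi / 2 * vnorm E) \<le> vnorm E * (\<beta> * vnorm (fom_error A b k))"
    by (simp add: power2_eq_square mult_ac)
  have "\<beta> \<ge> 0"
    using k2 Gamma_real_pos[of "3/4"] Gamma_real_pos[of "real k / 2 - 3/4"] Gamma_real_pos[of "real k / 2"]
    by (simp add: \<beta>_def Beta_def)
  then have "pi / 2 * vnorm E \<le> \<beta> * vnorm (fom_error A b k)"
    using le vnorm_nonneg[of E] by (cases "vnorm E = 0") auto
  \<comment> \<open>2/pi times the 1/4 in \<beta> gives the 1/(2 pi) of the statement.\<close>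
  then have "vnorm E \<le> \<beta> * vnorm (fom_error A b k) * 2 / pi"
    by (simp add: field_simps)
  moreover have "mat_sqrt A *\<^sub>v b - Arn_sqrt A b k = E"
    by (simp add: E_def Arn_sqrt_def Y_def Z_def arnoldi_Q_b(1) g_def)
  ultimately show ?thesis by (simp add: \<beta>_def field_simps)
qed

end

text \<open>By \<open>sqrt_lower_bound\<close> the form bounds l^2 and m^2 of the matrices become l
  and m for their roots; the sum l + m bounds the Sylvester operator from below and hence is the
  denominator.\<close>

lemma sqrt_perturbation_bound:
  fixes A B :: "complex mat"
  assumes A: "A \<in> carrier_mat n n" and B: "B \<in> carrier_mat n n" and n: "n > 0"
    and l: "l > 0" "\<And>x. x \<in> carrier_vec n \<Longrightarrow> vnorm x = 1 \<Longrightarrow> Re (herm_form A x) \<ge> l\<^sup>2"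
    and m: "m > 0" "\<And>x. x \<in> carrier_vec n \<Longrightarrow> vnorm x = 1 \<Longrightarrow> Re (herm_form B x) \<ge> m\<^sup>2"
    and e: "\<And>x. x \<in> carrier_vec n \<Longrightarrow> vnorm ((A - B) *\<^sub>v x) \<le> e * vnorm x"
    and x: "x \<in> carrier_vec n"
  shows "vnorm (mat_sqrt A *\<^sub>v x - mat_sqrt B *\<^sub>v x) \<le> e / (l + m) * vnorm x"
proof -
  have pdA: "positive_definite A"
    using l herm_form_lower_bound[OF A l(2)] by (intro positive_definiteI[OF A, of "l\<^sup>2"]) auto
  have pdB: "positive_definite B"
    using m herm_form_lower_bound[OF B m(2)] by (intro positive_definiteI[OF B, of "m\<^sup>2"]) auto
  define X where "X = mat_sqrt A"
  define Y where "Y = mat_sqrt B"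
  note X = mat_sqrt[OF A n pdA, folded X_def] and Y = mat_sqrt[OF B n pdB, folded Y_def]
  have D: "X - Y \<in> carrier_mat n n" and E: "A - B \<in> carrier_mat n n"
    using Y B by (auto intro: minus_carrier_mat)
  have Dv: "(X - Y) *\<^sub>v v = X *\<^sub>v v - Y *\<^sub>v v" if "v \<in> carrier_vec n" for v
    using X Y that by (simp add: minus_mult_distrib_mat_vec[of _ n n])
  have "(l + m) * vnorm ((X - Y) *\<^sub>v x) \<le> e * vnorm x"
  proof (rule sylvester_bound[OF X(1) Y(1) D E n _ _ e _ _ x])
    show "l * (vnorm v)\<^sup>2 \<le> Re (herm_form X v)" if "v \<in> carrier_vec n" for v
      using sqrt_lower_bound[OF X(1) n X(2) l(1) _ that] l(2) by (simp add: X(3))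
    show "m * (vnorm v)\<^sup>2 \<le> Re (herm_form Y v)" if "v \<in> carrier_vec n" for v
      using sqrt_lower_bound[OF Y(1) n Y(2) m(1) _ that] m(2) by (simp add: Y(3))
    show "X *\<^sub>v ((X - Y) *\<^sub>v v) + (X - Y) *\<^sub>v (Y *\<^sub>v v) = (A - B) *\<^sub>v v" if v: "v \<in> carrier_vec n" for v
    proof -
      have c: "X *\<^sub>v v \<in> carrier_vec n" "Y *\<^sub>v v \<in> carrier_vec n" using X Y v by auto
      have XX: "X *\<^sub>v (X *\<^sub>v v) = A *\<^sub>v v" using X v by (metis assoc_mult_mat_vec)
      have YY: "Y *\<^sub>v (Y *\<^sub>v v) = B *\<^sub>v v" using Y v by (metis assoc_mult_mat_vec)
      have c2: "X *\<^sub>v (Y *\<^sub>v v) \<in> carrier_vec n" "A *\<^sub>v v \<in> carrier_vec n" "B *\<^sub>v v \<in> carrier_vec n"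
        using X c A B v by auto
      have "X *\<^sub>v ((X - Y) *\<^sub>v v) = A *\<^sub>v v - X *\<^sub>v (Y *\<^sub>v v)"
        using mult_minus_distrib_mat_vec[OF X(1) c] by (simp add: Dv[OF v] XX)
      moreover have "(X - Y) *\<^sub>v (Y *\<^sub>v v) = X *\<^sub>v (Y *\<^sub>v v) - B *\<^sub>v v"
        by (simp add: Dv[OF c(2)] YY)
      moreover have "(A - B) *\<^sub>v v = A *\<^sub>v v - B *\<^sub>v v"
        by (rule minus_mult_distrib_mat_vec[OF A B v])
      ultimately show ?thesis using vec_diff_add_diff[OF c2(2,1,3)] by simp
    qed
  qed (use l m in auto)
  then show ?thesis
    using l(1) m(1) unfolding Dv[OF x] unfolding X_def Y_def by (simp add: pos_le_divide_eq mult.commute)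
qed

theorem corollary3p12:
  fixes M Mt :: "complex mat" and b :: "complex vec"
    and n k :: nat and \<mu>1 \<mu>2 \<epsilon> :: real
  assumes "M \<in> carrier_mat n n"
    and "positive_definite M"
    and "\<mu>1 > 0"
    and "\<And>x. x \<in> carrier_vec n \<Longrightarrow> vnorm x = 1 \<Longrightarrow> Re (herm_form M x) \<ge> \<mu>1\<^sup>2"
    and "b \<in> carrier_vec n"
    and "b \<noteq> 0\<^sub>v n"
    and "Mt \<in> carrier_mat n n"
    and "\<mu>2 > 0"
    and "\<And>x. x \<in> carrier_vec n \<Longrightarrow> vnorm x = 1 \<Longrightarrow> Re (herm_form Mt x) \<ge> \<mu>2\<^sup>2"
    and "\<epsilon> > 0"
    and "spectral_norm (M - Mt) \<le> \<epsilon> * spectral_norm M"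
    and "k \<ge> 2"
    and "arnoldi_defined Mt b k"
  shows "vnorm (mat_sqrt M *\<^sub>v b - Arn_sqrt Mt b k)
    \<le> \<epsilon> * sigma_max M / (\<mu>1 + \<mu>2) * vnorm b
      + Gamma (3/4) * (1 + \<epsilon>) powr (3/2) / (2 powr (1/4) * pi)
        * (2 * real k / (2 * real k - 3))
        * sigma_max M powr (3/2) * real k powr (-3/4) * vnorm (fom_error Mt b k)"
proof -
  note M = assms(1) and Mt = assms(7) and b = assms(5,6)
  interpret arnoldi_process Mt b n k
    using assms by unfold_locales auto
  have n: "n > 0" using b by (cases "n = 0") auto
  let ?S = "sigma_max M"
  have normM: "vnorm (M *\<^sub>v x) \<le> ?S * vnorm x" if "x \<in> carrier_vec n" for x
    by (rule order_trans[OF spectral_norm_bound[OF M n that]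
          mult_right_mono[OF spectral_norm_le_sigma_max[OF M n] vnorm_nonneg]])
  have normD: "vnorm ((M - Mt) *\<^sub>v x) \<le> (\<epsilon> * ?S) * vnorm x" if "x \<in> carrier_vec n" for x
  proof -
    have "spectral_norm (M - Mt) \<le> \<epsilon> * ?S"
      using assms(11) mult_left_mono[OF spectral_norm_le_sigma_max[OF M n], of \<epsilon>] assms(10) by linarith
    from mult_right_mono[OF this vnorm_nonneg] show ?thesis
      by (rule order_trans[OF spectral_norm_bound[OF minus_carrier_mat[OF Mt] n that]])
  qed
  \<comment> \<open>\<open>arnoldi_sqrt_error\<close> needs a positive norm bound; positivity
    follows by testing the form of \<open>M\<close> on one unit vector.\<close>
  have S: "?S > 0"
  proof -
    let ?u = "unit_vec n 0 :: complex vec"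
    have u: "?u \<in> carrier_vec n" "vnorm ?u = 1" using n by (auto intro: vnorm_unit_vec)
    have "0 < \<mu>1\<^sup>2" using assms(3) by simp
    also have "\<dots> \<le> Re (herm_form M ?u)" using assms(4)[OF u] .
    also have "\<dots> \<le> vnorm (M *\<^sub>v ?u) * vnorm ?u"
      unfolding herm_form_def by (rule Re_cscalar_le[OF mult_mat_vec_carrier[OF M u(1)] u(1)])
    also have "\<dots> \<le> ?S" using normM[OF u(1)] u(2) by simp
    finally show ?thesis .
  qed
  have normMt: "vnorm (Mt *\<^sub>v x) \<le> ((1 + \<epsilon>) * ?S) * vnorm x" if x: "x \<in> carrier_vec n" for x
  proof -
    have c: "M *\<^sub>v x \<in> carrier_vec n" "Mt *\<^sub>v x \<in> carrier_vec n" "(M - Mt) *\<^sub>v x \<in> carrier_vec n"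
      using M Mt mult_mat_vec_carrier[OF minus_carrier_mat[OF Mt] x] x by auto
    have "Mt *\<^sub>v x = M *\<^sub>v x - (M - Mt) *\<^sub>v x"
      unfolding minus_mult_distrib_mat_vec[OF M Mt x] using c by (intro eq_vecI) (auto simp del: index_mult_mat_vec)
    then show ?thesis
      using vnorm_triangle_minus[OF c(1,3)] normM[OF x] normD[OF x] by (simp add: algebra_simps)
  qed
  let ?X = "mat_sqrt M" and ?Y = "mat_sqrt Mt"
  have Mtlb: "Re (herm_form Mt x) \<ge> \<mu>2\<^sup>2 * (vnorm x)\<^sup>2" if "x \<in> carrier_vec n" for x
    by (rule herm_form_lower_bound[OF Mt assms(9) that])
  have pos2: "\<mu>2\<^sup>2 > 0" using assms(8) by simp
  have pS: "(1 + \<epsilon>) * ?S > 0" using S assms(10) by simp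
  have e1: "vnorm (?X *\<^sub>v b - ?Y *\<^sub>v b) \<le> \<epsilon> * ?S / (\<mu>1 + \<mu>2) * vnorm b"
    using assms by (intro sqrt_perturbation_bound[OF M Mt n _ _ _ _ normD]) auto
  have e2: "vnorm (?Y *\<^sub>v b - Arn_sqrt Mt b k) \<le>
      Beta (3/4) (real k / 2 - 3/4) / (2 * pi) * ((1 + \<epsilon>) * ?S) powr (3/2) * vnorm (fom_error Mt b k)"
    by (rule arnoldi_sqrt_error[OF pos2 Mtlb pS normMt assms(12)])
  also have "\<dots> \<le> Gamma (3/4) / (2 powr (1/4) * pi) * (2 * real k / (2 * real k - 3)) * real k powr (-3/4)
      * ((1 + \<epsilon>) * ?S) powr (3/2) * vnorm (fom_error Mt b k)"
    by (intro mult_right_mono Beta_half_shift_bound assms(12)) auto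
  also have "((1 + \<epsilon>) * ?S) powr (3/2) = (1 + \<epsilon>) powr (3/2) * ?S powr (3/2)"
    using S assms(10) by (simp add: powr_mult)
  finally have e2': "vnorm (?Y *\<^sub>v b - Arn_sqrt Mt b k) \<le>
      Gamma (3/4) * (1 + \<epsilon>) powr (3/2) / (2 powr (1/4) * pi)
        * (2 * real k / (2 * real k - 3))
        * ?S powr (3/2) * real k powr (-3/4) * vnorm (fom_error Mt b k)"
    by (simp add: mult_ac)
  have Yc: "?Y \<in> carrier_mat n n"
    by (rule mat_sqrt(1)[OF Mt n positive_definiteI[OF Mt pos2 Mtlb]])
  have Xc: "?X \<in> carrier_mat n n"
    by (rule mat_sqrt(1)[OF M n assms(2)])
  have "Arn_sqrt Mt b k \<in> carrier_vec n"
    by (rule carrier_vecI) (simp add: Arn_sqrt_def carrier_matD[OF arnoldi_Q_carrier])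
  note c = mult_mat_vec_carrier[OF Xc b(1)] mult_mat_vec_carrier[OF Yc b(1)] this
  have "?X *\<^sub>v b - Arn_sqrt Mt b k = (?X *\<^sub>v b - ?Y *\<^sub>v b) + (?Y *\<^sub>v b - Arn_sqrt Mt b k)"
    by (rule vec_diff_add_diff[OF c, symmetric])
  then have "vnorm (?X *\<^sub>v b - Arn_sqrt Mt b k) \<le> vnorm (?X *\<^sub>v b - ?Y *\<^sub>v b) + vnorm (?Y *\<^sub>v b - Arn_sqrt Mt b k)"
    using vnorm_triangle[of "?X *\<^sub>v b - ?Y *\<^sub>v b" n "?Y *\<^sub>v b - Arn_sqrt Mt b k"] c by simp
  then show ?thesis using e1 e2' by linarith
qed

end
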